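(* Let $s_1=\sigma_1+it_1$, $s_2=\sigma_2+it_2\in\mathbb{C}$, $T\ge2$, and \[ I^{[2]}(T)=\int_2^T|\zeta_2(s_1,s_2)|^2\,dt_2, \] where $s_1$ and $\sigma_2$ are fixed and only $t_2$ varies. Assume that as $t_2$ moves from $2$ to $T$ the point $(s_1,s_2)$ does not meet the singularities of $\zeta_2$. Let \[ \zeta_2^{[2]}(s_1,2\sigma_2)=\sum_{n=2}^\infty\Bigl|\sum_{m=1}^{n-1}\frac{1}{m^{s_1}}\Bigr|^2\frac{1}{n^{2\sigma_2}}, \] a series which converges for $\sigma_1+\sigma_2>3/2$ and $\sigma_2>1/2$. Then: (i) if $\sigma_2>1$ and $\sigma_1+\sigma_2>2$, $I^{[2]}(T)=\zeta_2^{[2]}(s_1,2\sigma_2)T+O(1)$, where the implied constant depends on $s_1$; (ii) if $\sigma_1>1$ and $1/2<\sigma_2\le1$, $I^{[2]}(T)=\zeta_2^{[2]}(s_1,2\sigma_2)T+O(T^{2-2\sigma_2})$ for $\sigma_2\ne1$ and $+O((\log T)^2)$ for $\sigma_2=1$; (iii) if $\sigma_1\le1$, $3/2<\sigma_1+\sigma_2\le2$ and $s_1\neq1$, $I^{[2]}(T)=\zeta_2^{[2]}(s_1,2\sigma_2)T+O(T^{4-2\sigma_1-2\sigma_2})$ for $\sigma_1+\sigma_2\neq2$ and $+O((\log T)^2)$ for $\sigma_1+\sigma_2=2$; (iv) if $s_1=1$ and $1/2<\sigma_2\le1$, $I^{[2]}(T)=\zeta_2^{[2]}(s_1,2\sigma_2)T+O(T^{2-2\sigma_2}(\log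 T)^2)$ for $\sigma_2\neq1$ and $+O((\log T)^4)$ for $\sigma_2=1$; (v) if $\sigma_1>1$ and $\sigma_2=1/2$, $I^{[2]}(T)=|\zeta(s_1)|^2T\log T+O(T)$; (vi) if $\sigma_1+\sigma_2=3/2$ and $\sigma_2>1/2$, $I^{[2]}(T)=|s_1-1|^{-2}T\log T+O(T)$; (vii) if $\sigma_2=1/2$, $\sigma_1=1$ and $s_1\neq1$, $I^{[2]}(T)=(|s_1-1|^{-2}+|\zeta(s_1)|^2)T\log T+O(T)$; (viii) if $\sigma_2=1/2$ and $s_1=1$, $I^{[2]}(T)=\frac{T(\log T)^3}{3}+O(T(\log T)^2)$.
   Context: The Euler double zeta-function is $\zeta_2(s_1,s_2)=\sum_{m=1}^\infty m^{-s_1}\sum_{n=1}^\infty (m+n)^{-s_2}$, absolutely convergent for $\Re s_2>1$, $\Re(s_1+s_2)>2$; it continues meromorphically to $\mathbb{C}^2$ and is holomorphic on $\{(s_1,s_2): s_2\neq 1,\ s_1+s_2\notin\{2,1,0,-2,-4,-6,\dots\}\}$. "Singularities" refers to the complement of this set. $\zeta$ is the Riemann zeta-function. Implied constants are independent of $T$. *)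

theory Defs
  imports "HOL-Analysis.Analysis" "HOL-Library.Landau_Symbols"
begin

text \<open>
  The Riemann zeta-function, as the holomorphic continuation of its Dirichlet series to
  the complex plane without 1. The continuation is unique on that set; the value at 1 is
  unspecified.
\<close>

definition riemann_zeta :: "complex \<Rightarrow> complex" where
  "riemann_zeta = (SOME f. f holomorphic_on - {1} \<and>
     (\<forall>s. Re s > 1 \<longrightarrow> f s = (\<Sum>n. 1 / of_nat (Suc n) powr s)))"

text \<open>
  Holomorphy of a function of two complex variables on an open set: at each point there is
  a complex-linear Frechet derivative.
\<close>

definition holomorphic2_on :: "(complex \<times> complex \<Rightarrow> complex) \<Rightarrow> (complex \<times> complex) set \<Rightarrow> bool"
  where "holomorphic2_on f U \<longleftrightarrow>
    (\<forall>p\<in>U. \<exists>a b. (f has_derivative (\<lambda>(h, k). a * h + b * k)) (at p))"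

definition euler_double_zeta_singularities :: "(complex \<times> complex) set" where
  "euler_double_zeta_singularities =
     {(s1, s2). s2 = 1 \<or> s1 + s2 \<in> {2, 1} \<union> range (\<lambda>k::nat. - 2 * of_nat k)}"

definition euler_double_zeta_series :: "complex \<Rightarrow> complex \<Rightarrow> complex" where
  "euler_double_zeta_series s1 s2 =
     (\<Sum>m. 1 / of_nat (Suc m) powr s1 * (\<Sum>n. 1 / of_nat (Suc m + Suc n) powr s2))"

text \<open>
  The Euler double zeta-function, as the holomorphic continuation of the double series to the
  complement of the singularities. This complement is open and connected (a locally finite
  family of complex lines is removed) and contains the region of convergence, so
  the continuation is unique there; the values at the singularities are unspecified.
\<close>

definition euler_double_zeta :: "complex \<Rightarrow> complex \<Rightarrow> complex" where
  "euler_double_zeta = (SOME Z.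
     holomorphic2_on (\<lambda>(s1, s2). Z s1 s2) (- euler_double_zeta_singularities) \<and>
     (\<forall>s1 s2. Re s2 > 1 \<and> Re (s1 + s2) > 2 \<longrightarrow> Z s1 s2 = euler_double_zeta_series s1 s2))"

text \<open>
  Here \<open>x\<close> stands for \<open>2 \<sigma>\<^sub>2\<close>. The terms are nonnegative, so unordered summation agrees with
  summation of the series in its usual order.
\<close>

definition zeta2_sq_term :: "complex \<Rightarrow> real \<Rightarrow> nat \<Rightarrow> real" where
  "zeta2_sq_term s1 x n = (cmod (\<Sum>m=1..n-1. 1 / of_nat m powr s1))\<^sup>2 * (1 / real n powr x)"

definition zeta2_sq :: "complex \<Rightarrow> real \<Rightarrow> real" where
  "zeta2_sq s1 x = (\<Sum>\<^sub>\<infinity>n\<in>{2..}. zeta2_sq_term s1 x n)"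

definition mean_square :: "complex \<Rightarrow> real \<Rightarrow> real \<Rightarrow> real" where
  "mean_square s1 \<sigma>2 T = integral {2..T} (\<lambda>t2. (cmod (euler_double_zeta s1 (Complex \<sigma>2 t2)))\<^sup>2)"

text \<open>
  The relation \<open>f(T) = g(T) + O(h(T))\<close>, with an inequality valid for every \<open>T \<ge> 2\<close>, not just for large \<open>T\<close>. The
  implied constant may depend on everything except \<open>T\<close>.
\<close>

definition eq_up_to_O :: "(real \<Rightarrow> real) \<Rightarrow> (real \<Rightarrow> real) \<Rightarrow> (real \<Rightarrow> real) \<Rightarrow> bool" where
  "eq_up_to_O f g h \<longleftrightarrow> (\<lambda>T. f T - g T) \<in> O[principal {2..}](h)"

end

theory Submission
  imports Defs "HOL-Complex_Analysis.Complex_Analysis"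
begin

text \<open>
  Write \<open>a\<^sub>n = \<Sum>\<^bsub>m<n\<^esub> m powr (-s\<^sub>1)\<close>, so that \<open>\<zeta>\<^sub>2(s\<^sub>1, s\<^sub>2) = \<Sum>\<^sub>n a\<^sub>n n powr (-s\<^sub>2)\<close>. Euler-Maclaurin summation in the
  inner variable continues \<open>\<zeta>\<^sub>2\<close> to the complement of its singularities. Taken to an order
  comparable with \<open>|s|\<close>, it also shows that for \<open>2 \<le> t\<^sub>2 \<le> T\<close> and \<open>N\<close> of the order of \<open>T\<close> the function differs from
  its partial sum \<open>\<Sum>\<^bsub>n<N\<^esub> a\<^sub>n n powr (-s\<^sub>2)\<close> by \<open>O(W/t\<^sub>2)\<close>, where \<open>W\<close> bounds \<open>N |a\<^sub>N| N powr (-\<sigma>\<^sub>2)\<close>.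

  The mean square of the partial sum is \<open>T \<Sum>\<^bsub>n<N\<^esub> |a\<^sub>n|\<^sup>2 n powr (-2\<sigma>\<^sub>2)\<close> up to the square of the sum over the dyadic
  blocks of the values of \<open>W\<close>. Within a block the off-diagonal terms are controlled by the monotonicity of
  the integral in its endpoints; distinct non-adjacent blocks are estimated trivially. The cross term with
  the error \<open>O(W/t\<^sub>2)\<close> is handled by Cauchy-Schwarz on dyadic intervals of \<open>t\<^sub>2\<close>. The cases of
  the theorem differ only in the size of \<open>a\<^sub>n\<close>, which follows from
  \<open>a\<^sub>n = \<zeta>(s\<^sub>1) + n powr (1 - s\<^sub>1) / (1 - s\<^sub>1) + O(n powr (-\<sigma>\<^sub>1))\<close>.
\<close>

section \<open>Euler-Maclaurin expansion of the Hurwitz zeta-function\<close>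

text \<open>The order of the expansion has to grow with |s|: a fixed order M leaves a remainder of
  size |s|^(M+1) n^(-Re s - M), which for n of order |s| is too large by a factor |s|. Once n is at
  least 4|s| + 2, an order close to |s| gains 2^(-M) and absorbs that factor. The parameter behind
  the case distinction is \<open>\<kappa>\<close>, which is \<beta> + 1 - \<sigma>2 when
  \<open>zeta_psum s1 n\<close> is at most of order n^\<beta> up to a logarithm. The block of n near
  2^j contributes (2 powr \<kappa>)^j, so the squared sum over blocks up to T is bounded, a power of
  log T, or T^(2 \<kappa>) with logarithms, according as \<kappa> is negative, zero or positive; at
  \<kappa> = 1/2 the diagonal itself diverges and becomes the main term. Since both zeta-functions
  are introduced by a choice operator, continuations to the whole prescribed domains are constructed
  first, and the identity theorem then shows that the chosen functions agree with them.\<close>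

definition bernoulli :: "nat \<Rightarrow> complex" where
  "bernoulli k = fps_nth (fps_X / (fps_exp 1 - 1)) k"

text \<open>Division of formal power series can cut off terms. Here it is exact because exp X - 1
  has subdegree 1 and so divides X.\<close>

lemma bernoulli_fps_eq:
  fixes B :: "complex fps"
  defines "B \<equiv> fps_X / (fps_exp 1 - 1)"
  shows "B * (fps_exp 1 - 1) = fps_X"
proof -
  have nz: "fps_exp (1::complex) - 1 \<noteq> 0"
    by (auto simp: fps_eq_iff intro!: exI[of _ 1])
  have "subdegree (fps_exp (1::complex) - 1) = 1"
    by (rule subdegreeI) auto
  then have "fps_exp (1::complex) - 1 dvd fps_X"
    using nz by (subst fps_dvd_iff) (auto)
  then show ?thesis unfolding B_def by simp
qed

text \<open>Comparison of coefficients in \<open>bernoulli_fps_eq\<close>; the index k = n is absent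
  because exp X - 1 has no constant term. This relation makes the Taylor terms cancel in
  \<open>norm_em_diff_le\<close>.\<close>

lemma bernoulli_rec: "(\<Sum>k<n. bernoulli k / fact (n - k)) = (if n = 1 then 1 else 0)"
proof -
  have "fps_nth (fps_X / (fps_exp 1 - 1) * (fps_exp 1 - 1) :: complex fps) n
      = (\<Sum>k\<le>n. bernoulli k * fps_nth (fps_exp 1 - 1) (n - k))"
    by (simp add: fps_mult_nth bernoulli_def atLeast0AtMost)
  also have "\<dots> = (\<Sum>k<n. bernoulli k / fact (n - k))"
    by (intro sum.mono_neutral_cong_right) auto
  finally show ?thesis by (simp add: bernoulli_fps_eq)
qed

lemma bernoulli_0 [simp]: "bernoulli 0 = 1"
  using bernoulli_rec[of 1] by simp

text \<open>Substituting -X for X and multiplying by exp X gives B(-X) = X + B(X) for the generating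
  series B, so the only odd power in B is X itself.\<close>

lemma bernoulli_odd:
  assumes "odd k" "k \<noteq> 1"
  shows "bernoulli k = 0"
proof -
  define B :: "complex fps" where "B = fps_X / (fps_exp 1 - 1)"
  have nz: "fps_exp (1::complex) - 1 \<noteq> 0"
    by (auto simp: fps_eq_iff intro!: exI[of _ 1])
  have B: "B * (fps_exp 1 - 1) = fps_X"
    unfolding B_def by (rule bernoulli_fps_eq)
  have "(B oo (-fps_X)) * ((fps_exp 1 - 1) oo (-fps_X)) = (fps_X oo (- fps_X))"
    unfolding B[symmetric] by (rule fps_compose_mult_distrib[symmetric]) auto
  moreover have "(fps_exp (1::complex) - 1) oo (-fps_X) = fps_exp (-1) - 1"
    by (auto simp: fps_compose_uminus' fps_eq_iff)
  ultimately have "(B oo (-fps_X)) * (fps_exp (-1) - 1) = - fps_X"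
    by simp
  then have "(B oo (-fps_X)) * ((fps_exp (-1) - 1) * fps_exp 1) = - fps_X * fps_exp 1"
    by (simp flip: mult.assoc)
  moreover have "(fps_exp (-1) - 1) * fps_exp 1 = - (fps_exp (1::complex) - 1)"
    by (simp add: left_diff_distrib flip: fps_exp_add_mult)
  ultimately have "(B oo (-fps_X)) * (fps_exp 1 - 1) = fps_X * fps_exp 1"
    by (metis mult_minus_left mult_minus_right minus_minus)
  also have "\<dots> = (fps_X + B) * (fps_exp 1 - 1)"
    using B by (simp add: algebra_simps)
  finally have "B oo (-fps_X) = fps_X + B"
    using nz by simp
  then have "fps_nth (B oo (-fps_X)) k = fps_nth (fps_X + B) k"
    by simp
  then have "- bernoulli k = bernoulli k"
    using assms by (simp add: fps_compose_uminus' B_def bernoulli_def)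
  then show ?thesis by simp
qed

text \<open>From 2^m <= (m + 1)!. The value 2 is what the induction in
  \<open>norm_bernoulli_le\<close> can afford: one unit is taken by the term k = n there, which
  leaves 1.\<close>

lemma sum_inverse_fact_le: "(\<Sum>k<n. 1 / fact (n - k)) \<le> (2::real)"
proof -
  have fact_ge: "2 ^ m \<le> (fact (Suc m) :: real)" for m
  proof (induction m)
    case (Suc m)
    have "(2::real) ^ Suc m \<le> (real m + 2) * fact (Suc m)"
      unfolding power_Suc by (intro mult_mono Suc) auto
    then show ?case by (simp add: algebra_simps)
  qed simp
  have "(\<Sum>k<n. 1 / fact (n - k)) = (\<Sum>k<n. 1 / (fact (Suc k)::real))"
    by (rule sum.reindex_bij_witness[of _ "\<lambda>k. n - Suc k" "\<lambda>k. n - Suc k"])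
       (auto simp: Suc_diff_Suc simp del: fact_Suc)
  also have "\<dots> \<le> (\<Sum>k<n. (1/2) ^ k)"
    by (intro sum_mono) (use fact_ge in \<open>simp add: field_simps del: fact_Suc\<close>)
  also have "\<dots> \<le> (\<Sum>k. (1/2) ^ k)"
    by (rule sum_le_suminf) auto
  also have "\<dots> = 2"
    by (simp add: suminf_geometric)
  finally show ?thesis .
qed

text \<open>Induction by solving the recurrence for its last term. The true decay is that of (2
  pi)^(-n), but the smallness of the expansion comes from the powers of n, so a bounded coefficient
  is enough.\<close>

lemma norm_bernoulli_le: "norm (bernoulli n) \<le> 1"
proof (induction n rule: less_induct)
  case (less n)
  show ?case
  proof (cases "n = 0")
    case False
    have "bernoulli n + (\<Sum>k<n. bernoulli k / fact (Suc n - k)) = 0"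
      using bernoulli_rec[of "Suc n"] False by (simp add: add.commute)
    then have "bernoulli n = - (\<Sum>k<n. bernoulli k / fact (Suc n - k))"
      by (simp add: add_eq_0_iff2)
    then have "norm (bernoulli n) \<le> (\<Sum>k<n. norm (bernoulli k / fact (Suc n - k)))"
      by (simp add: sum_norm_le)
    also have "\<dots> \<le> (\<Sum>k<n. 1 / fact (Suc n - k))"
      using less by (intro sum_mono) (auto simp: norm_divide divide_right_mono)
    also have "\<dots> = (\<Sum>k<Suc n. 1 / fact (Suc n - k)) - 1"
      by simp
    also have "\<dots> \<le> 1"
      using sum_inverse_fact_le[of "Suc n"] by simp
    finally show ?thesis .
  qed simp
qed

text \<open>
  The terms of the Euler-Maclaurin expansion of \<open>\<Sum>\<^sub>j (n + j) powr (-s)\<close>: for \<open>f(x) = x powr (-s)\<close>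
  the operator \<open>\<Sum>\<^sub>j exp (j D) = 1 / (1 - exp D)\<close> expands as \<open>-\<Sum>\<^sub>k b\<^sub>k D\<^bsup>k-1\<^esup>\<close>, where
  \<open>b\<^sub>k = bernoulli k\<close> is the Bernoulli number \<open>B\<^sub>k\<close> divided by \<open>k!\<close>.
\<close>

definition em_poly :: "nat \<Rightarrow> nat \<Rightarrow> complex \<Rightarrow> complex" where
  "em_poly M n s = (\<Sum>k\<le>M. bernoulli k * (-1) ^ k * pochhammer (s - 1) k / (s - 1) *
     of_nat n powr (1 - s - of_nat k))"

text \<open>The error of the telescoping: it would vanish if \<open>em_poly\<close> were exactly the
  sum over j, since those sums at n and n + 1 differ by the single term at n.\<close>

definition em_diff :: "nat \<Rightarrow> nat \<Rightarrow> complex \<Rightarrow> complex" where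
  "em_diff M n s = of_nat n powr (-s) - em_poly M n s + em_poly M (Suc n) s"

definition em_rem :: "nat \<Rightarrow> nat \<Rightarrow> complex \<Rightarrow> complex" where
  "em_rem M n s = (\<Sum>j. em_diff M (n + j) s)"

text \<open>The Hurwitz zeta-function with integer shift n. The order is just one with Re s + M > 0,
  where the remainder series converges; by \<open>hurwitz_zeta_eq\<close> every other such order
  gives the same value for s different from 1.\<close>

definition hurwitz_zeta :: "nat \<Rightarrow> complex \<Rightarrow> complex" where
  "hurwitz_zeta n s = em_poly (Suc (nat \<lceil>- Re s\<rceil>)) n s + em_rem (Suc (nat \<lceil>- Re s\<rceil>)) n s"

lemma norm_of_nat_powr: "n \<ge> 1 \<Longrightarrow> norm (of_nat n powr z) = real n powr Re z"
  by (subst norm_powr_real_powr) auto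

text \<open>The k-th derivative of z powr (1 - s) at n + 1 is expanded around n up to order M + 1 -
  k, so that every Taylor remainder involves the same derivative of order M + 2. By
  \<open>bernoulli_rec\<close> the Taylor terms cancel down to the first derivative, which is (1 -
  s) n powr (-s).\<close>

lemma norm_em_diff_le:
  assumes n: "n \<ge> 1" and s: "s \<noteq> 1" and M: "Re s + real M + 1 \<ge> 0"
  shows "norm (em_diff M n s) \<le> 2 * norm (pochhammer s (Suc M)) * real n powr (- Re s - real M - 1)"
proof -
  define w where "w = s - 1"
  \<comment> \<open>The k-th derivative of z powr (-w).\<close>
  define D where "D k z = (-1) ^ k * pochhammer w k * z powr (- w - of_nat k)" for k z
  define S :: "complex set" where "S = closed_segment (of_nat n) (of_nat (Suc n))"
  define B where "B = norm (pochhammer w (Suc (Suc M))) * real n powr (- Re s - real M - 1)"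
  define R where "R k = D k (of_nat (Suc n)) - (\<Sum>i\<le>Suc M - k. D (k + i) (of_nat n) / fact i)" for k
  have w: "w \<noteq> 0" using s by (simp add: w_def)
  have S_real: "\<exists>x\<ge>real n. z = of_real x" if "z \<in> S" for z
  proof -
    have "S = of_real ` closed_segment (real n) (real (Suc n))"
      unfolding S_def by (metis closed_segment_of_real of_real_of_nat_eq)
    then show ?thesis
      using that by (auto simp: closed_segment_eq_real_ivl)
  qed
  have deriv: "(D k has_field_derivative D (Suc k) z) (at z within S)" if "z \<in> S" for k z
  proof -
    from S_real[OF that] obtain x where x: "x \<ge> real n" "z = of_real x"
      by blast
    then have z: "z \<notin> \<real>\<^sub>\<le>\<^sub>0"
      using n by simp
    have "(D k has_field_derivative (-1) ^ k * pochhammer w k * ((- w - of_nat k) * z powr (- w - of_nat k - 1))) (at z)"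
      unfolding D_def by (intro DERIV_cmult has_field_derivative_powr z)
    also have "(-1) ^ k * pochhammer w k * ((- w - of_nat k) * z powr (- w - of_nat k - 1)) = D (Suc k) z"
      by (simp add: D_def pochhammer_Suc algebra_simps)
    finally show ?thesis
      by (rule has_field_derivative_at_within)
  qed
  have R_le: "norm (R k) \<le> B / fact (Suc M - k)" if "k < Suc M" for k
  proof -
    have "norm (D (k + 0) (of_nat (Suc n)) - (\<Sum>i\<le>Suc M - k. D (k + i) (of_nat n) * (of_nat (Suc n) - of_nat n) ^ i / fact i))
      \<le> B * norm (of_nat (Suc n) - of_nat n :: complex) ^ Suc (Suc M - k) / fact (Suc M - k)"
    proof (rule complex_Taylor[where f = "\<lambda>i. D (k + i)" and S = S])
      fix z assume "z \<in> S"
      then obtain x where x: "x \<ge> real n" "z = of_real x"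
        using S_real by blast
      have "norm (D (k + Suc (Suc M - k)) z) = norm (pochhammer w (Suc (Suc M))) * x powr (- Re s - real M - 1)"
        using that x n by (simp add: D_def norm_mult norm_power norm_powr_real_powr w_def)
      also have "\<dots> \<le> B"
        unfolding B_def using x n M by (intro mult_left_mono powr_mono2') auto
      finally show "norm (D (k + Suc (Suc M - k)) z) \<le> B" .
    qed (use deriv in \<open>auto simp: S_def\<close>)
    then show ?thesis by (simp add: R_def)
  qed
  \<comment> \<open>Sorted by the order l of the derivative, the coefficients become the left-hand
    side of \<open>bernoulli_rec\<close>, which vanishes except for l = 1.\<close>
  have "(\<Sum>k<Suc M. \<Sum>l=Suc k..Suc M. bernoulli k * D l (of_nat n) / fact (l - k))
      = (\<Sum>l\<le>Suc M. \<Sum>k<l. bernoulli k * D l (of_nat n) / fact (l - k))"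
    by (rule sum.nested_swap'[symmetric])
  also have "\<dots> = (\<Sum>l\<le>Suc M. D l (of_nat n) * (\<Sum>k<l. bernoulli k / fact (l - k)))"
    by (simp add: sum_distrib_left mult_ac)
  also have "\<dots> = (\<Sum>l\<le>Suc M. if l = 1 then D 1 (of_nat n) else 0)"
    unfolding bernoulli_rec by (intro sum.cong) auto
  also have "\<dots> = D 1 (of_nat n)"
    by (subst sum.delta) auto
  finally have main: "(\<Sum>k<Suc M. \<Sum>l=Suc k..Suc M. bernoulli k * D l (of_nat n) / fact (l - k)) = D 1 (of_nat n)" .
  have inner: "bernoulli k * (D k (of_nat (Suc n)) - D k (of_nat n))
      = bernoulli k * R k + (\<Sum>l=Suc k..Suc M. bernoulli k * D l (of_nat n) / fact (l - k))" if "k < Suc M" for k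
  proof -
    have "(\<Sum>i\<le>Suc M - k. D (k + i) (of_nat n) / fact i) = (\<Sum>l=k..Suc M. D l (of_nat n) / fact (l - k))"
      using that by (intro sum.reindex_bij_witness[of _ "\<lambda>l. l - k" "\<lambda>i. k + i"]) auto
    also have "\<dots> = D k (of_nat n) + (\<Sum>l=Suc k..Suc M. D l (of_nat n) / fact (l - k))"
      using that by (subst sum.atLeast_Suc_atMost) auto
    finally show ?thesis
      by (simp add: R_def algebra_simps sum_distrib_left sum_distrib_right)
  qed
  have poly: "w * em_poly M m s = (\<Sum>k<Suc M. bernoulli k * D k (of_nat m))" for m
    using w unfolding em_poly_def lessThan_Suc_atMost sum_distrib_left
    by (intro sum.cong refl) (simp add: D_def w_def field_simps)
  have "w * em_diff M n s = - D 1 (of_nat n) + (\<Sum>k<Suc M. bernoulli k * (D k (of_nat (Suc n)) - D k (of_nat n)))"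
    unfolding em_diff_def right_diff_distrib distrib_left poly
    by (simp add: sum_subtractf right_diff_distrib D_def w_def) (simp add: algebra_simps)
  also have "(\<Sum>k<Suc M. bernoulli k * (D k (of_nat (Suc n)) - D k (of_nat n)))
      = (\<Sum>k<Suc M. bernoulli k * R k + (\<Sum>l=Suc k..Suc M. bernoulli k * D l (of_nat n) / fact (l - k)))"
    by (rule sum.cong[OF refl inner]) simp
  also have "- D 1 (of_nat n) + \<dots> = (\<Sum>k<Suc M. bernoulli k * R k)"
    unfolding sum.distrib main by simp
  finally have "norm w * norm (em_diff M n s) \<le> (\<Sum>k<Suc M. norm (bernoulli k * R k))"
    by (metis norm_mult norm_sum)
  also have "\<dots> \<le> (\<Sum>k<Suc M. 1 * (B / fact (Suc M - k)))"
    unfolding norm_mult using R_le norm_bernoulli_le by (intro sum_mono mult_mono) auto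
  also have "\<dots> = B * (\<Sum>k<Suc M. 1 / fact (Suc M - k))"
    unfolding sum_distrib_left by simp
  also have "\<dots> \<le> B * 2"
    by (intro mult_left_mono sum_inverse_fact_le) (simp add: B_def)
  \<comment> \<open>\<open>pochhammer w (M + 2)\<close> contains the factor w, so dividing by w
    leaves no pole at s = 1 in the bound.\<close>
  also have "\<dots> = norm w * (2 * norm (pochhammer s (Suc M)) * real n powr (- Re s - real M - 1))"
    unfolding B_def pochhammer_rec[of w] by (simp add: w_def norm_mult)
  finally show ?thesis
    using w by simp
qed

text \<open>Comparison with the integral of x powr (-a - 1), expressed through the mean value
  theorem for x powr (-a); the 1 in the constant pays for the term j = 0.\<close>

lemma sum_powr_tail:
  assumes a: "a > 0" and n: "n \<ge> 1"
  shows "summable (\<lambda>j. real (n + j) powr (- a - 1))"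
    and "(\<Sum>j. real (n + j) powr (- a - 1)) \<le> real n powr (-a) * (1 + 1 / a)"
proof -
  have step: "(x + 1) powr (- a - 1) \<le> (x powr (-a) - (x + 1) powr (-a)) / a" if "x > 0" for x :: real
  proof -
    have "\<exists>z>x. z < x + 1 \<and> (x + 1) powr (-a) - x powr (-a) = (x + 1 - x) * (- a * z powr (- a - 1))"
      using that by (intro MVT2) (auto intro!: derivative_eq_intros)
    then obtain z where z: "x < z" "z < x + 1" "x powr (-a) - (x + 1) powr (-a) = a * z powr (- a - 1)"
      by auto
    have "(x + 1) powr (- a - 1) \<le> z powr (- a - 1)"
      using z that a by (intro powr_mono2') auto
    then show ?thesis
      using z a by (simp add: field_simps)
  qed
  have partial: "(\<Sum>j<N. real (n + j) powr (- a - 1)) \<le> real n powr (-a) * (1 + 1 / a)" for N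
  proof -
    have "(\<Sum>j<Suc N. real (n + j) powr (- a - 1))
        \<le> real n powr (-a-1) + (real n powr (-a) - real (n + N) powr (-a)) / a"
    proof (induction N)
      case (Suc N)
      have "real (n + Suc N) powr (- a - 1) \<le> (real (n + N) powr (-a) - real (n + Suc N) powr (-a)) / a"
        using step[of "real (n + N)"] n by (simp add: add_ac)
      with Suc.IH show ?case
        by (simp add: diff_divide_distrib add_ac)
    qed simp
    also have "\<dots> \<le> real n powr (-a) + real n powr (-a) / a"
      using a n by (intro add_mono divide_right_mono powr_mono) auto
    finally have "(\<Sum>j<Suc N. real (n + j) powr (- a - 1)) \<le> real n powr (-a) * (1 + 1 / a)"
      by (simp add: algebra_simps)
    moreover have "(\<Sum>j<N. real (n + j) powr (- a - 1)) \<le> (\<Sum>j<Suc N. real (n + j) powr (- a - 1))"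
      by simp
    ultimately show ?thesis by linarith
  qed
  show summ: "summable (\<lambda>j. real (n + j) powr (- a - 1))"
    by (rule summableI_nonneg_bounded[OF _ partial]) auto
  show "(\<Sum>j. real (n + j) powr (- a - 1)) \<le> real n powr (-a) * (1 + 1 / a)"
    by (rule suminf_le_const[OF summ partial])
qed

lemma
  assumes n: "n \<ge> 1" and s: "s \<noteq> 1" and M: "Re s + real M > 0"
  shows summable_norm_em_diff: "summable (\<lambda>j. norm (em_diff M (n + j) s))"
    and norm_em_rem_le: "norm (em_rem M n s) \<le>
      2 * norm (pochhammer s (Suc M)) * real n powr (- Re s - real M) * (1 + 1 / (Re s + real M))"
proof -
  let ?C = "2 * norm (pochhammer s (Suc M))" and ?a = "Re s + real M"
  have le: "norm (em_diff M (n + j) s) \<le> ?C * real (n + j) powr (- ?a - 1)" for j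
    using norm_em_diff_le[of "n + j" s M] assms by (simp add: algebra_simps)
  have summ: "summable (\<lambda>j. ?C * real (n + j) powr (- ?a - 1))"
    by (intro summable_mult sum_powr_tail assms)
  show summ': "summable (\<lambda>j. norm (em_diff M (n + j) s))"
    by (rule summable_comparison_test'[OF summ]) (use le in auto)
  have "norm (em_rem M n s) \<le> (\<Sum>j. norm (em_diff M (n + j) s))"
    unfolding em_rem_def by (rule summable_norm[OF summ'])
  also have "\<dots> \<le> (\<Sum>j. ?C * real (n + j) powr (- ?a - 1))"
    by (intro suminf_le le summ summ')
  also have "\<dots> = ?C * (\<Sum>j. real (n + j) powr (- ?a - 1))"
    by (intro suminf_mult sum_powr_tail assms)
  also have "\<dots> \<le> ?C * (real n powr (-?a) * (1 + 1 / ?a))"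
    by (intro mult_left_mono sum_powr_tail assms) auto
  finally show "norm (em_rem M n s) \<le> ?C * real n powr (- Re s - real M) * (1 + 1 / (Re s + real M))"
    by (simp add: algebra_simps)
qed

lemma summable_em_diff:
  assumes "n \<ge> 1" "s \<noteq> 1" "Re s + real M > 0"
  shows "summable (\<lambda>j. em_diff M (n + j) s)"
  using summable_norm_cancel[OF summable_norm_em_diff[OF assms]] .

lemma powr_neg_tendsto_0:
  assumes "Re z < 0"
  shows "(\<lambda>j. of_nat (n + j) powr z) \<longlonglongrightarrow> (0::complex)"
proof (rule tendsto_norm_zero_cancel)
  have "(\<lambda>j. real j powr Re z) \<longlonglongrightarrow> 0"
    using assms by (intro tendsto_neg_powr filterlim_real_sequentially) auto
  then have "(\<lambda>j. real (j + n) powr Re z) \<longlonglongrightarrow> 0"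
    by (rule LIMSEQ_ignore_initial_segment)
  then show "(\<lambda>j. norm (of_nat (n + j) powr z)) \<longlonglongrightarrow> 0"
    by (rule Lim_transform_eventually)
       (use eventually_gt_at_top[of 0] in eventually_elim, subst norm_of_nat_powr, auto simp: add_ac)
qed

text \<open>The new term \<open>q\<close> tends to 0 because Re s + M > 0, so telescoping it along
  the series of \<open>em_diff\<close> takes from the remainder exactly what the polynomial
  gains.\<close>

lemma em_Suc:
  assumes n: "n \<ge> 1" and s: "s \<noteq> 1" and M: "Re s + real M > 0"
  shows "em_poly (Suc M) n s + em_rem (Suc M) n s = em_poly M n s + em_rem M n s"
proof -
  define q where "q j = bernoulli (Suc M) * (-1) ^ Suc M * pochhammer (s - 1) (Suc M) / (s - 1) *
     of_nat (n + j) powr (1 - s - of_nat (Suc M))" for j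
  have poly: "em_poly (Suc M) (n + j) s = em_poly M (n + j) s + q j" for j
    by (simp add: em_poly_def q_def)
  have "q \<longlonglongrightarrow> bernoulli (Suc M) * (-1) ^ Suc M * pochhammer (s - 1) (Suc M) / (s - 1) * 0"
    unfolding q_def by (intro tendsto_mult_left powr_neg_tendsto_0) (use M in auto)
  then have "(\<lambda>j. q (Suc j) - q j) sums (0 - q 0)"
    by (intro telescope_sums) simp
  moreover have "(\<lambda>j. em_diff M (n + j) s) sums em_rem M n s"
    unfolding em_rem_def by (intro summable_sums summable_em_diff assms)
  ultimately have "(\<lambda>j. em_diff M (n + j) s + (q (Suc j) - q j)) sums (em_rem M n s + (0 - q 0))"
    by (intro sums_add)
  also have "(\<lambda>j. em_diff M (n + j) s + (q (Suc j) - q j)) = (\<lambda>j. em_diff (Suc M) (n + j) s)"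
  proof
    show "em_diff M (n + j) s + (q (Suc j) - q j) = em_diff (Suc M) (n + j) s" for j
      using poly[of j] poly[of "Suc j"] by (simp add: em_diff_def)
  qed
  finally have "em_rem (Suc M) n s = em_rem M n s - q 0"
    by (simp add: em_rem_def sums_iff)
  then show ?thesis
    using poly[of 0] by simp
qed

lemma hurwitz_zeta_eq:
  assumes n: "n \<ge> 1" and s: "s \<noteq> 1" and M: "Re s + real M > 0"
  shows "hurwitz_zeta n s = em_poly M n s + em_rem M n s"
proof -
  have mono: "em_poly L n s + em_rem L n s = em_poly M n s + em_rem M n s"
    if "M \<le> L" "Re s + real M > 0" for L M
    using that
  proof (induction L rule: dec_induct)
    case (step L)
    then show ?case
      using em_Suc[OF n s, of L] by (simp add: order_less_le_trans)
  qed simp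
  define L where "L = Suc (nat \<lceil>- Re s\<rceil>)"
  have L: "Re s + real L > 0"
    unfolding L_def by linarith
  have "em_poly (max L M) n s + em_rem (max L M) n s = em_poly M n s + em_rem M n s"
    using M by (intro mono) auto
  moreover have "em_poly (max L M) n s + em_rem (max L M) n s = em_poly L n s + em_rem L n s"
    using L by (intro mono) auto
  ultimately show ?thesis
    unfolding hurwitz_zeta_def L_def by simp
qed

lemma hurwitz_zeta_Suc:
  assumes n: "n \<ge> 1" and s: "s \<noteq> 1"
  shows "hurwitz_zeta n s = of_nat n powr (-s) + hurwitz_zeta (Suc n) s"
proof -
  define M where "M = Suc (nat \<lceil>- Re s\<rceil>)"
  have M: "Re s + real M > 0"
    unfolding M_def by linarith
  have "em_rem M n s = em_diff M n s + em_rem M (Suc n) s"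
    unfolding em_rem_def
    using suminf_split_head[OF summable_em_diff[OF n s M]] by simp
  then show ?thesis
    using n by (simp add: hurwitz_zeta_eq[OF _ s M] em_diff_def)
qed

lemma hurwitz_zeta_eq_sum:
  assumes n: "n \<ge> 1" and s: "s \<noteq> 1" and "n \<le> N"
  shows "hurwitz_zeta n s = (\<Sum>m=n..<N. of_nat m powr (-s)) + hurwitz_zeta N s"
  using \<open>n \<le> N\<close>
proof (induction N rule: dec_induct)
  case (step N)
  then show ?case
    using hurwitz_zeta_Suc[of N s] n s by simp
qed simp

lemma em_poly_0: "em_poly 0 n s = of_nat n powr (1 - s) / (s - 1)"
  by (simp add: em_poly_def)

text \<open>Order 0 works already: for Re s > 1 the term \<open>em_poly 0\<close> tends to 0, so its
  telescoping sum returns the value at n and leaves the Dirichlet series.\<close>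

lemma hurwitz_zeta_sums:
  assumes n: "n \<ge> 1" and s: "Re s > 1"
  shows "(\<lambda>j. of_nat (n + j) powr (-s)) sums hurwitz_zeta n s"
proof -
  have s1: "s \<noteq> 1" using s by auto
  have "(\<lambda>j. em_diff 0 (n + j) s) sums em_rem 0 n s"
    unfolding em_rem_def using s by (intro summable_sums summable_em_diff n s1) auto
  moreover have "(\<lambda>j. em_poly 0 (n + j) s) \<longlonglongrightarrow> 0 / (s - 1)"
    unfolding em_poly_0 by (intro tendsto_divide powr_neg_tendsto_0 tendsto_const) (use s s1 in auto)
  then have "(\<lambda>j. em_poly 0 (n + Suc j) s - em_poly 0 (n + j) s) sums (0 - em_poly 0 (n + 0) s)"
    by (intro telescope_sums) simp
  ultimately have "(\<lambda>j. em_diff 0 (n + j) s - (em_poly 0 (n + Suc j) s - em_poly 0 (n + j) s))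
      sums (em_rem 0 n s - (0 - em_poly 0 (n + 0) s))"
    by (rule sums_diff)
  moreover have "hurwitz_zeta n s = em_poly 0 n s + em_rem 0 n s"
    using s by (intro hurwitz_zeta_eq n s1) auto
  ultimately show ?thesis
    by (simp add: em_diff_def add.commute)
qed

section \<open>Holomorphy in s and the Riemann zeta-function\<close>

lemma holomorphic_on_suminf:
  fixes f :: "nat \<Rightarrow> complex \<Rightarrow> complex"
  assumes "open S" and hol: "\<And>n. f n holomorphic_on S"
    and bound: "\<And>x. x \<in> S \<Longrightarrow> \<exists>d B. d > 0 \<and> cball x d \<subseteq> S \<and> summable B \<and> (\<forall>n. \<forall>w\<in>cball x d. norm (f n w) \<le> B n)"
  shows "(\<lambda>z. \<Sum>n. f n z) holomorphic_on S"
proof (rule holomorphic_uniform_sequence[OF \<open>open S\<close>])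
  show "(\<lambda>z. \<Sum>n<N. f n z) holomorphic_on S" for N
    by (intro holomorphic_on_sum hol)
  fix x assume "x \<in> S"
  then obtain d B where "d > 0" "cball x d \<subseteq> S" "summable B" "\<And>n w. w \<in> cball x d \<Longrightarrow> norm (f n w) \<le> B n"
    using bound by metis
  then show "\<exists>d>0. cball x d \<subseteq> S \<and>
      uniform_limit (cball x d) (\<lambda>N z. \<Sum>n<N. f n z) (\<lambda>z. \<Sum>n. f n z) sequentially"
    by (intro exI[of _ d] conjI Weierstrass_m_test) auto
qed

lemma open_half_plane_minus_1: "open ({s. Re s > c} - {1})"
  by (intro open_Diff open_halfspace_Re_gt) auto

lemma of_nat_powr_holomorphic:
  assumes "n \<ge> 1" "f holomorphic_on S"
  shows "(\<lambda>s. (of_nat n :: complex) powr f s) holomorphic_on S"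
  using assms by (intro holomorphic_on_powr_right) auto

lemma pochhammer_holomorphic:
  "f holomorphic_on S \<Longrightarrow> (\<lambda>s. pochhammer (f s) k) holomorphic_on S"
  unfolding pochhammer_prod by (intro holomorphic_intros)

lemma em_poly_holomorphic: "n \<ge> 1 \<Longrightarrow> em_poly M n holomorphic_on - {1}"
  unfolding em_poly_def
  by (intro holomorphic_intros pochhammer_holomorphic of_nat_powr_holomorphic) auto

lemma em_diff_holomorphic: "n \<ge> 1 \<Longrightarrow> em_diff M n holomorphic_on - {1}"
  unfolding em_diff_def
  by (intro holomorphic_intros of_nat_powr_holomorphic em_poly_holomorphic) auto

text \<open>A ball whose radius is at most half the margin Re s + M and half the distance to 1 keeps
  a uniform margin for the remainder series and stays off the pole.\<close>

lemma local_bound_setup: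
  assumes "s \<noteq> 1" "Re s + real M > 0"
  obtains d a C where "d > 0" "a > 0" "C \<ge> 0"
    "cball s d \<subseteq> {s. Re s > - real M} - {1}"
    "\<And>w. w \<in> cball s d \<Longrightarrow> a \<le> Re w + real M"
    "\<And>w. w \<in> cball s d \<Longrightarrow> norm (pochhammer w (Suc M)) \<le> C"
proof -
  define a where "a = (Re s + real M) / 2"
  define d where "d = min a (dist s 1 / 2)"
  have d: "d > 0" "a > 0" "d \<le> a" "d < dist s 1"
    using assms by (auto simp: d_def a_def min_def not_le)
  have a: "Re s + real M = 2 * a"
    by (simp add: a_def)
  have Re_ge: "a \<le> Re w + real M" if "w \<in> cball s d" for w
  proof -
    have "\<bar>Re s - Re w\<bar> \<le> d"
      using that abs_Re_le_cmod[of "s - w"] by (auto simp: dist_norm)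
    then show ?thesis using d a by linarith
  qed
  have "bounded ((\<lambda>w. pochhammer w (Suc M)) ` cball s d)"
    unfolding pochhammer_prod
    by (intro compact_imp_bounded compact_continuous_image continuous_intros) auto
  then obtain C where C: "\<And>w. w \<in> cball s d \<Longrightarrow> norm (pochhammer w (Suc M)) \<le> C"
    unfolding bounded_iff ball_simps by blast
  then have "0 \<le> C"
    using order_trans[OF norm_ge_zero C[of s]] d by simp
  moreover have "cball s d \<subseteq> {s. Re s > - real M} - {1}"
    using Re_ge d by (fastforce simp: dist_commute)
  ultimately show ?thesis
    using that[of d a C] d Re_ge C by blast
qed

lemma em_rem_holomorphic:
  assumes n: "n \<ge> 1"
  shows "em_rem M n holomorphic_on {s. Re s > - real M} - {1}"
  unfolding em_rem_def
proof (rule holomorphic_on_suminf[OF open_half_plane_minus_1])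
  show "em_diff M (n + j) holomorphic_on {s. Re s > - real M} - {1}" for j
    by (rule holomorphic_on_subset[OF em_diff_holomorphic]) (use n in auto)
next
  fix s assume "s \<in> {s. Re s > - real M} - {1}"
  then have s: "s \<noteq> 1" "Re s + real M > 0" by auto
  obtain d a C where
    d: "d > 0" "a > 0" "C \<ge> 0" "cball s d \<subseteq> {s. Re s > - real M} - {1}"
    and Re_ge: "\<And>w. w \<in> cball s d \<Longrightarrow> a \<le> Re w + real M"
    and C: "\<And>w. w \<in> cball s d \<Longrightarrow> norm (pochhammer w (Suc M)) \<le> C"
    by (rule local_bound_setup[OF s]) (rule that)
  have "norm (em_diff M (n + j) w) \<le> 2 * C * real (n + j) powr (- a - 1)" if "w \<in> cball s d" for j w
  proof -
    have w: "w \<noteq> 1" "a \<le> Re w + real M"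
      using that Re_ge d(4) by auto
    have "norm (em_diff M (n + j) w) \<le> 2 * norm (pochhammer w (Suc M)) * real (n + j) powr (- Re w - real M - 1)"
      using w n d by (intro norm_em_diff_le) auto
    also have "\<dots> \<le> 2 * C * real (n + j) powr (- a - 1)"
      using w n d C[OF that] by (intro mult_mono powr_mono) auto
    finally show ?thesis .
  qed
  moreover have "summable (\<lambda>j. 2 * C * real (n + j) powr (- a - 1))"
    by (intro summable_mult sum_powr_tail n d)
  ultimately show "\<exists>d B. d > 0 \<and> cball s d \<subseteq> {s. Re s > - real M} - {1} \<and> summable B \<and>
      (\<forall>j. \<forall>w\<in>cball s d. norm (em_diff M (n + j) w) \<le> B j)"
    using d by blast
qed

text \<open>The constant must be the same for all n: the bound feeds the majorant of
  \<open>double_zeta_em_ser\<close>, which is a series over n.\<close>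

lemma em_rem_local_bound:
  assumes "s \<noteq> 1" "Re s + real M > 0"
  obtains d C where "d > 0" "C \<ge> 0" "cball s d \<subseteq> {s. Re s > - real M} - {1}"
    "\<And>n w. n \<ge> 1 \<Longrightarrow> w \<in> cball s d \<Longrightarrow> norm (em_rem M n w) \<le> C * real n powr (- Re w - real M)"
proof -
  obtain d a C where
    d: "d > 0" "a > 0" "C \<ge> 0" "cball s d \<subseteq> {s. Re s > - real M} - {1}"
    and Re_ge: "\<And>w. w \<in> cball s d \<Longrightarrow> a \<le> Re w + real M"
    and C: "\<And>w. w \<in> cball s d \<Longrightarrow> norm (pochhammer w (Suc M)) \<le> C"
    by (rule local_bound_setup[OF assms]) (rule that)
  have "norm (em_rem M n w) \<le> 2 * C * (1 + 1 / a) * real n powr (- Re w - real M)"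
    if n: "n \<ge> 1" and "w \<in> cball s d" for n w
  proof -
    have w: "w \<noteq> 1" "a \<le> Re w + real M"
      using that Re_ge d(4) by auto
    have "norm (em_rem M n w) \<le> 2 * norm (pochhammer w (Suc M)) * real n powr (- Re w - real M) * (1 + 1 / (Re w + real M))"
      using w n d by (intro norm_em_rem_le) auto
    also have "\<dots> \<le> 2 * C * real n powr (- Re w - real M) * (1 + 1 / a)"
      using w n d C[OF that(2)] by (intro mult_mono add_mono divide_left_mono) auto
    finally show ?thesis by (simp add: algebra_simps)
  qed
  then show ?thesis
    using that[of d "2 * C * (1 + 1 / a)"] d by auto
qed

text \<open>The order in \<open>hurwitz_zeta\<close> jumps with Re s, so holomorphy is shown on
  half-planes with a fixed order on each; these half-planes exhaust the plane.\<close>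

lemma hurwitz_zeta_holomorphic:
  assumes n: "n \<ge> 1"
  shows "hurwitz_zeta n holomorphic_on - {1}"
proof -
  have "hurwitz_zeta n holomorphic_on {s. Re s > - real M} - {1}" for M
  proof (rule holomorphic_transform)
    show "(\<lambda>s. em_poly M n s + em_rem M n s) holomorphic_on {s. Re s > - real M} - {1}"
      by (intro holomorphic_intros em_rem_holomorphic n holomorphic_on_subset[OF em_poly_holomorphic]) auto
  qed (use hurwitz_zeta_eq[of n _ M] n in auto)
  then have "hurwitz_zeta n holomorphic_on (\<Union>M. {s. Re s > - real M} - {1})"
    by (intro holomorphic_on_UN_open open_half_plane_minus_1)
  moreover have "(\<Union>M. {s. Re s > - real M} - {1}) = - {1}"
  proof -
    have "\<exists>M. - real M < Re s" for s
      using reals_Archimedean2[of "- Re s"] by (metis minus_less_iff)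
    then show ?thesis by auto
  qed
  ultimately show ?thesis by simp
qed

text \<open>\<open>hurwitz_zeta 1\<close> witnesses that a continuation exists, and the identity
  theorem on the connected set - {1} makes the chosen one equal to it.\<close>

lemma riemann_zeta_eq_hurwitz_zeta:
  assumes "s \<noteq> 1"
  shows "riemann_zeta s = hurwitz_zeta 1 s"
proof -
  have ser: "hurwitz_zeta 1 s = (\<Sum>n. 1 / of_nat (Suc n) powr s)" if "Re s > 1" for s
    using hurwitz_zeta_sums[of 1 s] that by (simp add: sums_iff powr_minus_divide)
  have "riemann_zeta holomorphic_on - {1} \<and>
      (\<forall>s. Re s > 1 \<longrightarrow> riemann_zeta s = (\<Sum>n. 1 / of_nat (Suc n) powr s))"
    unfolding riemann_zeta_def
    by (rule someI[of _ "hurwitz_zeta 1"]) (use ser hurwitz_zeta_holomorphic in auto)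
  then have hol: "riemann_zeta holomorphic_on - {1}"
    and eq: "\<And>s. Re s > 1 \<Longrightarrow> riemann_zeta s = hurwitz_zeta 1 s"
    using ser by auto
  show ?thesis
  proof (rule analytic_continuation_open[of "{s. Re s > 1}" "- {1}" riemann_zeta "hurwitz_zeta 1"])
    show "connected (- {1 :: complex})"
      by (intro connected_punctured_universe) auto
    have "2 \<in> {s. Re s > 1}" by simp
    then show "{s. Re s > 1} \<noteq> {}" by blast
  qed (use hol eq hurwitz_zeta_holomorphic[of 1] assms in \<open>auto simp: open_halfspace_Re_gt\<close>)
qed

lemma pochhammer_minus_1_div:
  assumes "s \<noteq> (1 :: complex)" "k > 0"
  shows "pochhammer (s - 1) k / (s - 1) = pochhammer s (k - 1)"
  using assms by (cases k) (auto simp: pochhammer_rec)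

lemma norm_pochhammer_le: "norm (pochhammer s k :: complex) \<le> (norm s + real k) ^ k"
proof (induction k)
  case (Suc k)
  have "norm (s + of_nat k) \<le> norm s + real (Suc k)"
    by (rule order_trans[OF norm_triangle_ineq]) auto
  moreover have "(norm s + real k) ^ k \<le> (norm s + real (Suc k)) ^ k"
    by (intro power_mono) auto
  ultimately show ?case
    using Suc.IH unfolding pochhammer_Suc norm_mult power_Suc2
    by (intro mult_mono) auto
qed simp

text \<open>The term k = 0 is the main term. In the term k + 1 the denominator s - 1 cancels against
  the Pochhammer symbol, leaving \<open>pochhammer s k\<close>.\<close>

lemma hurwitz_zeta_minus_main:
  assumes n: "n \<ge> 1" and s: "s \<noteq> 1" and M: "Re s + real M > 0"
  shows "norm (hurwitz_zeta n s - of_nat n powr (1 - s) / (s - 1)) \<le>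
    (\<Sum>k<M. norm (pochhammer s k) * real n powr (- Re s - real k)) + norm (em_rem M n s)"
proof -
  let ?t = "\<lambda>k. bernoulli k * (-1) ^ k * pochhammer (s - 1) k / (s - 1) * of_nat n powr (1 - s - of_nat k)"
  have "em_poly M n s = ?t 0 + (\<Sum>k<M. ?t (Suc k))"
    unfolding em_poly_def by (rule sum.atMost_shift)
  then have eq: "hurwitz_zeta n s - of_nat n powr (1 - s) / (s - 1) = (\<Sum>k<M. ?t (Suc k)) + em_rem M n s"
    by (simp add: hurwitz_zeta_eq[OF n s M])
  have "norm (?t (Suc k)) \<le> norm (pochhammer s k) * real n powr (- Re s - real k)" for k
  proof -
    have "norm (?t (Suc k)) = norm (bernoulli (Suc k)) * (norm (pochhammer (s - 1) (Suc k) / (s - 1)) * real n powr (- Re s - real k))"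
      by (simp add: norm_mult norm_power norm_divide norm_of_nat_powr[OF n])
    also have "\<dots> \<le> 1 * (norm (pochhammer (s - 1) (Suc k) / (s - 1)) * real n powr (- Re s - real k))"
      by (intro mult_right_mono norm_bernoulli_le mult_nonneg_nonneg) auto
    also have "\<dots> = norm (pochhammer s k) * real n powr (- Re s - real k)"
      using pochhammer_minus_1_div[OF s, of "Suc k"] by simp
    finally show ?thesis .
  qed
  then have "(\<Sum>k<M. norm (?t (Suc k))) \<le> (\<Sum>k<M. norm (pochhammer s k) * real n powr (- Re s - real k))"
    by (intro sum_mono)
  moreover have "norm ((\<Sum>k<M. ?t (Suc k)) + em_rem M n s) \<le> (\<Sum>k<M. norm (?t (Suc k))) + norm (em_rem M n s)"
    by (rule order_trans[OF norm_triangle_ineq add_right_mono[OF norm_sum]])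
  ultimately show ?thesis
    unfolding eq by linarith
qed

text \<open>For fixed s a fixed order will do, with a constant depending on s. This version yields
  the asymptotics of \<open>zeta_psum\<close>; the uniform \<open>hurwitz_zeta_approx\<close> serves
  the approximation in t.\<close>

lemma hurwitz_zeta_asymp:
  assumes s: "s \<noteq> 1"
  obtains C where "C \<ge> 0"
    "\<And>n. n \<ge> 1 \<Longrightarrow> norm (hurwitz_zeta n s - of_nat n powr (1 - s) / (s - 1)) \<le> C * real n powr (- Re s)"
proof -
  obtain M where M: "- Re s < real M"
    using reals_Archimedean2 by blast
  define C where "C = (\<Sum>k<M. norm (pochhammer s k)) + 2 * norm (pochhammer s (Suc M)) * (1 + 1 / (Re s + real M))"
  have "norm (hurwitz_zeta n s - of_nat n powr (1 - s) / (s - 1)) \<le> C * real n powr (- Re s)" if n: "n \<ge> 1" for n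
  proof -
    have "norm (hurwitz_zeta n s - of_nat n powr (1 - s) / (s - 1)) \<le>
      (\<Sum>k<M. norm (pochhammer s k) * real n powr (- Re s - real k)) + norm (em_rem M n s)"
      using M by (intro hurwitz_zeta_minus_main n s) auto
    also have "\<dots> \<le> (\<Sum>k<M. norm (pochhammer s k) * real n powr (- Re s - real k))
       + 2 * norm (pochhammer s (Suc M)) * real n powr (- Re s - real M) * (1 + 1 / (Re s + real M))"
      using M by (intro add_left_mono norm_em_rem_le n s) auto
    also have "\<dots> \<le> (\<Sum>k<M. norm (pochhammer s k) * real n powr (- Re s))
       + 2 * norm (pochhammer s (Suc M)) * real n powr (- Re s) * (1 + 1 / (Re s + real M))"
      using M n by (intro add_mono sum_mono mult_mono powr_mono) auto
    also have "\<dots> = C * real n powr (- Re s)"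
      by (simp add: C_def algebra_simps sum_distrib_left sum_distrib_right)
    finally show ?thesis .
  qed
  moreover have "C \<ge> 0"
    unfolding C_def using M by (intro add_nonneg_nonneg sum_nonneg mult_nonneg_nonneg) auto
  ultimately show ?thesis using that by blast
qed

text \<open>Taking \<open>M\<close> of the size of \<open>|s|\<close> makes the expansion uniform for \<open>n \<ge> 4|s| + 2\<close>.\<close>

lemma hurwitz_zeta_approx:
  assumes s: "s \<noteq> 1" "Re s \<ge> 1/2" and n: "real n \<ge> 4 * norm s + 2"
  shows "norm (hurwitz_zeta n s - of_nat n powr (1 - s) / (s - 1)) \<le> 14 * real n powr (- Re s)"
proof -
  define M where "M = nat \<lceil>norm s\<rceil>"
  \<comment> \<open>Since M <= |s| + 1, the numerator is at most 2|s| + 1, half of the lower bound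
    for n: every Pochhammer factor divided by n is at most 1/2.\<close>
  define q where "q = (norm s + real M) / real n"
  have "norm s \<ge> 1/2"
    using s(2) complex_Re_le_cmod[of s] by linarith
  then have M: "real M \<ge> norm s" "real M \<le> norm s + 1" "M \<ge> 1"
    unfolding M_def by linarith+
  have n1: "n \<ge> 1" using n norm_ge_zero[of s] by linarith
  have q: "0 \<le> q" "q \<le> 1/2"
    using M n n1 by (auto simp: q_def field_simps)
  have term_le: "norm (pochhammer s k) * real n powr (- Re s - real k) \<le> real n powr (- Re s) * (1/2) ^ k"
    if "k \<le> M" for k
  proof -
    have "norm (pochhammer s k) \<le> (norm s + real M) ^ k"
      by (rule order_trans[OF norm_pochhammer_le power_mono]) (use that in auto)
    then have "norm (pochhammer s k) * real n powr (- Re s - real k)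
        \<le> (norm s + real M) ^ k * (real n powr (- Re s) / real n ^ k)"
      using n1 by (intro mult_mono) (auto simp: powr_diff powr_realpow)
    also have "\<dots> = real n powr (- Re s) * q ^ k"
      by (simp add: q_def power_divide)
    also have "\<dots> \<le> real n powr (- Re s) * (1/2) ^ k"
      using q by (intro mult_left_mono power_mono) auto
    finally show ?thesis .
  qed
  have "(\<Sum>k<M. norm (pochhammer s k) * real n powr (- Re s - real k)) \<le> (\<Sum>k<M. real n powr (- Re s) * (1/2) ^ k)"
    by (intro sum_mono term_le) auto
  also have "\<dots> = real n powr (- Re s) * (\<Sum>k<M. (1/2) ^ k)"
    by (simp add: sum_distrib_left)
  also have "\<dots> \<le> real n powr (- Re s) * (\<Sum>k. (1/2) ^ k)"
    by (intro mult_left_mono sum_le_suminf) auto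
  also have "\<dots> = 2 * real n powr (- Re s)"
    by (simp add: suminf_geometric)
  finally have sum_le: "(\<Sum>k<M. norm (pochhammer s k) * real n powr (- Re s - real k)) \<le> 2 * real n powr (- Re s)" .
  have "norm (em_rem M n s) \<le> 2 * norm (pochhammer s (Suc M)) * real n powr (- Re s - real M) * (1 + 1 / (Re s + real M))"
    using s by (intro norm_em_rem_le n1) auto
  \<comment> \<open>The Pochhammer symbol has one factor more than there are powers of n. This
    factor is at most 2 M and is absorbed by M / 2^M <= 1; the constants give 2 * 2 * 3 =
    12.\<close>
  also have "\<dots> = 2 * norm (s + of_nat M) * (norm (pochhammer s M) * real n powr (- Re s - real M)) * (1 + 1 / (Re s + real M))"
    by (simp add: pochhammer_Suc norm_mult)
  also have "\<dots> \<le> 2 * (2 * real M) * (real n powr (- Re s) * (1/2) ^ M) * (1 + 1 / (1/2))"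
  proof (intro mult_mono[OF mult_mono[OF mult_left_mono term_le]] add_mono divide_left_mono)
    show "norm (s + of_nat M) \<le> 2 * real M"
      using M by (intro order_trans[OF norm_triangle_ineq]) auto
  qed (use s in auto)
  also have "\<dots> = 12 * real n powr (- Re s) * (real M / 2 ^ M)"
    by (simp add: power_divide)
  also have "\<dots> \<le> 12 * real n powr (- Re s) * 1"
    by (intro mult_left_mono) (auto simp: less_imp_le of_nat_less_two_power)
  finally have "norm (em_rem M n s) \<le> 12 * real n powr (- Re s)" by simp
  moreover have "norm (hurwitz_zeta n s - of_nat n powr (1 - s) / (s - 1)) \<le>
      (\<Sum>k<M. norm (pochhammer s k) * real n powr (- Re s - real k)) + norm (em_rem M n s)"
    using s by (intro hurwitz_zeta_minus_main n1) auto
  ultimately show ?thesis using sum_le by linarith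
qed

section \<open>Holomorphic functions of two variables\<close>

definition complex_differentiable2 :: "(complex \<times> complex \<Rightarrow> complex) \<Rightarrow> complex \<times> complex \<Rightarrow> bool" where
  "complex_differentiable2 f p \<longleftrightarrow> (\<exists>a b. (f has_derivative (\<lambda>(h, k). a * h + b * k)) (at p))"

lemma holomorphic2_on_iff: "holomorphic2_on f U \<longleftrightarrow> (\<forall>p\<in>U. complex_differentiable2 f p)"
  by (simp add: holomorphic2_on_def complex_differentiable2_def)

lemma complex_differentiable2_const: "complex_differentiable2 (\<lambda>p. c) p"
  unfolding complex_differentiable2_def
  by (rule exI[of _ 0], rule exI[of _ 0]) (simp add: case_prod_unfold)

lemma complex_differentiable2_fst: "complex_differentiable2 fst p"
  unfolding complex_differentiable2_def
  by (rule exI[of _ 1], rule exI[of _ 0]) (auto simp: case_prod_beta intro!: derivative_eq_intros)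

lemma complex_differentiable2_snd: "complex_differentiable2 snd p"
  unfolding complex_differentiable2_def
  by (rule exI[of _ 0], rule exI[of _ 1]) (auto simp: case_prod_beta intro!: derivative_eq_intros)

lemma complex_differentiable2_add:
  assumes "complex_differentiable2 f p" "complex_differentiable2 g p"
  shows "complex_differentiable2 (\<lambda>q. f q + g q) p"
proof -
  from assms obtain a b c d where
    "(f has_derivative (\<lambda>(h, k). a * h + b * k)) (at p)"
    "(g has_derivative (\<lambda>(h, k). c * h + d * k)) (at p)"
    unfolding complex_differentiable2_def by blast
  from has_derivative_add[OF this] show ?thesis
    unfolding complex_differentiable2_def
    by (intro exI[of _ "a + c"] exI[of _ "b + d"])
       (elim has_derivative_eq_rhs, auto simp: algebra_simps)
qed

lemma complex_differentiable2_mult: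
  assumes "complex_differentiable2 f p" "complex_differentiable2 g p"
  shows "complex_differentiable2 (\<lambda>q. f q * g q) p"
proof -
  from assms obtain a b c d where
    "(f has_derivative (\<lambda>(h, k). a * h + b * k)) (at p)"
    "(g has_derivative (\<lambda>(h, k). c * h + d * k)) (at p)"
    unfolding complex_differentiable2_def by blast
  from has_derivative_mult[OF this] show ?thesis
    unfolding complex_differentiable2_def
    by (intro exI[of _ "a * g p + f p * c"] exI[of _ "b * g p + f p * d"])
       (elim has_derivative_eq_rhs, auto simp: algebra_simps)
qed

lemma complex_differentiable2_compose:
  assumes "complex_differentiable2 f p" "g field_differentiable at (f p)"
  shows "complex_differentiable2 (\<lambda>q. g (f q)) p"
proof -
  from assms obtain a b c where
    f: "(f has_derivative (\<lambda>(h, k). a * h + b * k)) (at p)"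
    and g: "(g has_derivative (*) c) (at (f p))"
    unfolding complex_differentiable2_def field_differentiable_def has_field_derivative_def by blast
  from has_derivative_compose[OF f g] show ?thesis
    unfolding complex_differentiable2_def
    by (intro exI[of _ "c * a"] exI[of _ "c * b"])
       (elim has_derivative_eq_rhs, auto simp: algebra_simps)
qed

lemma complex_differentiable2_sum:
  assumes "\<And>i. i \<in> I \<Longrightarrow> complex_differentiable2 (f i) p"
  shows "complex_differentiable2 (\<lambda>q. \<Sum>i\<in>I. f i q) p"
  using assms
  by (induction I rule: infinite_finite_induct)
     (auto intro: complex_differentiable2_const complex_differentiable2_add)

text \<open>Cauchy's inequality for f(x, .) - f(a, .) on circles of radius r: uniform continuity on
  the compact product makes this difference small, and continuity of the single derivative at x = a
  does the rest. The radius 2 r keeps these circles inside the domain.\<close>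

lemma continuous_deriv_snd:
  fixes f :: "complex \<times> complex \<Rightarrow> complex"
  assumes cont: "continuous_on (cball a r \<times> cball b (2 * r)) f" and r: "r > 0"
    and hol: "\<And>x. x \<in> cball a r \<Longrightarrow> (\<lambda>w. f (x, w)) holomorphic_on ball b (2 * r)"
  shows "continuous (at (a, b) within ball a r \<times> ball b r) (\<lambda>(x, y). deriv (\<lambda>w. f (x, w)) y)"
proof -
  let ?K = "cball a r \<times> cball b (2 * r)"
  define d where "d x y = deriv (\<lambda>w. f (x, w)) y" for x y
  have "continuous (at (a, b) within ball a r \<times> ball b r) (\<lambda>p. d (fst p) (snd p))"
    unfolding continuous_within_eps_delta
  proof (intro allI impI)
    fix e :: real assume e: "e > 0"
    have "uniformly_continuous_on ?K f"
      by (intro compact_uniformly_continuous cont compact_Times) auto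
    moreover have "e * r / 2 > 0" using e r by simp
    ultimately obtain \<delta> where \<delta>: "\<delta> > 0"
      "\<And>p q. p \<in> ?K \<Longrightarrow> q \<in> ?K \<Longrightarrow> dist q p < \<delta> \<Longrightarrow> dist (f q) (f p) < e * r / 2"
      unfolding uniformly_continuous_on_def by metis
    have "isCont (d a) b"
    proof -
      have "d a holomorphic_on ball b (2 * r)"
        unfolding d_def using r by (intro holomorphic_deriv hol) auto
      then have "continuous_on (ball b (2 * r)) (d a)"
        by (rule holomorphic_on_imp_continuous_on)
      then show ?thesis
        using r by (auto simp: continuous_on_eq_continuous_at)
    qed
    then obtain \<eta> where \<eta>: "\<eta> > 0" "\<And>y. dist y b < \<eta> \<Longrightarrow> dist (d a y) (d a b) < e / 2"
      using e by (metis continuous_at_eps_delta half_gt_zero)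
    show "\<exists>\<epsilon>>0. \<forall>p\<in>ball a r \<times> ball b r. dist p (a, b) < \<epsilon> \<longrightarrow>
        dist (d (fst p) (snd p)) (d (fst (a, b)) (snd (a, b))) < e"
    proof (intro exI[of _ "min \<delta> \<eta>"] conjI ballI impI)
      fix p assume p: "p \<in> ball a r \<times> ball b r" "dist p (a, b) < min \<delta> \<eta>"
      obtain x y where xy: "p = (x, y)" by (cases p)
      have dist: "dist x a < \<delta>" "dist y b < \<eta>"
        using p dist_fst_le[of p "(a, b)"] dist_snd_le[of p "(a, b)"] by (auto simp: xy)
      have x: "x \<in> cball a r" and y: "y \<in> ball b r" using p by (auto simp: xy)
      have sub: "cball y r \<subseteq> cball b (2 * r)" "ball y r \<subseteq> ball b (2 * r)"
        using y by (auto simp: subset_iff) metric+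
      define g where "g w = f (x, w) - f (a, w)" for w
      have hol_g: "g holomorphic_on ball b (2 * r)"
        unfolding g_def using r by (intro holomorphic_intros hol x) auto
      have "norm ((deriv ^^ 1) g y) \<le> fact 1 * (e * r / 2) / r ^ 1"
      proof (rule Cauchy_inequality)
        show "g holomorphic_on ball y r"
          by (rule holomorphic_on_subset[OF hol_g sub(2)])
        have *: "continuous_on (cball b (2 * r)) (\<lambda>w. f (z, w))" if "z \<in> cball a r" for z
          by (rule continuous_on_compose2[OF cont]) (use that in \<open>auto intro!: continuous_intros\<close>)
        have "a \<in> cball a r" using r by simp
        then show "continuous_on (cball y r) g"
          unfolding g_def by (intro continuous_on_subset[OF continuous_on_diff[OF * *] sub(1)] x)
        fix w assume "norm (y - w) = r"
        then have "w \<in> cball b (2 * r)" using sub by (auto simp: dist_norm)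
        then have "dist (f (x, w)) (f (a, w)) < e * r / 2"
          using x r dist by (intro \<delta>) (auto simp: dist_Pair_Pair)
        then show "norm (g w) \<le> e * r / 2"
          by (simp add: g_def dist_norm)
      qed (use r in auto)
      moreover have "deriv g y = d x y - d a y"
      proof -
        have "y \<in> ball b (2 * r)" using y r by auto
        then show ?thesis
          unfolding g_def d_def using r x
          by (intro deriv_diff holomorphic_on_imp_differentiable_at[OF hol]) auto
      qed
      ultimately have "dist (d x y) (d a y) \<le> e / 2"
        using r by (simp add: dist_norm)
      moreover have "dist (d a y) (d a b) < e / 2"
        by (rule \<eta>) (rule dist)
      ultimately show "dist (d (fst p) (snd p)) (d (fst (a, b)) (snd (a, b))) < e"
        using dist_triangle[of "d x y" "d a b" "d a y"] by (simp add: xy)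
    qed (use \<delta> \<eta> in auto)
  qed
  then show ?thesis
    by (simp add: d_def case_prod_unfold)
qed

text \<open>Osgood's lemma. A total derivative exists as soon as one partial derivative exists at
  the point and the other exists nearby and is continuous there; \<open>continuous_deriv_snd\<close>
  supplies this continuity.\<close>

lemma complex_differentiable2_Osgood:
  assumes U: "open U" "(a, b) \<in> U" and cont: "continuous_on U f"
    and d1: "\<And>z w. (z, w) \<in> U \<Longrightarrow> (\<lambda>z. f (z, w)) field_differentiable at z"
    and d2: "\<And>z w. (z, w) \<in> U \<Longrightarrow> (\<lambda>w. f (z, w)) field_differentiable at w"
  shows "complex_differentiable2 f (a, b)"
proof -
  from open_prod_elim[OF U] obtain A B where AB: "open A" "open B" "a \<in> A" "b \<in> B" "A \<times> B \<subseteq> U"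
    by (metis mem_Times_iff fst_conv snd_conv)
  from AB obtain r1 where r1: "r1 > 0" "cball a r1 \<subseteq> A" by (meson open_contains_cball)
  from AB obtain r2 where r2: "r2 > 0" "cball b r2 \<subseteq> B" by (meson open_contains_cball)
  define r where "r = min r1 (r2 / 2)"
  have r: "r > 0" "cball a r \<subseteq> A" "cball b (2 * r) \<subseteq> B"
    using r1 r2 by (auto simp: r_def)
  have U_r: "(x, y) \<in> U" if "x \<in> cball a r" "y \<in> cball b (2 * r)" for x y
    using that r AB by blast
  define d where "d x y = deriv (\<lambda>w. f (x, w)) y" for x y
  obtain c where c: "((\<lambda>x. f (x, b)) has_field_derivative c) (at a)"
    using d1[OF U(2)] by (auto simp: field_differentiable_def)
  have "((\<lambda>(x, y). f (x, y)) has_derivative (\<lambda>(h, k). c * h + blinfun_mult_right (d a b) k))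
      (at (a, b) within ball a r \<times> ball b r)"
  proof (rule has_derivative_partialsI)
    show "((\<lambda>x. f (x, b)) has_derivative (*) c) (at a within ball a r)"
      using c by (auto simp: has_field_derivative_def intro: has_derivative_at_withinI)
    show "((\<lambda>y. f (x, y)) has_derivative blinfun_apply (blinfun_mult_right (d x y))) (at y within ball b r)"
      if "x \<in> ball a r" "y \<in> ball b r" for x y
    proof -
      have "(\<lambda>w. f (x, w)) field_differentiable at y"
        using that r by (intro d2 U_r) auto
      then have "((\<lambda>w. f (x, w)) has_field_derivative d x y) (at y)"
        unfolding d_def by (simp add: field_differentiable_derivI)
      then show ?thesis
        by (auto simp: has_field_derivative_def intro: has_derivative_at_withinI)
    qed
    have "continuous (at (a, b) within ball a r \<times> ball b r) (\<lambda>(x, y). deriv (\<lambda>w. f (x, w)) y)"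
    proof (rule continuous_deriv_snd)
      show "continuous_on (cball a r \<times> cball b (2 * r)) f"
        by (rule continuous_on_subset[OF cont]) (use U_r in auto)
      show "(\<lambda>w. f (x, w)) holomorphic_on ball b (2 * r)" if "x \<in> cball a r" for x
        unfolding holomorphic_on_def using that r
        by (auto intro!: field_differentiable_at_within d2 U_r)
    qed (use r in auto)
    then show "continuous (at (a, b) within ball a r \<times> ball b r) (\<lambda>(x, y). blinfun_mult_right (d x y))"
      unfolding case_prod_beta d_def
      by (rule bounded_linear.continuous[OF bounded_linear_blinfun_mult_right])
  qed (use r in auto)
  then have "(f has_derivative (\<lambda>(h, k). c * h + d a b * k)) (at (a, b) within ball a r \<times> ball b r)"
    by simp
  moreover have "at (a, b) within ball a r \<times> ball b r = at (a, b)"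
    using r by (intro at_within_open open_Times) auto
  ultimately show ?thesis
    unfolding complex_differentiable2_def by auto
qed

section \<open>Continuation of the double zeta-function\<close>

text \<open>
  Inserting the Euler-Maclaurin expansion of the inner sum into the double series leaves a finite
  sum of Riemann zeta-functions and a remainder series, which converges in a larger region.
  The vanishing of the odd Bernoulli numbers removes the lines \<open>s\<^sub>1 + s\<^sub>2 = -1, -3, \<dots>\<close> from the polar set.
\<close>

definition double_zeta_em_ser :: "nat \<Rightarrow> complex \<times> complex \<Rightarrow> complex" where
  "double_zeta_em_ser M p = (\<Sum>j. of_nat (Suc j) powr (- fst p) * em_rem M (Suc j) (snd p))"

definition double_zeta_em_coeff :: "nat \<Rightarrow> complex \<Rightarrow> complex" where
  "double_zeta_em_coeff k s = bernoulli k * (-1) ^ k * pochhammer (s - 1) k / (s - 1)"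

text \<open>For each m the inner sum runs over n > m, so it is the Hurwitz zeta-function at m
  without its first term. That term accounts for the subtracted zeta-value at s1 + s2, and the k-th
  term of \<open>em_poly\<close> for the one at s1 + s2 + k - 1.\<close>

definition double_zeta_em :: "nat \<Rightarrow> complex \<times> complex \<Rightarrow> complex" where
  "double_zeta_em M p = (\<Sum>k\<le>M. double_zeta_em_coeff k (snd p) * hurwitz_zeta 1 (fst p + snd p + (of_nat k - 1)))
     + - hurwitz_zeta 1 (fst p + snd p) + double_zeta_em_ser M p"

text \<open>Re s2 + M > 0 makes \<open>em_rem\<close> converge. Its size turns the summand of the
  remainder series into j powr (- Re (s1 + s2) - M), which the last condition makes
  summable.\<close>

definition double_zeta_em_dom :: "nat \<Rightarrow> (complex \<times> complex) set" where
  "double_zeta_em_dom M = {p. Re (snd p) + real M > 0 \<and> snd p \<noteq> 1 \<and> Re (fst p + snd p) + real M > 1}"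

lemma open_double_zeta_em_dom: "open (double_zeta_em_dom M)"
proof -
  have "double_zeta_em_dom M = {p. - real M < Re (snd p)} \<inter> {p. snd p \<noteq> 1} \<inter> {p. 1 - real M < Re (fst p + snd p)}"
    by (auto simp: double_zeta_em_dom_def)
  also have "open \<dots>"
    by (intro open_Int open_Collect_less open_Collect_neq continuous_intros)
  finally show ?thesis .
qed

lemma double_zeta_em_ser_bound:
  assumes "(a, b) \<in> double_zeta_em_dom M"
  obtains d B where "d > 0" "cball a d \<times> cball b d \<subseteq> double_zeta_em_dom M" "summable B"
    "\<And>j z w. z \<in> cball a d \<Longrightarrow> w \<in> cball b d \<Longrightarrow>
       norm (of_nat (Suc j) powr (- z) * em_rem M (Suc j) w) \<le> B j"
proof -
  \<comment> \<open>The margin of Re (a + b) + M over 1 is 2 q. Each variable moves by at most q /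
    2, so a margin q survives on the whole polydisc.\<close>
  define q where "q = (Re (a + b) + real M - 1) / 2"
  have ab: "b \<noteq> 1" "Re b + real M > 0" "q > 0"
    using assms by (auto simp: double_zeta_em_dom_def q_def)
  obtain d0 C where d0: "d0 > 0" "C \<ge> 0" "cball b d0 \<subseteq> {s. Re s > - real M} - {1}"
    and C: "\<And>n w. n \<ge> 1 \<Longrightarrow> w \<in> cball b d0 \<Longrightarrow> norm (em_rem M n w) \<le> C * real n powr (- Re w - real M)"
    by (rule em_rem_local_bound[OF ab(1,2)]) (rule that)
  define d where "d = min d0 (q / 2)"
  have d: "d > 0" "d \<le> d0" "d \<le> q / 2"
    using d0 ab by (auto simp: d_def)
  have Re_ge: "Re (z + w) + real M \<ge> q + 1" if "z \<in> cball a d" "w \<in> cball b d" for z w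
  proof -
    have "\<bar>Re a - Re z\<bar> \<le> d" "\<bar>Re b - Re w\<bar> \<le> d"
      using that abs_Re_le_cmod[of "a - z"] abs_Re_le_cmod[of "b - w"] by (auto simp: dist_norm)
    then have "Re (a + b) - Re (z + w) \<le> q" using d by simp
    moreover have "Re (a + b) + real M = 2 * q + 1" unfolding q_def by (simp add: field_simps)
    ultimately show ?thesis by linarith
  qed
  have sub: "cball b d \<subseteq> cball b d0"
    using d by (intro subset_cball)
  show ?thesis
  proof (rule that)
    show "d > 0" by fact
    show "cball a d \<times> cball b d \<subseteq> double_zeta_em_dom M"
    proof clarify
      fix z w assume zw: "z \<in> cball a d" "w \<in> cball b d"
      then have "w \<in> {s. Re s > - real M} - {1}" using sub d0(3) by blast
      then show "(z, w) \<in> double_zeta_em_dom M"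
        using Re_ge[OF zw] ab by (auto simp: double_zeta_em_dom_def)
    qed
    show "summable (\<lambda>j. C * real (1 + j) powr (- q - 1))"
      by (intro summable_mult sum_powr_tail) (use ab in auto)
    fix j z w assume zw: "z \<in> cball a d" "w \<in> cball b d"
    have "norm (of_nat (Suc j) powr (- z) * em_rem M (Suc j) w)
        \<le> real (Suc j) powr (- Re z) * (C * real (Suc j) powr (- Re w - real M))"
      unfolding norm_mult using zw sub
      by (intro mult_mono C) (auto simp: norm_of_nat_powr simp del: of_nat_Suc)
    also have "\<dots> = C * real (Suc j) powr (- Re z + (- Re w - real M))"
      by (subst powr_add) simp
    also have "\<dots> \<le> C * real (Suc j) powr (- q - 1)"
      using Re_ge[OF zw] d0 by (intro mult_left_mono powr_mono) auto
    finally show "norm (of_nat (Suc j) powr (- z) * em_rem M (Suc j) w) \<le> C * real (1 + j) powr (- q - 1)"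
      by simp
  qed
qed

lemma double_zeta_em_ser_summable:
  assumes "(a, b) \<in> double_zeta_em_dom M"
  shows "summable (\<lambda>j. of_nat (Suc j) powr (- a) * em_rem M (Suc j) b)"
proof -
  from assms obtain d B where d: "d > 0" "cball a d \<times> cball b d \<subseteq> double_zeta_em_dom M" "summable B"
    and B: "\<And>j z w. z \<in> cball a d \<Longrightarrow> w \<in> cball b d \<Longrightarrow>
       norm (of_nat (Suc j) powr (- z) * em_rem M (Suc j) w) \<le> B j"
    by (rule double_zeta_em_ser_bound) (rule that)
  show ?thesis
    by (rule summable_comparison_test'[OF d(3)], rule B) (use d(1) in auto)
qed

lemma open_slices:
  assumes "open U"
  shows "open {z. (z, w) \<in> U}" "open {w. (z, w) \<in> U}"
proof -
  have "{z. (z, w) \<in> U} = (\<lambda>z. (z, w)) -` U" "{w. (z, w) \<in> U} = Pair z -` U" by auto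
  moreover have "open ((\<lambda>z. (z, w)) -` U)" "open (Pair z -` U)"
    by (intro open_vimage assms continuous_intros)+
  ultimately show "open {z. (z, w) \<in> U}" "open {w. (z, w) \<in> U}"
    by simp_all
qed

lemma double_zeta_em_ser_differentiable:
  assumes "(a, b) \<in> double_zeta_em_dom M"
  shows "complex_differentiable2 (double_zeta_em_ser M) (a, b)"
proof (rule complex_differentiable2_Osgood[OF open_double_zeta_em_dom assms])
  show "continuous_on (double_zeta_em_dom M) (double_zeta_em_ser M)"
  proof (rule continuous_at_imp_continuous_on, clarify)
    fix x y assume "(x, y) \<in> double_zeta_em_dom M"
    then obtain d B where d: "d > 0" "cball x d \<times> cball y d \<subseteq> double_zeta_em_dom M" "summable B"
      "\<And>j z w. z \<in> cball x d \<Longrightarrow> w \<in> cball y d \<Longrightarrow>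
         norm (of_nat (Suc j) powr (- z) * em_rem M (Suc j) w) \<le> B j"
      by (rule double_zeta_em_ser_bound) (rule that)
    have "uniform_limit (cball x d \<times> cball y d)
        (\<lambda>N p. \<Sum>j<N. of_nat (Suc j) powr (- fst p) * em_rem M (Suc j) (snd p)) (double_zeta_em_ser M) sequentially"
      unfolding double_zeta_em_ser_def using d by (intro Weierstrass_m_test[OF _ d(3)]) auto
    then have "continuous_on (cball x d \<times> cball y d) (double_zeta_em_ser M)"
    proof (rule uniform_limit_theorem[rotated])
      have "w \<in> {s. Re s > - real M} - {1}" if "w \<in> cball y d" for w
      proof -
        have "(x, w) \<in> double_zeta_em_dom M" using d(1,2) that by auto
        then show ?thesis by (auto simp: double_zeta_em_dom_def)
      qed
      then have sub: "cball y d \<subseteq> {s. Re s > - real M} - {1}" by blast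
      have em: "continuous_on (cball x d \<times> cball y d) (\<lambda>p. em_rem M (Suc j) (snd p))" for j
        by (rule continuous_on_compose2[OF holomorphic_on_imp_continuous_on[OF em_rem_holomorphic]])
           (use sub in \<open>auto intro!: continuous_intros\<close>)
      show "\<forall>\<^sub>F N in sequentially. continuous_on (cball x d \<times> cball y d)
          (\<lambda>p. \<Sum>j<N. of_nat (Suc j) powr (- fst p) * em_rem M (Suc j) (snd p))"
        by (intro always_eventually allI continuous_intros em continuous_on_powr_complex) 
           (auto simp del: of_nat_Suc)
    qed auto
    then have "continuous_on (ball x d \<times> ball y d) (double_zeta_em_ser M)"
      by (rule continuous_on_subset) auto
    then show "isCont (double_zeta_em_ser M) (x, y)"
      using d(1) by (subst (asm) continuous_on_eq_continuous_at) (auto intro: open_Times)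
  qed
next
  fix z w assume zw: "(z, w) \<in> double_zeta_em_dom M"
  have "(\<lambda>z. double_zeta_em_ser M (z, w)) holomorphic_on {z. (z, w) \<in> double_zeta_em_dom M}"
    unfolding double_zeta_em_ser_def fst_conv snd_conv
  proof (rule holomorphic_on_suminf[OF open_slices(1)[OF open_double_zeta_em_dom]])
    fix x assume "x \<in> {z. (z, w) \<in> double_zeta_em_dom M}"
    then have "(x, w) \<in> double_zeta_em_dom M" by simp
    then obtain d B where d: "d > 0" "cball x d \<times> cball w d \<subseteq> double_zeta_em_dom M" "summable B"
      "\<And>j z v. z \<in> cball x d \<Longrightarrow> v \<in> cball w d \<Longrightarrow>
         norm (of_nat (Suc j) powr (- z) * em_rem M (Suc j) v) \<le> B j"
      by (rule double_zeta_em_ser_bound) (rule that)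
    then show "\<exists>d B. d > 0 \<and> cball x d \<subseteq> {z. (z, w) \<in> double_zeta_em_dom M} \<and> summable B \<and>
        (\<forall>j. \<forall>z\<in>cball x d. norm (of_nat (Suc j) powr (- z) * em_rem M (Suc j) w) \<le> B j)"
      by (intro exI[of _ d] exI[of _ B]) auto
  qed (intro holomorphic_intros of_nat_powr_holomorphic, auto)
  then show "(\<lambda>z. double_zeta_em_ser M (z, w)) field_differentiable at z"
    using zw open_slices(1)[OF open_double_zeta_em_dom] by (intro holomorphic_on_imp_differentiable_at) auto
  have "(\<lambda>w. double_zeta_em_ser M (z, w)) holomorphic_on {w. (z, w) \<in> double_zeta_em_dom M}"
    unfolding double_zeta_em_ser_def fst_conv snd_conv
  proof (rule holomorphic_on_suminf[OF open_slices(2)[OF open_double_zeta_em_dom]])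
    fix x assume "x \<in> {w. (z, w) \<in> double_zeta_em_dom M}"
    then have "(z, x) \<in> double_zeta_em_dom M" by simp
    then obtain d B where d: "d > 0" "cball z d \<times> cball x d \<subseteq> double_zeta_em_dom M" "summable B"
      "\<And>j u v. u \<in> cball z d \<Longrightarrow> v \<in> cball x d \<Longrightarrow>
         norm (of_nat (Suc j) powr (- u) * em_rem M (Suc j) v) \<le> B j"
      by (rule double_zeta_em_ser_bound) (rule that)
    then show "\<exists>d B. d > 0 \<and> cball x d \<subseteq> {w. (z, w) \<in> double_zeta_em_dom M} \<and> summable B \<and>
        (\<forall>j. \<forall>w\<in>cball x d. norm (of_nat (Suc j) powr (- z) * em_rem M (Suc j) w) \<le> B j)"
      by (intro exI[of _ d] exI[of _ B]) auto
  next
    show "(\<lambda>w. of_nat (Suc j) powr (- z) * em_rem M (Suc j) w) holomorphic_on {w. (z, w) \<in> double_zeta_em_dom M}" for j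
      by (intro holomorphic_intros holomorphic_on_subset[OF em_rem_holomorphic]) (auto simp: double_zeta_em_dom_def)
  qed
  then show "(\<lambda>w. double_zeta_em_ser M (z, w)) field_differentiable at w"
    using zw open_slices(2)[OF open_double_zeta_em_dom] by (intro holomorphic_on_imp_differentiable_at) auto
qed

text \<open>The k-th zeta-value has its pole at a + b = 2 - k. For k = 0, k = 1 and even k these are
  listed singular lines; for odd k > 1 the coefficient vanishes by
  \<open>bernoulli_odd\<close>.\<close>

lemma double_zeta_em_differentiable:
  assumes "(a, b) \<in> double_zeta_em_dom M" "(a, b) \<notin> euler_double_zeta_singularities"
  shows "complex_differentiable2 (double_zeta_em M) (a, b)"
proof -
  have b: "b \<noteq> 1" using assms by (simp add: double_zeta_em_dom_def)
  have hurwitz_zeta_diff: "hurwitz_zeta 1 field_differentiable at s" if "s \<noteq> 1" for s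
    by (rule holomorphic_on_imp_differentiable_at[OF hurwitz_zeta_holomorphic]) (use that in auto)
  have shift: "complex_differentiable2 (\<lambda>p. fst p + snd p + c) p" for c p
    by (intro complex_differentiable2_add complex_differentiable2_fst complex_differentiable2_snd complex_differentiable2_const)
  have hz2: "complex_differentiable2 (\<lambda>p. hurwitz_zeta 1 (fst p + snd p + c)) (a, b)" if "a + b + c \<noteq> 1" for c
    by (rule complex_differentiable2_compose[OF shift hurwitz_zeta_diff]) (use that in simp)
  have term_diff: "complex_differentiable2 (\<lambda>p. double_zeta_em_coeff k (snd p) * hurwitz_zeta 1 (fst p + snd p + (of_nat k - 1))) (a, b)" for k
  proof (cases "odd k \<and> k \<noteq> 1")
    case True
    then show ?thesis
      by (simp add: double_zeta_em_coeff_def bernoulli_odd complex_differentiable2_const)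
  next
    case False
    have "a + b + (of_nat k - 1) \<noteq> 1"
    proof
      assume eq: "a + b + (of_nat k - 1) = 1"
      then have "a + b = 2 - of_nat k" by (simp add: algebra_simps)
      moreover have "(2 - of_nat k :: complex) \<in> {2, 1} \<union> range (\<lambda>k::nat. - 2 * of_nat k)"
      proof (cases "k < 2")
        case True
        then have "k = 0 \<or> k = 1" by auto
        then show ?thesis by auto
      next
        case k: False
        with False obtain m where "k = 2 * m" by auto
        with k have "2 - of_nat k = (- 2 * of_nat (m - 1) :: complex)"
          by (cases m) auto
        then show ?thesis by blast
      qed
      ultimately show False
        using assms(2) by (auto simp: euler_double_zeta_singularities_def)
    qed
    moreover have "double_zeta_em_coeff k field_differentiable at b"
      unfolding double_zeta_em_coeff_def
      by (rule holomorphic_on_imp_differentiable_at[of _ "- {1}"])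
         (use b in \<open>auto intro!: holomorphic_intros pochhammer_holomorphic\<close>)
    ultimately show ?thesis
      by (intro complex_differentiable2_mult hz2 complex_differentiable2_compose[OF complex_differentiable2_snd]) auto
  qed
  have "a + b \<noteq> 1"
    using assms(2) by (auto simp: euler_double_zeta_singularities_def)
  then have "complex_differentiable2 (\<lambda>p. (-1) * hurwitz_zeta 1 (fst p + snd p + 0)) (a, b)"
    by (intro complex_differentiable2_mult hz2 complex_differentiable2_const) auto
  then show ?thesis
    unfolding double_zeta_em_def
    by (intro complex_differentiable2_add complex_differentiable2_sum term_diff double_zeta_em_ser_differentiable assms) auto
qed

text \<open>By \<open>em_Suc\<close> the two remainders differ for each j by a multiple of (j + 1)
  powr (- (a + b + M)). On the domain of order M this series converges absolutely, and its sum is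
  the zeta-value added to the finite part.\<close>

lemma double_zeta_em_Suc:
  assumes "(a, b) \<in> double_zeta_em_dom M"
  shows "double_zeta_em (Suc M) (a, b) = double_zeta_em M (a, b)"
proof -
  have ab: "Re b + real M > 0" "b \<noteq> 1" "Re (a + b + of_nat M) > 1"
    using assms by (auto simp: double_zeta_em_dom_def)
  have term_eq: "of_nat (Suc j) powr (- a) * em_rem M (Suc j) b - of_nat (Suc j) powr (- a) * em_rem (Suc M) (Suc j) b
      = double_zeta_em_coeff (Suc M) b * of_nat (1 + j) powr (- (a + b + of_nat M))" for j
  proof -
    have "em_rem M (Suc j) b - em_rem (Suc M) (Suc j) b = em_poly (Suc M) (Suc j) b - em_poly M (Suc j) b"
      using em_Suc[of "Suc j" b M] ab by (simp add: algebra_simps)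
    also have "\<dots> = double_zeta_em_coeff (Suc M) b * of_nat (Suc j) powr (- b - of_nat M)"
      by (simp add: em_poly_def double_zeta_em_coeff_def)
    finally have "of_nat (Suc j) powr (- a) * (em_rem M (Suc j) b - em_rem (Suc M) (Suc j) b)
        = double_zeta_em_coeff (Suc M) b * (of_nat (Suc j) powr (- a) * of_nat (Suc j) powr (- b - of_nat M))"
      by simp
    also have "of_nat (Suc j) powr (- a) * of_nat (Suc j) powr (- b - of_nat M) = of_nat (Suc j) powr (- (a + b + of_nat M))"
      by (simp add: algebra_simps flip: powr_add del: of_nat_Suc)
    finally show ?thesis by (simp add: right_diff_distrib)
  qed
  have "summable (\<lambda>j. of_nat (Suc j) powr (- a) * em_rem L (Suc j) b)" if "L \<ge> M" for L
    using assms that by (intro double_zeta_em_ser_summable) (auto simp: double_zeta_em_dom_def)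
  then have "(\<lambda>j. of_nat (Suc j) powr (- a) * em_rem M (Suc j) b - of_nat (Suc j) powr (- a) * em_rem (Suc M) (Suc j) b)
      sums (double_zeta_em_ser M (a, b) - double_zeta_em_ser (Suc M) (a, b))"
    unfolding double_zeta_em_ser_def fst_conv snd_conv by (intro sums_diff summable_sums) auto
  then have "(\<lambda>j. double_zeta_em_coeff (Suc M) b * of_nat (1 + j) powr (- (a + b + of_nat M)))
      sums (double_zeta_em_ser M (a, b) - double_zeta_em_ser (Suc M) (a, b))"
    by (simp only: term_eq)
  moreover have "(\<lambda>j. double_zeta_em_coeff (Suc M) b * of_nat (1 + j) powr (- (a + b + of_nat M)))
      sums (double_zeta_em_coeff (Suc M) b * hurwitz_zeta 1 (a + b + of_nat M))"
    using ab by (intro sums_mult hurwitz_zeta_sums) auto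
  ultimately have "double_zeta_em_ser M (a, b) - double_zeta_em_ser (Suc M) (a, b) = double_zeta_em_coeff (Suc M) b * hurwitz_zeta 1 (a + b + of_nat M)"
    by (rule sums_unique2)
  then show ?thesis
    by (simp add: double_zeta_em_def algebra_simps)
qed

lemma double_zeta_em_mono:
  assumes "(a, b) \<in> double_zeta_em_dom M" "M \<le> L"
  shows "double_zeta_em L (a, b) = double_zeta_em M (a, b)"
  using assms(2)
proof (induction L rule: dec_induct)
  case (step L)
  have "(a, b) \<in> double_zeta_em_dom L"
    using assms(1) step(1) by (auto simp: double_zeta_em_dom_def)
  then show ?case using step double_zeta_em_Suc by simp
qed simp

text \<open>The order grows with the point, which gives one function on the whole complement; near
  each point it may be replaced by a fixed admissible order.\<close>

definition double_zeta :: "complex \<times> complex \<Rightarrow> complex" where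
  "double_zeta p = double_zeta_em (nat \<lceil>norm (fst p) + norm (snd p)\<rceil> + 2) p"

lemma double_zeta_eq_dz:
  assumes "(a, b) \<in> double_zeta_em_dom M"
  shows "double_zeta (a, b) = double_zeta_em M (a, b)"
proof -
  define L where "L = nat \<lceil>norm a + norm b\<rceil> + 2"
  have "real L \<ge> norm a + norm b + 2" unfolding L_def by linarith
  moreover have "\<bar>Re b\<bar> \<le> norm b" "\<bar>Re a\<bar> \<le> norm a" by (auto simp: abs_Re_le_cmod)
  ultimately have "Re b + real L > 0" "Re a + Re b + real L > 1"
    using norm_ge_zero[of a] norm_ge_zero[of b] by linarith+
  then have L: "(a, b) \<in> double_zeta_em_dom L"
    using assms by (auto simp: double_zeta_em_dom_def)
  have "double_zeta (a, b) = double_zeta_em L (a, b)"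
    by (simp add: double_zeta_def L_def)
  also have "\<dots> = double_zeta_em (max L M) (a, b)"
    using double_zeta_em_mono[OF L, of "max L M"] by simp
  also have "\<dots> = double_zeta_em M (a, b)"
    using double_zeta_em_mono[OF assms, of "max L M"] by simp
  finally show ?thesis .
qed

lemma ex_double_zeta_em_dom: "b \<noteq> 1 \<Longrightarrow> \<exists>M. (a, b) \<in> double_zeta_em_dom M"
proof -
  assume "b \<noteq> 1"
  obtain M where "max (- Re b) (1 - Re (a + b)) < real M"
    using reals_Archimedean2 by blast
  with \<open>b \<noteq> 1\<close> have "(a, b) \<in> double_zeta_em_dom M"
    by (auto simp: double_zeta_em_dom_def)
  then show ?thesis ..
qed

lemma holomorphic2_double_zeta: "holomorphic2_on double_zeta (- euler_double_zeta_singularities)"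
  unfolding holomorphic2_on_iff
proof clarify
  fix a b assume ab: "(a, b) \<notin> euler_double_zeta_singularities"
  then have "b \<noteq> 1" by (auto simp: euler_double_zeta_singularities_def)
  then obtain M where M: "(a, b) \<in> double_zeta_em_dom M" using ex_double_zeta_em_dom by blast
  from double_zeta_em_differentiable[OF M ab] obtain c d where
    "(double_zeta_em M has_derivative (\<lambda>(h, k). c * h + d * k)) (at (a, b))"
    unfolding complex_differentiable2_def by blast
  then have "(double_zeta has_derivative (\<lambda>(h, k). c * h + d * k)) (at (a, b))"
    by (rule has_derivative_transform_within_open[OF _ open_double_zeta_em_dom M]) (auto simp: double_zeta_eq_dz)
  then show "complex_differentiable2 double_zeta (a, b)"
    unfolding complex_differentiable2_def by blast
qed

section \<open>Splitting off partial sums, and identification with the chosen continuation\<close>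

definition zeta_psum :: "complex \<Rightarrow> nat \<Rightarrow> complex" where
  "zeta_psum s n = (\<Sum>m=1..<n. of_nat m powr (- s))"

lemma zeta_psum_Suc: "n \<ge> 1 \<Longrightarrow> zeta_psum s (Suc n) = zeta_psum s n + of_nat n powr (- s)"
  by (simp add: zeta_psum_def)

lemma zeta_psum_eq: "zeta_psum s n = (\<Sum>m=1..n-1. 1 / of_nat m powr s)"
  unfolding zeta_psum_def
  by (intro sum.cong) (auto simp: powr_minus_divide)

lemma double_zeta_summable:
  assumes "Re b > 0" "Re (a + b) > 1" "b \<noteq> 1" "K \<ge> 1"
  shows "summable (\<lambda>j. of_nat (K + j) powr (- a) * (em_rem 0 (K + j) b - of_nat (K + j) powr (- b)))"
proof -
  have "(a, b) \<in> double_zeta_em_dom 0" using assms by (auto simp: double_zeta_em_dom_def)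
  from double_zeta_em_ser_summable[OF this]
  have "summable (\<lambda>j. of_nat (Suc j) powr (- a) * em_rem 0 (Suc j) b)" .
  moreover have "summable (\<lambda>j. of_nat (Suc j) powr (- (a + b)))"
    using hurwitz_zeta_sums[of 1 "a + b"] assms by (simp add: sums_iff)
  ultimately have "summable (\<lambda>j. of_nat (Suc j) powr (- a) * em_rem 0 (Suc j) b - of_nat (Suc j) powr (- (a + b)))"
    by (rule summable_diff)
  then have "summable (\<lambda>j. of_nat (Suc j) powr (- a) * (em_rem 0 (Suc j) b - of_nat (Suc j) powr (- b)))"
    by (simp add: right_diff_distrib powr_add flip: powr_add)
  then have "summable (\<lambda>j. of_nat (Suc (j + (K - 1))) powr (- a) * (em_rem 0 (Suc (j + (K - 1))) b - of_nat (Suc (j + (K - 1))) powr (- b)))"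
    by (subst summable_iff_shift[where f = "\<lambda>j. of_nat (Suc j) powr (- a) * (em_rem 0 (Suc j) b - of_nat (Suc j) powr (- b))"])
  moreover have "Suc (j + (K - 1)) = K + j" for j
    using assms by simp
  ultimately show ?thesis by (simp only:)
qed

text \<open>Beyond the partial sum, the pairs m < K <= n give \<open>zeta_psum a K\<close> times a
  Hurwitz value, and the pairs K <= m < n give the order-0 expansion of the inner sum, summed over
  m. Induction on K moves one term at a time, so the identity reaches the continued function outside
  the region of absolute convergence.\<close>

lemma double_zeta_split:
  assumes b: "Re b > 0" "b \<noteq> 1" and ab: "Re (a + b) > 1" "a + b \<noteq> 2" and K: "K \<ge> 1"
  shows "double_zeta (a, b) = (\<Sum>n=1..<K. zeta_psum a n * of_nat n powr (- b)) + zeta_psum a K * hurwitz_zeta K b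
    + hurwitz_zeta K (a + b - 1) / (b - 1)
    + (\<Sum>j. of_nat (K + j) powr (- a) * (em_rem 0 (K + j) b - of_nat (K + j) powr (- b)))"
  using K
proof (induction K rule: dec_induct)
  case base
  have dom: "(a, b) \<in> double_zeta_em_dom 0" using b ab by (auto simp: double_zeta_em_dom_def)
  from double_zeta_em_ser_summable[OF this]
  have "summable (\<lambda>j. of_nat (Suc j) powr (- a) * em_rem 0 (Suc j) b)" .
  then have "(\<lambda>j. of_nat (1 + j) powr (- a) * em_rem 0 (1 + j) b) sums double_zeta_em_ser 0 (a, b)"
    unfolding double_zeta_em_ser_def by (simp add: sums_iff)
  moreover have "(\<lambda>j. of_nat (1 + j) powr (- (a + b))) sums hurwitz_zeta 1 (a + b)"
    using ab by (intro hurwitz_zeta_sums) auto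
  ultimately have "(\<lambda>j. of_nat (1 + j) powr (- a) * em_rem 0 (1 + j) b - of_nat (1 + j) powr (- (a + b)))
      sums (double_zeta_em_ser 0 (a, b) - hurwitz_zeta 1 (a + b))"
    by (rule sums_diff)
  moreover have "of_nat (1 + j) powr (- a) * em_rem 0 (1 + j) b - of_nat (1 + j) powr (- (a + b))
      = of_nat (1 + j) powr (- a) * (em_rem 0 (1 + j) b - of_nat (1 + j) powr (- b))" for j
    by (simp add: right_diff_distrib flip: powr_add)
  ultimately have "(\<Sum>j. of_nat (1 + j) powr (- a) * (em_rem 0 (1 + j) b - of_nat (1 + j) powr (- b)))
      = double_zeta_em_ser 0 (a, b) - hurwitz_zeta 1 (a + b)"
    by (simp add: sums_iff)
  then show ?case
    by (simp add: double_zeta_eq_dz[OF dom] double_zeta_em_def double_zeta_em_coeff_def zeta_psum_def)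
next
  case (step K)
  define f where "f j = of_nat (K + j) powr (- a) * (em_rem 0 (K + j) b - of_nat (K + j) powr (- b))" for j
  have "summable f"
    unfolding f_def using step b ab by (intro double_zeta_summable) auto
  then have split: "(\<Sum>j. f j) = f 0 + (\<Sum>j. f (Suc j))"
    using suminf_split_head by (metis add.commute diff_add_cancel)
  have Sf: "(\<Sum>j. of_nat (K + j) powr (- a) * (em_rem 0 (K + j) b - of_nat (K + j) powr (- b))) = (\<Sum>j. f j)"
    by (simp only: f_def)
  define x y where "x = (of_nat K powr (- a) :: complex)" and "y = (of_nat K powr (- b) :: complex)"
  have hurwitz_zeta_b: "hurwitz_zeta K b = y + hurwitz_zeta (Suc K) b"
    unfolding y_def using step b by (intro hurwitz_zeta_Suc) auto
  have em: "em_rem 0 K b = hurwitz_zeta K b - of_nat K powr (1 - b) / (b - 1)"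
    using step b by (subst hurwitz_zeta_eq[where M = 0]) (auto simp: em_poly_0)
  have "hurwitz_zeta K (a + b - 1) = of_nat K powr (- (a + b - 1)) + hurwitz_zeta (Suc K) (a + b - 1)"
    using step ab by (intro hurwitz_zeta_Suc) (auto simp: algebra_simps)
  also have "of_nat K powr (- (a + b - 1)) = x * of_nat K powr (1 - b)"
    by (simp add: x_def algebra_simps flip: powr_add)
  finally have hurwitz_zeta_ab: "hurwitz_zeta K (a + b - 1) = x * of_nat K powr (1 - b) + hurwitz_zeta (Suc K) (a + b - 1)" .
  have f0: "f 0 = x * hurwitz_zeta (Suc K) b - x * of_nat K powr (1 - b) / (b - 1)"
    by (simp add: f_def em hurwitz_zeta_b x_def y_def algebra_simps)
  have IH: "double_zeta (a, b) = (\<Sum>n=1..<K. zeta_psum a n * of_nat n powr (- b)) + zeta_psum a K * hurwitz_zeta K b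
    + hurwitz_zeta K (a + b - 1) / (b - 1) + (f 0 + (\<Sum>j. f (Suc j)))"
    using step.IH unfolding Sf split .
  have "(\<Sum>j. f (Suc j)) = (\<Sum>j. of_nat (Suc K + j) powr (- a) * (em_rem 0 (Suc K + j) b - of_nat (Suc K + j) powr (- b)))"
    by (simp add: f_def)
  moreover have "zeta_psum a (Suc K) = zeta_psum a K + x"
    using step by (simp add: zeta_psum_Suc x_def)
  moreover have "(\<Sum>n=1..<Suc K. zeta_psum a n * of_nat n powr (- b)) = (\<Sum>n=1..<K. zeta_psum a n * of_nat n powr (- b)) + zeta_psum a K * y"
    using step.hyps(1) by (simp add: y_def)
  ultimately show ?case
    using IH unfolding f0 hurwitz_zeta_ab hurwitz_zeta_b by (simp only:) (simp add: algebra_simps add_divide_distrib)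
qed

lemma double_zeta_series:
  assumes b: "Re b > 1" and ab: "Re (a + b) > 2"
  shows "double_zeta (a, b) = euler_double_zeta_series a b"
proof -
  have b1: "b \<noteq> 1" using b by auto
  have dom: "(a, b) \<in> double_zeta_em_dom 0" using b ab by (auto simp: double_zeta_em_dom_def)
  from double_zeta_em_ser_summable[OF this]
  have "summable (\<lambda>j. of_nat (Suc j) powr (- a) * em_rem 0 (Suc j) b)" .
  then have "(\<lambda>j. of_nat (1 + j) powr (- a) * em_rem 0 (1 + j) b) sums double_zeta_em_ser 0 (a, b)"
    unfolding double_zeta_em_ser_def by (simp add: sums_iff)
  moreover have "(\<lambda>j. of_nat (1 + j) powr (- (a + b))) sums hurwitz_zeta 1 (a + b)"
    using ab by (intro hurwitz_zeta_sums) auto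
  moreover have "(\<lambda>j. of_nat (1 + j) powr (- (a + b - 1)) / (b - 1)) sums (hurwitz_zeta 1 (a + b - 1) / (b - 1))"
    using ab by (intro sums_divide hurwitz_zeta_sums) auto
  ultimately have "(\<lambda>j. of_nat (1 + j) powr (- (a + b - 1)) / (b - 1)
      + (of_nat (1 + j) powr (- a) * em_rem 0 (1 + j) b - of_nat (1 + j) powr (- (a + b))))
      sums (hurwitz_zeta 1 (a + b - 1) / (b - 1) + (double_zeta_em_ser 0 (a, b) - hurwitz_zeta 1 (a + b)))"
    by (intro sums_add sums_diff)
  moreover have "of_nat (1 + j) powr (- (a + b - 1)) / (b - 1)
      + (of_nat (1 + j) powr (- a) * em_rem 0 (1 + j) b - of_nat (1 + j) powr (- (a + b)))
      = 1 / of_nat (Suc j) powr a * (\<Sum>n. 1 / of_nat (Suc j + Suc n) powr b)" for j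
  proof -
    have "(\<lambda>n. of_nat (Suc (Suc j) + n) powr (- b)) sums hurwitz_zeta (Suc (Suc j)) b"
      using b by (intro hurwitz_zeta_sums) auto
    then have "(\<lambda>n. 1 / of_nat (Suc j + Suc n) powr b) sums hurwitz_zeta (Suc (Suc j)) b"
      by (simp add: powr_minus_divide)
    then have *: "(\<Sum>n. 1 / of_nat (Suc j + Suc n) powr b) = hurwitz_zeta (Suc (Suc j)) b"
      by (rule sums_unique[symmetric])
    have "hurwitz_zeta (Suc j) b = of_nat (Suc j) powr (- b) + hurwitz_zeta (Suc (Suc j)) b"
      using b1 by (intro hurwitz_zeta_Suc) auto
    moreover have "hurwitz_zeta (Suc j) b = of_nat (Suc j) powr (1 - b) / (b - 1) + em_rem 0 (Suc j) b"
      using b b1 by (subst hurwitz_zeta_eq[where M = 0]) (auto simp: em_poly_0)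
    ultimately have eq: "hurwitz_zeta (Suc (Suc j)) b = of_nat (Suc j) powr (1 - b) / (b - 1) + em_rem 0 (Suc j) b - of_nat (Suc j) powr (- b)"
      by (simp add: algebra_simps)
    have "1 / of_nat (Suc j) powr a = of_nat (Suc j) powr (- a)"
      by (simp add: powr_minus_divide)
    moreover have "of_nat (Suc j) powr (- (a + b - 1)) = of_nat (Suc j) powr (- a) * of_nat (Suc j) powr (1 - b)"
      "of_nat (Suc j) powr (- (a + b)) = of_nat (Suc j) powr (- a) * of_nat (Suc j) powr (- b)"
      by (simp_all add: algebra_simps flip: powr_add del: of_nat_Suc)
    ultimately show ?thesis
      unfolding * eq by (simp add: algebra_simps del: of_nat_Suc)
  qed
  ultimately have "(\<lambda>j. 1 / of_nat (Suc j) powr a * (\<Sum>n. 1 / of_nat (Suc j + Suc n) powr b))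
      sums (hurwitz_zeta 1 (a + b - 1) / (b - 1) + (double_zeta_em_ser 0 (a, b) - hurwitz_zeta 1 (a + b)))"
    by simp
  then show ?thesis
    by (simp add: double_zeta_eq_dz[OF dom] double_zeta_em_def double_zeta_em_coeff_def euler_double_zeta_series_def sums_iff)
qed

lemma holomorphic2_slice:
  assumes "holomorphic2_on f U" "open U"
  shows "(\<lambda>w. f (a, w)) holomorphic_on {w. (a, w) \<in> U}"
proof -
  have "\<exists>d. ((\<lambda>w. f (a, w)) has_field_derivative d) (at w)" if "(a, w) \<in> U" for w
  proof -
    have "\<exists>c d. (f has_derivative (\<lambda>(h, k). c * h + d * k)) (at (a, w))"
      using bspec[OF assms(1)[unfolded holomorphic2_on_def] that] .
    then obtain c d where f: "(f has_derivative (\<lambda>(h, k). c * h + d * k)) (at (a, w))"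
      by blast
    have "(Pair a has_derivative Pair 0) (at w)"
      by (auto intro!: derivative_eq_intros)
    from has_derivative_compose[OF this f]
    have "((\<lambda>w. f (a, w)) has_derivative (\<lambda>k. (\<lambda>(h, k). c * h + d * k) (0, k))) (at w)" .
    then show ?thesis
      by (auto simp: has_field_derivative_def)
  qed
  then show ?thesis
    unfolding holomorphic_on_def field_differentiable_def
    by (auto intro: has_field_derivative_at_within)
qed

lemma closed_singularities: "closed euler_double_zeta_singularities"
proof -
  let ?A = "{2, 1} \<union> range (\<lambda>k::nat. - 2 * of_nat k) :: complex set"
  have "euler_double_zeta_singularities = {p. snd p = 1} \<union> (\<lambda>p. fst p + snd p) -` ?A"
    by (auto simp: euler_double_zeta_singularities_def)
  moreover have "?A \<subseteq> \<int>" by auto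
  then have "closed ?A" by (rule closed_subset_Ints)
  then have "closed ((\<lambda>p. fst p + snd p) -` ?A)"
    by (rule closed_vimage) (intro continuous_intros)
  moreover have "closed {p :: complex \<times> complex. snd p = 1}"
    by (intro closed_Collect_eq continuous_intros)
  ultimately show ?thesis by (metis closed_Un)
qed

text \<open>For fixed a the slice of the domain is the plane minus a countable set, hence connected,
  and it contains a half-plane on which the series represents both functions. The identity theorem
  in one variable thus settles uniqueness in two.\<close>

lemma euler_double_zeta_eq_double_zeta:
  assumes "(a, b) \<notin> euler_double_zeta_singularities"
  shows "euler_double_zeta a b = double_zeta (a, b)"
proof -
  let ?U = "- euler_double_zeta_singularities"
  have U: "open ?U" using closed_singularities by auto
  have "holomorphic2_on (\<lambda>(a, b). euler_double_zeta a b) ?U \<and>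
     (\<forall>a b. Re b > 1 \<and> Re (a + b) > 2 \<longrightarrow> euler_double_zeta a b = euler_double_zeta_series a b)"
    unfolding euler_double_zeta_def
    by (rule someI[of _ "\<lambda>a b. double_zeta (a, b)"]) (use double_zeta_series holomorphic2_double_zeta in auto)
  then have hol: "holomorphic2_on (\<lambda>(a, b). euler_double_zeta a b) ?U"
    and ser: "\<And>w. Re w > 1 \<Longrightarrow> Re (a + w) > 2 \<Longrightarrow> euler_double_zeta a w = double_zeta (a, w)"
    using double_zeta_series by auto
  define S where "S = {w. Re w > max 1 (2 - Re a)}"
  define V where "V = {w. (a, w) \<in> ?U}"
  let ?A = "{2, 1} \<union> range (\<lambda>k::nat. - 2 * of_nat k) :: complex set"
  let ?T = "insert 1 ((\<lambda>z. z - a) ` ?A)"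
  have "of_real (max 1 (2 - Re a) + 1) \<in> S"
    by (simp add: max_def S_def)
  then have "S \<noteq> {}" by blast
  have "open S" unfolding S_def by (rule open_halfspace_Re_gt)
  have "open V" unfolding V_def by (rule open_slices[OF U])
  have "w \<in> V \<longleftrightarrow> w \<in> UNIV - ?T" for w
  proof -
    have "a + w \<in> ?A \<longleftrightarrow> w \<in> (\<lambda>z. z - a) ` ?A"
      by (metis (no_types, lifting) add_diff_cancel_left' diff_add_cancel add.commute image_iff)
    then show ?thesis
      unfolding euler_double_zeta_singularities_def V_def by blast
  qed
  then have "V = UNIV - ?T" by blast
  also have "connected \<dots>"
    by (rule connected_open_diff_countable) auto
  finally have "connected V" .
  have "S \<subseteq> V"
  proof
    fix w assume "w \<in> S"
    then have w: "1 < Re w" "2 < Re (a + w)" by (auto simp: S_def)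
    have le: "Re z \<le> 2" if "z \<in> ?A" for z using that by auto
    have "a + w \<notin> ?A"
    proof
      assume "a + w \<in> ?A"
      from le[OF this] w show False by linarith
    qed
    moreover have "w \<noteq> 1" using w by auto
    ultimately show "w \<in> V"
      unfolding euler_double_zeta_singularities_def V_def by simp
  qed
  have hol_Z: "(\<lambda>w. euler_double_zeta a w) holomorphic_on V"
    using holomorphic2_slice[OF hol U, of a] by (simp add: V_def)
  have hol_double_zeta: "(\<lambda>w. double_zeta (a, w)) holomorphic_on V"
    using holomorphic2_slice[OF holomorphic2_double_zeta U, of a] by (simp add: V_def)
  have eq: "euler_double_zeta a w = double_zeta (a, w)" if "w \<in> S" for w
    using that by (intro ser) (auto simp: S_def)
  have bV: "b \<in> V" using assms by (simp add: V_def)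
  show ?thesis
    by (rule analytic_continuation_open[where f = "euler_double_zeta a" and g = "\<lambda>w. double_zeta (a, w)",
          OF \<open>open S\<close> \<open>open V\<close> \<open>S \<noteq> {}\<close> \<open>connected V\<close> \<open>S \<subseteq> V\<close> hol_Z hol_double_zeta eq bV])
qed

section \<open>Mean squares of Dirichlet polynomials\<close>

text \<open>The factor \<open>cis\<close> is the n-th power with exponent - i t; the decay n powr
  (-\<sigma>2) is put into the coefficients.\<close>

definition dpoly :: "(nat \<Rightarrow> complex) \<Rightarrow> nat set \<Rightarrow> real \<Rightarrow> complex" where
  "dpoly c A t = (\<Sum>n\<in>A. c n * cis (- (t * ln (real n))))"

lemma continuous_on_dpoly [continuous_intros]: "continuous_on S (dpoly c A)"
  unfolding dpoly_def by (intro continuous_intros)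

lemma dpoly_cross:
  "Re (dpoly c A t * cnj (dpoly c B t)) =
     (\<Sum>m\<in>A. \<Sum>n\<in>B. Re (c m * cnj (c n) * cis (t * (ln (real n) - ln (real m)))))"
proof -
  have "dpoly c A t * cnj (dpoly c B t) =
      (\<Sum>m\<in>A. \<Sum>n\<in>B. (c m * cis (- (t * ln (real m)))) * (cnj (c n) * cis (t * ln (real n))))"
    unfolding dpoly_def cnj_sum by (simp add: sum_product cis_cnj)
  also have "\<dots> = (\<Sum>m\<in>A. \<Sum>n\<in>B. c m * cnj (c n) * cis (t * (ln (real n) - ln (real m))))"
  proof (intro sum.cong refl)
    fix m n
    have "cis (- (t * ln (real m))) * cis (t * ln (real n)) = cis (t * (ln (real n) - ln (real m)))"
      by (simp add: cis_mult algebra_simps)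
    then show "c m * cis (- (t * ln (real m))) * (cnj (c n) * cis (t * ln (real n))) =
        c m * cnj (c n) * cis (t * (ln (real n) - ln (real m)))"
      by (metis (no_types, lifting) mult.assoc mult.left_commute)
  qed
  finally show ?thesis by simp
qed

lemma norm_square_eq_Re: "(norm (z :: complex))\<^sup>2 = Re (z * cnj z)"
  by (metis Re_complex_of_real complex_norm_square)

text \<open>The primitive has the same shape with z replaced by z / (i u), so the rule can be
  applied twice, as in \<open>mean_square_block\<close>.\<close>

lemma cis_deriv:
  assumes "u \<noteq> 0"
  shows "((\<lambda>t. Re (z * cis (t * u) / (\<i> * of_real u))) has_real_derivative Re (z * cis (t * u))) (at t)"
proof -
  have eq: "Re (z * cis (t * u) / (\<i> * of_real u)) = (Im z * cos (t * u) + Re z * sin (t * u)) / u" for t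
    using assms by (simp add: Re_divide Im_divide power2_eq_square field_simps)
  show ?thesis
    unfolding eq using assms by (auto intro!: derivative_eq_intros simp: field_simps)
qed

lemma ln_diff_ge_nat:
  assumes "m \<ge> 1" "n \<ge> 1" "m < n" "real n \<le> X"
  shows "(real n - real m) / X \<le> ln (real n) - ln (real m)"
proof -
  have "ln (real m / real n) \<le> real m / real n - 1"
    using assms by (intro ln_le_minus_one) auto
  then have "1 - real m / real n \<le> ln (real n) - ln (real m)"
    using assms by (simp add: ln_div)
  moreover have "(real n - real m) / X \<le> (real n - real m) / real n"
    using assms by (intro divide_left_mono) auto
  ultimately show ?thesis
    using assms by (simp add: diff_divide_distrib)
qed

lemma sum_inverse_squares_le: "N \<ge> 1 \<Longrightarrow> (\<Sum>d=1..N. 1 / (real d)\<^sup>2) \<le> 2 - 1 / real N"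
proof (induction N rule: dec_induct)
  case (step N)
  have "1 / (real (Suc N))\<^sup>2 \<le> 1 / (real N * real (Suc N))"
    using step by (intro divide_left_mono) (auto simp: power2_eq_square)
  also have "\<dots> = 1 / real N - 1 / real (Suc N)"
    using step by (simp add: field_simps)
  finally show ?case using step by simp
qed simp

text \<open>Each distance d >= 1 occurs at most once on either side of m, and the sum of 1 / d^2 is
  at most 2.\<close>

lemma sum_inverse_square_diff_le:
  fixes A :: "nat set"
  assumes "finite A"
  shows "(\<Sum>n\<in>A - {m}. 1 / (real m - real n)\<^sup>2) \<le> 4"
proof -
  have le2: "(\<Sum>d\<in>D. 1 / (real d)\<^sup>2) \<le> 2" if "finite D" "0 \<notin> D" for D :: "nat set"
  proof -
    obtain N where "D \<subseteq> {..N}" using \<open>finite D\<close> by (meson finite_nat_iff_bounded_le)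
    have "D \<subseteq> {1..Suc N}"
    proof
      fix d assume d: "d \<in> D"
      with that(2) have "d \<noteq> 0" by metis
      with d \<open>D \<subseteq> {..N}\<close> show "d \<in> {1..Suc N}" by auto
    qed
    then have "(\<Sum>d\<in>D. 1 / (real d)\<^sup>2) \<le> (\<Sum>d=1..Suc N. 1 / (real d)\<^sup>2)"
      by (intro sum_mono2) auto
    also have "\<dots> \<le> 2 - 1 / real (Suc N)" by (rule sum_inverse_squares_le) simp
    also have "\<dots> \<le> 2" by simp
    finally show ?thesis .
  qed
  have "(\<Sum>n\<in>A - {m}. 1 / (real m - real n)\<^sup>2)
      = (\<Sum>n\<in>{n\<in>A. n < m}. 1 / (real m - real n)\<^sup>2) + (\<Sum>n\<in>{n\<in>A. m < n}. 1 / (real m - real n)\<^sup>2)"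
    using assms by (subst sum.union_disjoint[symmetric]) (auto intro!: sum.cong)
  also have "(\<Sum>n\<in>{n\<in>A. n < m}. 1 / (real m - real n)\<^sup>2) = (\<Sum>d\<in>(\<lambda>n. m - n) ` {n\<in>A. n < m}. 1 / (real d)\<^sup>2)"
    by (subst sum.reindex) (auto simp: inj_on_def of_nat_diff)
  also have "\<dots> \<le> 2"
    using assms by (intro le2) auto
  also have "(\<Sum>n\<in>{n\<in>A. m < n}. 1 / (real m - real n)\<^sup>2) = (\<Sum>d\<in>(\<lambda>n. n - m) ` {n\<in>A. m < n}. 1 / (real d)\<^sup>2)"
    by (subst sum.reindex) (auto simp: inj_on_def of_nat_diff power2_commute)
  also have "\<dots> \<le> 2"
    using assms by (intro le2) auto
  finally show ?thesis by simp
qed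

text \<open>Schur's test: the products are split by the arithmetic-geometric mean inequality, and
  the row sums of the symmetric kernel are at most 4. The square in the denominator is what makes
  these row sums bounded.\<close>

lemma hilbert_type_bound:
  fixes x :: "nat \<Rightarrow> real"
  assumes "finite A" "\<And>n. x n \<ge> 0"
  shows "(\<Sum>m\<in>A. \<Sum>n\<in>A - {m}. x m * x n / (real m - real n)\<^sup>2) \<le> 4 * (\<Sum>n\<in>A. (x n)\<^sup>2)"
proof -
  let ?w = "\<lambda>m n. if n = m then 0 else 1 / (real m - real n)\<^sup>2"
  have w: "(\<Sum>n\<in>A. ?w m n) \<le> 4" for m
  proof -
    have "(\<Sum>n\<in>A. ?w m n) = (\<Sum>n\<in>A - {m}. 1 / (real m - real n)\<^sup>2)"
      using assms by (intro sum.mono_neutral_cong_right) auto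
    then show ?thesis using sum_inverse_square_diff_le[OF assms(1)] by simp
  qed
  have "(\<Sum>n\<in>A - {m}. x m * x n / (real m - real n)\<^sup>2) = (\<Sum>n\<in>A. x m * x n * ?w m n)" for m
    using assms by (intro sum.mono_neutral_cong_left) auto
  then have "(\<Sum>m\<in>A. \<Sum>n\<in>A - {m}. x m * x n / (real m - real n)\<^sup>2) = (\<Sum>m\<in>A. \<Sum>n\<in>A. x m * x n * ?w m n)"
    by simp
  also have "\<dots> \<le> (\<Sum>m\<in>A. \<Sum>n\<in>A. ((x m)\<^sup>2 / 2 + (x n)\<^sup>2 / 2) * ?w m n)"
  proof (intro sum_mono mult_right_mono)
    show "x m * x n \<le> (x m)\<^sup>2 / 2 + (x n)\<^sup>2 / 2" for m n
      using sum_squares_bound[of "x m" "x n"] by simp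
  qed auto
  also have "\<dots> = (\<Sum>m\<in>A. \<Sum>n\<in>A. (x m)\<^sup>2 / 2 * ?w m n) + (\<Sum>m\<in>A. \<Sum>n\<in>A. (x n)\<^sup>2 / 2 * ?w m n)"
    by (simp add: distrib_right sum.distrib)
  also have "(\<Sum>m\<in>A. \<Sum>n\<in>A. (x n)\<^sup>2 / 2 * ?w m n) = (\<Sum>n\<in>A. \<Sum>m\<in>A. (x n)\<^sup>2 / 2 * ?w m n)"
    by (rule sum.swap)
  also have "\<dots> = (\<Sum>m\<in>A. \<Sum>n\<in>A. (x m)\<^sup>2 / 2 * ?w m n)"
    by (intro sum.cong refl) (simp add: power2_commute)
  also have "(\<Sum>m\<in>A. \<Sum>n\<in>A. (x m)\<^sup>2 / 2 * ?w m n) = (\<Sum>m\<in>A. (x m)\<^sup>2 / 2 * (\<Sum>n\<in>A. ?w m n))"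
    by (simp only: sum_distrib_left)
  also have "\<dots> \<le> (\<Sum>m\<in>A. (x m)\<^sup>2 / 2 * 4)"
    by (intro sum_mono mult_left_mono w) auto
  finally show ?thesis
    by (simp add: sum_distrib_left)
qed

lemma square_eq_off_diagonal:
  "(norm (dpoly c A t))\<^sup>2 = (\<Sum>n\<in>A. (norm (c n))\<^sup>2)
     + (\<Sum>m\<in>A. \<Sum>n\<in>A - {m}. Re (c m * cnj (c n) * cis (t * (ln (real n) - ln (real m)))))"
  if "finite A"
proof -
  have "(norm (dpoly c A t))\<^sup>2 = (\<Sum>m\<in>A. \<Sum>n\<in>A. Re (c m * cnj (c n) * cis (t * (ln (real n) - ln (real m)))))"
    unfolding norm_square_eq_Re dpoly_cross ..
  also have "\<dots> = (\<Sum>m\<in>A. (norm (c m))\<^sup>2 + (\<Sum>n\<in>A - {m}. Re (c m * cnj (c n) * cis (t * (ln (real n) - ln (real m))))))"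
    using that by (intro sum.cong refl) (simp add: sum.remove norm_square_eq_Re)
  finally show ?thesis by (simp add: sum.distrib)
qed

text \<open>
  Since \<open>|S|\<^sup>2\<close> is nonnegative, \<open>F(t) = V t + G(t)\<close> is increasing, where \<open>G\<close> collects the
  off-diagonal terms. Hence \<open>G(t)\<close> is at most its mean over \<open>[t, t + P]\<close> plus \<open>P V\<close>, and this mean
  is small because integrating \<open>G\<close> once more brings in a second factor \<open>1 / log(n/m)\<close>, for which the
  double sum converges absolutely. This replaces the Montgomery-Vaughan inequality.
\<close>

lemma mean_square_block:
  fixes c :: "nat \<Rightarrow> complex" and P :: nat
  assumes A: "finite A" "A \<subseteq> {P..4 * P}" and P: "P \<ge> 1" and ab: "a \<le> b"
  defines "V \<equiv> (\<Sum>n\<in>A. (norm (c n))\<^sup>2)"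
  shows "\<bar>integral {a..b} (\<lambda>t. (norm (dpoly c A t))\<^sup>2) - (b - a) * V\<bar> \<le> 258 * real P * V"
proof -
  define u where "u m n = ln (real n) - ln (real m)" for m n :: nat
  define z where "z m n = c m * cnj (c n)" for m n
  \<comment> \<open>\<open>H\<close> is a primitive of \<open>G\<close>, and \<open>G\<close> one of
    \<open>g\<close>; each integration divides by the logarithmic gap \<open>u m n\<close>.\<close>
  define g where "g t = (\<Sum>m\<in>A. \<Sum>n\<in>A - {m}. Re (z m n * cis (t * u m n)))" for t
  define G where "G t = (\<Sum>m\<in>A. \<Sum>n\<in>A - {m}. Re (z m n * cis (t * u m n) / (\<i> * of_real (u m n))))" for t
  define H where "H t = (\<Sum>m\<in>A. \<Sum>n\<in>A - {m}. Re (z m n / (\<i> * of_real (u m n)) * cis (t * u m n) / (\<i> * of_real (u m n))))" for t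
  have pos: "n \<ge> 1" "real n \<le> 4 * real P" if "n \<in> A" for n
    using subsetD[OF A(2) that] P by auto
  have u_ge: "\<bar>real m - real n\<bar> / (4 * real P) \<le> \<bar>u m n\<bar>" if "m \<in> A" "n \<in> A" "m \<noteq> n" for m n
  proof (cases "m < n")
    case True
    then show ?thesis
      using ln_diff_ge_nat[of m n "4 * real P"] pos[OF that(1)] pos[OF that(2)] by (auto simp: u_def)
  next
    case False
    then show ?thesis
      using ln_diff_ge_nat[of n m "4 * real P"] pos[OF that(1)] pos[OF that(2)] that(3) by (auto simp: u_def)
  qed
  have u0: "u m n \<noteq> 0" if "m \<in> A" "n \<in> A" "m \<noteq> n" for m n
  proof -
    have "0 < \<bar>real m - real n\<bar> / (4 * real P)" using that P by simp
    then show ?thesis using u_ge[OF that] by auto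
  qed
  have dG: "(G has_real_derivative g t) (at t)" for t
    unfolding G_def g_def by (intro DERIV_sum cis_deriv u0) auto
  have dH: "(H has_real_derivative G t) (at t)" for t
  proof -
    have "(H has_real_derivative (\<Sum>m\<in>A. \<Sum>n\<in>A - {m}. Re (z m n / (\<i> * of_real (u m n)) * cis (t * u m n)))) (at t)"
      unfolding H_def by (intro DERIV_sum cis_deriv u0) auto
    then show ?thesis by (simp add: G_def)
  qed
  have V0: "V \<ge> 0" unfolding V_def by (intro sum_nonneg) auto
  \<comment> \<open>The gap is at least |m - n| / (4 P), so two divisions cost 16 P^2;
    \<open>hilbert_type_bound\<close> contributes the factor 4.\<close>
  have H_le: "\<bar>H t\<bar> \<le> 64 * (real P)\<^sup>2 * V" for t
  proof -
    have term_le: "\<bar>Re (z m n / (\<i> * of_real (u m n)) * cis (t * u m n) / (\<i> * of_real (u m n)))\<bar>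
        \<le> 16 * (real P)\<^sup>2 * (norm (c m) * norm (c n) / (real m - real n)\<^sup>2)" if "m \<in> A" "n \<in> A - {m}" for m n
    proof -
      have mn: "n \<in> A" "m \<noteq> n" using that by auto
      have "\<bar>Re (z m n / (\<i> * of_real (u m n)) * cis (t * u m n) / (\<i> * of_real (u m n)))\<bar>
          \<le> norm (z m n / (\<i> * of_real (u m n)) * cis (t * u m n) / (\<i> * of_real (u m n)))"
        by (rule abs_Re_le_cmod)
      also have "\<dots> = norm (c m) * norm (c n) / \<bar>u m n\<bar>\<^sup>2"
        by (simp add: z_def norm_mult norm_divide power2_eq_square)
      also have "\<dots> \<le> norm (c m) * norm (c n) / (\<bar>real m - real n\<bar> / (4 * real P))\<^sup>2"
        using u0[OF that(1) mn] mn P by (intro divide_left_mono power_mono u_ge that(1) mult_pos_pos) auto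
      also have "\<dots> = 16 * (real P)\<^sup>2 * (norm (c m) * norm (c n) / (real m - real n)\<^sup>2)"
        by (simp add: power_divide power_mult_distrib)
      finally show ?thesis .
    qed
    have "\<bar>H t\<bar> \<le> (\<Sum>m\<in>A. \<bar>\<Sum>n\<in>A - {m}. Re (z m n / (\<i> * of_real (u m n)) * cis (t * u m n) / (\<i> * of_real (u m n)))\<bar>)"
      unfolding H_def by (rule sum_abs)
    also have "\<dots> \<le> (\<Sum>m\<in>A. \<Sum>n\<in>A - {m}. \<bar>Re (z m n / (\<i> * of_real (u m n)) * cis (t * u m n) / (\<i> * of_real (u m n)))\<bar>)"
      by (intro sum_mono sum_abs)
    also have "\<dots> \<le> (\<Sum>m\<in>A. \<Sum>n\<in>A - {m}. 16 * (real P)\<^sup>2 * (norm (c m) * norm (c n) / (real m - real n)\<^sup>2))"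
      by (intro sum_mono term_le)
    also have "\<dots> = 16 * (real P)\<^sup>2 * (\<Sum>m\<in>A. \<Sum>n\<in>A - {m}. norm (c m) * norm (c n) / (real m - real n)\<^sup>2)"
      by (simp only: sum_distrib_left)
    also have "\<dots> \<le> 16 * (real P)\<^sup>2 * (4 * V)"
      unfolding V_def by (intro mult_left_mono hilbert_type_bound A) auto
    finally show ?thesis by simp
  qed
  define F where "F t = V * t + G t" for t
  have sq: "(norm (dpoly c A t))\<^sup>2 = V + g t" for t
    unfolding square_eq_off_diagonal[OF A(1)] V_def g_def z_def u_def ..
  have dF: "(F has_real_derivative (norm (dpoly c A t))\<^sup>2) (at t)" for t
    unfolding F_def sq by (auto intro!: derivative_eq_intros dG)
  have F_mono: "F s \<le> F t" if "s \<le> t" for s t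
    by (rule DERIV_nonneg_imp_nondecreasing[OF that], rule exI, rule conjI[OF dF]) simp
  \<comment> \<open>The increments of \<open>H\<close> over intervals of length P give v > t with G
    v <= 128 P V and w < t with - G w <= 128 P V. Monotonicity of \<open>F\<close> carries both
    bounds to t at the additional cost P V; hence 129, and 258 for two endpoints.\<close>
  have G_le: "\<bar>G t\<bar> \<le> 129 * real P * V" for t
  proof -
    have "\<exists>v>t. v < t + real P \<and> H (t + real P) - H t = (t + real P - t) * G v"
      using P by (intro MVT2) (auto intro: dH)
    then obtain v where v: "t < v" "v < t + real P" "H (t + real P) - H t = real P * G v" by auto
    have "\<exists>w>t - real P. w < t \<and> H t - H (t - real P) = (t - (t - real P)) * G w"
      using P by (intro MVT2) (auto intro: dH)
    then obtain w where w: "t - real P < w" "w < t" "H t - H (t - real P) = real P * G w" by auto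
    have "real P * G v \<le> 128 * (real P)\<^sup>2 * V"
      using v(3) H_le[of t] H_le[of "t + real P"] by (simp add: abs_le_iff)
    then have Gv: "G v \<le> 128 * real P * V"
      using P by (simp add: power2_eq_square mult.assoc)
    have "real P * (- G w) \<le> 128 * (real P)\<^sup>2 * V"
      using w(3) H_le[of t] H_le[of "t - real P"] by (simp add: abs_le_iff)
    also have "\<dots> = real P * (128 * real P * V)"
      by (simp add: power2_eq_square)
    finally have Gw: "- G w \<le> 128 * real P * V"
      by (rule mult_left_le_imp_le) (use P in auto)
    have "V * (v - t) \<le> V * real P" "V * (t - w) \<le> V * real P"
      using V0 v w by (intro mult_left_mono; simp)+
    moreover have "V * t + G t \<le> V * v + G v" "V * w + G w \<le> V * t + G t"
      using F_mono[of t v] F_mono[of w t] v w by (auto simp: F_def)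
    ultimately show ?thesis
      using Gv Gw by (simp add: abs_le_iff algebra_simps)
  qed
  have "((\<lambda>t. (norm (dpoly c A t))\<^sup>2) has_integral (F b - F a)) {a..b}"
    by (rule fundamental_theorem_of_calculus[OF ab])
       (use dF in \<open>auto simp: has_real_derivative_iff_has_vector_derivative[symmetric] intro: has_field_derivative_at_within\<close>)
  then have "integral {a..b} (\<lambda>t. (norm (dpoly c A t))\<^sup>2) = F b - F a"
    by (rule integral_unique)
  then show ?thesis
    using G_le[of a] G_le[of b] by (simp add: F_def abs_le_iff algebra_simps)
qed

text \<open>All logarithmic gaps are at least 1/2, so one integration and the triangle inequality
  suffice; each of the two endpoints costs a factor 2.\<close>

lemma dpoly_cross_far:
  assumes A: "finite A" "finite B" and far: "\<And>m n. m \<in> A \<Longrightarrow> n \<in> B \<Longrightarrow> 1 \<le> m \<and> 2 * m \<le> n" and ab: "a \<le> b"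
  shows "\<bar>integral {a..b} (\<lambda>t. Re (dpoly c A t * cnj (dpoly c B t)))\<bar>
    \<le> 4 * (\<Sum>m\<in>A. norm (c m)) * (\<Sum>n\<in>B. norm (c n))"
proof -
  define u where "u m n = ln (real n) - ln (real m)" for m n :: nat
  define z where "z m n = c m * cnj (c n)" for m n
  define G where "G t = (\<Sum>m\<in>A. \<Sum>n\<in>B. Re (z m n * cis (t * u m n) / (\<i> * of_real (u m n))))" for t
  have u: "u m n \<ge> 1/2" if "m \<in> A" "n \<in> B" for m n
  proof -
    have "(real n - real m) / real n \<le> u m n"
      unfolding u_def using far[OF that] by (intro ln_diff_ge_nat) auto
    moreover have "1/2 \<le> (real n - real m) / real n"
      using far[OF that] by (simp add: field_simps)
    ultimately show ?thesis by linarith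
  qed
  have u0: "u m n \<noteq> 0" if "m \<in> A" "n \<in> B" for m n
    using u[OF that] by auto
  have "(G has_real_derivative Re (dpoly c A t * cnj (dpoly c B t))) (at t)" for t
    unfolding G_def dpoly_cross z_def[symmetric] u_def[symmetric]
    by (intro DERIV_sum cis_deriv u0)
  then have "((\<lambda>t. Re (dpoly c A t * cnj (dpoly c B t))) has_integral (G b - G a)) {a..b}"
    by (intro fundamental_theorem_of_calculus[OF ab])
       (auto simp: has_real_derivative_iff_has_vector_derivative[symmetric] intro: has_field_derivative_at_within)
  then have int: "integral {a..b} (\<lambda>t. Re (dpoly c A t * cnj (dpoly c B t))) = G b - G a"
    by (rule integral_unique)
  have "\<bar>G t\<bar> \<le> 2 * ((\<Sum>m\<in>A. norm (c m)) * (\<Sum>n\<in>B. norm (c n)))" for t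
  proof -
    have term_le: "\<bar>Re (z m n * cis (t * u m n) / (\<i> * of_real (u m n)))\<bar> \<le> 2 * (norm (c m) * norm (c n))"
      if "m \<in> A" "n \<in> B" for m n
    proof -
      have "\<bar>Re (z m n * cis (t * u m n) / (\<i> * of_real (u m n)))\<bar> \<le> norm (z m n * cis (t * u m n) / (\<i> * of_real (u m n)))"
        by (rule abs_Re_le_cmod)
      also have "\<dots> = norm (c m) * norm (c n) / \<bar>u m n\<bar>"
        by (simp add: z_def norm_mult norm_divide)
      also have "\<dots> \<le> norm (c m) * norm (c n) / (1/2)"
        using u[OF that] by (intro divide_left_mono) auto
      finally show ?thesis by simp
    qed
    have "\<bar>G t\<bar> \<le> (\<Sum>m\<in>A. \<bar>\<Sum>n\<in>B. Re (z m n * cis (t * u m n) / (\<i> * of_real (u m n)))\<bar>)"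
      unfolding G_def by (rule sum_abs)
    also have "\<dots> \<le> (\<Sum>m\<in>A. \<Sum>n\<in>B. \<bar>Re (z m n * cis (t * u m n) / (\<i> * of_real (u m n)))\<bar>)"
      by (intro sum_mono sum_abs)
    also have "\<dots> \<le> (\<Sum>m\<in>A. \<Sum>n\<in>B. 2 * (norm (c m) * norm (c n)))"
      by (intro sum_mono term_le)
    also have "\<dots> = 2 * ((\<Sum>m\<in>A. norm (c m)) * (\<Sum>n\<in>B. norm (c n)))"
      by (simp only: sum_distrib_left[symmetric] sum_product)
    finally show ?thesis .
  qed
  from this[of a] this[of b] show ?thesis
    unfolding int by (simp add: abs_le_iff mult.assoc)
qed

lemma dpoly_Un: "finite A \<Longrightarrow> finite B \<Longrightarrow> A \<inter> B = {} \<Longrightarrow> dpoly c (A \<union> B) t = dpoly c A t + dpoly c B t"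
  unfolding dpoly_def by (rule sum.union_disjoint)

lemma norm_add_square: "(norm (x + y :: complex))\<^sup>2 = (norm x)\<^sup>2 + 2 * Re (x * cnj y) + (norm y)\<^sup>2"
  by (simp add: norm_square_eq_Re algebra_simps)

lemma integrable_dpoly [simp]:
  "(\<lambda>t. (norm (dpoly c A t))\<^sup>2) integrable_on {a..b}"
  "(\<lambda>t. Re (dpoly c A t * cnj (dpoly c B t))) integrable_on {a..b}"
  by (intro integrable_continuous_interval continuous_intros)+

lemma integral_norm_add_square:
  "integral {a..b} (\<lambda>t. (norm (dpoly c A t + dpoly c B t))\<^sup>2) =
     integral {a..b} (\<lambda>t. (norm (dpoly c A t))\<^sup>2)
     + 2 * integral {a..b} (\<lambda>t. Re (dpoly c A t * cnj (dpoly c B t)))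
     + integral {a..b} (\<lambda>t. (norm (dpoly c B t))\<^sup>2)"
  unfolding norm_add_square
  by (subst integral_add; (subst integral_add)?)
     (auto intro!: integrable_add integrable_on_mult_right simp del: times_complex.sel)

text \<open>Polarization: \<open>mean_square_block\<close> is applied to A, B and their union, and
  the main terms cancel. This is why its blocks may reach from P to 4 P, the span of two adjacent
  dyadic blocks.\<close>

lemma dpoly_cross_near:
  assumes A: "finite A" "A \<subseteq> {P..4 * P}" and B: "finite B" "B \<subseteq> {P..4 * P}" and disj: "A \<inter> B = {}"
    and P: "P \<ge> 1" and ab: "a \<le> b"
  shows "\<bar>integral {a..b} (\<lambda>t. Re (dpoly c A t * cnj (dpoly c B t)))\<bar>
    \<le> 258 * real P * ((\<Sum>n\<in>A. (norm (c n))\<^sup>2) + (\<Sum>n\<in>B. (norm (c n))\<^sup>2))"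
proof -
  let ?V = "\<lambda>A. \<Sum>n\<in>A. (norm (c n))\<^sup>2"
  let ?I = "\<lambda>A. integral {a..b} (\<lambda>t. (norm (dpoly c A t))\<^sup>2)"
  have V: "?V (A \<union> B) = ?V A + ?V B"
    by (rule sum.union_disjoint[OF A(1) B(1) disj])
  have "?I (A \<union> B) = ?I A + 2 * integral {a..b} (\<lambda>t. Re (dpoly c A t * cnj (dpoly c B t))) + ?I B"
    unfolding dpoly_Un[OF A(1) B(1) disj] by (rule integral_norm_add_square)
  moreover have "\<bar>?I (A \<union> B) - (b - a) * ?V (A \<union> B)\<bar> \<le> 258 * real P * ?V (A \<union> B)"
    using A B by (intro mean_square_block P ab) auto
  moreover have "\<bar>?I A - (b - a) * ?V A\<bar> \<le> 258 * real P * ?V A"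
    using A by (intro mean_square_block P ab) auto
  moreover have "\<bar>?I B - (b - a) * ?V B\<bar> \<le> 258 * real P * ?V B"
    using B by (intro mean_square_block P ab) auto
  ultimately show ?thesis
    unfolding V by (simp add: abs_le_iff algebra_simps)
qed

lemma sum_squares_le_square_sum:
  fixes y :: "nat \<Rightarrow> real"
  assumes "\<And>j. y j \<ge> 0"
  shows "(\<Sum>j<L. (y j)\<^sup>2) \<le> (\<Sum>j<L. y j)\<^sup>2"
proof (induction L)
  case (Suc L)
  have "0 \<le> (\<Sum>j<L. y j) * y L"
    by (intro mult_nonneg_nonneg sum_nonneg assms)
  with Suc.IH show ?case by (simp add: power2_sum)
qed simp

text \<open>\<open>y j\<close> bounds 2^j |c n| on the j-th block, hence also the sum of |c n| over
  the block and the square root of 2^j times the sum of |c n|^2. The first controls distant blocks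
  through \<open>dpoly_cross_far\<close>, the second the block itself and its neighbour.\<close>

lemma mean_square_dyadic:
  fixes c :: "nat \<Rightarrow> complex" and y :: "nat \<Rightarrow> real"
  assumes y: "\<And>j n. 2 ^ j \<le> n \<Longrightarrow> n < 2 ^ Suc j \<Longrightarrow> norm (c n) \<le> y j / 2 ^ j" and ab: "a \<le> b"
  shows "\<bar>integral {a..b} (\<lambda>t. (norm (dpoly c {1..<2 ^ L} t))\<^sup>2) - (b - a) * (\<Sum>n\<in>{1..<2 ^ L}. (norm (c n))\<^sup>2)\<bar>
    \<le> 1300 * (\<Sum>j<L. y j)\<^sup>2"
proof -
  define D where "D j = {2 ^ j..<2 ^ Suc j :: nat}" for j
  define V where "V A = (\<Sum>n\<in>A. (norm (c n))\<^sup>2)" for A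
  define I where "I A = integral {a..b} (\<lambda>t. (norm (dpoly c A t))\<^sup>2)" for A
  define X where "X A B = integral {a..b} (\<lambda>t. Re (dpoly c A t * cnj (dpoly c B t)))" for A B
  have y0: "y j \<ge> 0" for j
    using mult_nonneg_nonneg[OF order_trans[OF norm_ge_zero y[of j "2 ^ j"]], of "2 ^ j"] by simp
  have fin: "finite (D j)" for j by (simp add: D_def)
  have L1: "(\<Sum>n\<in>D j. norm (c n)) \<le> y j" for j
  proof -
    have "(\<Sum>n\<in>D j. norm (c n)) \<le> (\<Sum>n\<in>D j. y j / 2 ^ j)"
      by (intro sum_mono y) (auto simp: D_def)
    also have "\<dots> = y j" by (simp add: D_def)
    finally show ?thesis .
  qed
  have VD: "2 ^ j * V (D j) \<le> (y j)\<^sup>2" for j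
  proof -
    have "V (D j) \<le> (\<Sum>n\<in>D j. (y j / 2 ^ j)\<^sup>2)"
      unfolding V_def by (intro sum_mono power_mono y) (auto simp: D_def)
    also have "\<dots> = (y j)\<^sup>2 / 2 ^ j" by (simp add: D_def power2_eq_square)
    finally show ?thesis by (simp add: field_simps)
  qed
  have V0: "V A \<ge> 0" for A
    unfolding V_def by (intro sum_nonneg) auto
  have low_L1: "(\<Sum>n\<in>{1..<2 ^ L}. norm (c n)) \<le> (\<Sum>j<L. y j)" for L
  proof (induction L)
    case (Suc L)
    have "{1..<2 ^ Suc L} = {1..<2 ^ L} \<union> D L" by (auto simp: D_def)
    then have "(\<Sum>n\<in>{1..<2 ^ Suc L}. norm (c n)) = (\<Sum>n\<in>{1..<2 ^ L}. norm (c n)) + (\<Sum>n\<in>D L. norm (c n))"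
      by (simp only:) (intro sum.union_disjoint, auto simp: D_def)
    with Suc.IH L1[of L] show ?case by simp
  qed simp
  define Y where "Y L = (\<Sum>j<L. y j)" for L
  define e where "e L = \<bar>I {1..<2 ^ L} - (b - a) * V {1..<2 ^ L}\<bar>" for L
  have Y0: "Y L \<ge> 0" for L unfolding Y_def by (intro sum_nonneg y0)
  have step: "e (Suc L) \<le> e L + 2 * \<bar>X {1..<2 ^ L} (D L)\<bar> + 258 * (y L)\<^sup>2" for L
  proof -
    have un: "{1..<2 ^ Suc L} = {1..<2 ^ L} \<union> D L" by (auto simp: D_def)
    have "I {1..<2 ^ Suc L} = I {1..<2 ^ L} + 2 * X {1..<2 ^ L} (D L) + I (D L)"
      unfolding un I_def X_def
      by (subst dpoly_Un) (auto simp: D_def integral_norm_add_square)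
    moreover have "V {1..<2 ^ Suc L} = V {1..<2 ^ L} + V (D L)"
      unfolding un V_def by (rule sum.union_disjoint) (auto simp: D_def)
    moreover have "\<bar>I (D L) - (b - a) * V (D L)\<bar> \<le> 258 * real (2 ^ L) * V (D L)"
      unfolding I_def V_def by (intro mean_square_block ab fin) (auto simp: D_def)
    moreover have "258 * real (2 ^ L) * V (D L) \<le> 258 * (y L)\<^sup>2"
      using VD[of L] by simp
    ultimately show ?thesis
      unfolding e_def by (simp add: algebra_simps)
  qed
  \<comment> \<open>Of everything below the new block only the preceding block is adjacent to it;
    the rest is smaller by a factor of at least 2.\<close>
  have cross: "\<bar>X {1..<2 ^ Suc L} (D (Suc L))\<bar> \<le> 4 * Y (Suc L) * y (Suc L) + 258 * ((y L)\<^sup>2 + (y (Suc L))\<^sup>2)" for L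
  proof -
    have un: "{1..<2 ^ Suc L} = {1..<2 ^ L} \<union> D L" by (auto simp: D_def)
    have "X {1..<2 ^ Suc L} (D (Suc L)) = X {1..<2 ^ L} (D (Suc L)) + X (D L) (D (Suc L))"
      unfolding un X_def
      by (subst dpoly_Un) (auto simp: D_def distrib_right integral_add simp del: times_complex.sel)
    moreover have "\<bar>X {1..<2 ^ L} (D (Suc L))\<bar> \<le> 4 * (\<Sum>m\<in>{1..<2 ^ L}. norm (c m)) * (\<Sum>n\<in>D (Suc L). norm (c n))"
      unfolding X_def by (intro dpoly_cross_far ab fin) (auto simp: D_def)
    moreover have "\<dots> \<le> 4 * Y (Suc L) * y (Suc L)"
    proof (intro mult_mono)
      show "(\<Sum>m\<in>{1..<2 ^ L}. norm (c m)) \<le> Y (Suc L)"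
        using low_L1[of L] y0[of L] by (simp add: Y_def)
    qed (use L1 Y0 in \<open>auto intro: sum_nonneg\<close>)
    moreover have "\<bar>X (D L) (D (Suc L))\<bar> \<le> 258 * real (2 ^ L) * (V (D L) + V (D (Suc L)))"
      unfolding X_def V_def by (intro dpoly_cross_near ab fin) (auto simp: D_def)
    moreover have "258 * real (2 ^ L) * (V (D L) + V (D (Suc L))) \<le> 258 * ((y L)\<^sup>2 + (y (Suc L))\<^sup>2)"
    proof -
      have "2 ^ L * V (D (Suc L)) \<le> 2 ^ Suc L * V (D (Suc L))"
        by (intro mult_right_mono V0) auto
      with VD[of L] VD[of "Suc L"] show ?thesis by (simp add: algebra_simps)
    qed
    ultimately show ?thesis by (simp add: abs_le_iff)
  qed
  text \<open>The last term leaves room for the interaction with the next block.\<close>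
  have e_le: "e (Suc L) \<le> 4 * (Y (Suc L))\<^sup>2 + 1290 * (\<Sum>j<Suc L. (y j)\<^sup>2) - 516 * (y L)\<^sup>2" for L
  proof (induction L)
    case 0
    have "e 0 = 0" by (simp add: e_def I_def V_def dpoly_def)
    moreover have "X {1..<2 ^ 0} (D 0) = 0" by (simp add: X_def dpoly_def)
    ultimately have "e (Suc 0) \<le> 258 * (y 0)\<^sup>2"
      using step[of 0] by simp
    moreover have "0 \<le> (y 0)\<^sup>2" by simp
    ultimately have "e (Suc 0) \<le> 778 * (y 0)\<^sup>2" by linarith
    then show ?case unfolding Y_def by simp
  next
    case (Suc L)
    have "Y (Suc (Suc L)) = Y (Suc L) + y (Suc L)" by (simp add: Y_def)
    then have "(Y (Suc (Suc L)))\<^sup>2 = (Y (Suc L))\<^sup>2 + 2 * (Y (Suc L) * y (Suc L)) + (y (Suc L))\<^sup>2"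
      by (simp add: power2_sum)
    moreover have "(\<Sum>j<Suc (Suc L). (y j)\<^sup>2) = (\<Sum>j<Suc L. (y j)\<^sup>2) + (y (Suc L))\<^sup>2"
      by simp
    moreover have "0 \<le> (y (Suc L))\<^sup>2" by simp
    moreover have "\<bar>X {1..<2 ^ Suc L} (D (Suc L))\<bar> \<le> 4 * (Y (Suc L) * y (Suc L)) + 258 * ((y L)\<^sup>2 + (y (Suc L))\<^sup>2)"
      using cross[of L] by (simp only: mult.assoc)
    moreover note Suc.IH step[of "Suc L"]
    \<comment> \<open>Each block costs 258 for itself and 516 for the cross term with its
      predecessor, and 516 is reserved for its successor: 1290 in total. The distant part 8 p is the
      mixed term of 4 times the square of the enlarged sum.\<close>
    moreover have "e2 \<le> 4 * a2 + 1290 * s2 - 516 * q"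
      if "a2 = a1 + 2 * p + q" "s2 = s1 + q" "0 \<le> q" "x \<le> 4 * p + 258 * (r + q)"
        "e1 \<le> 4 * a1 + 1290 * s1 - 516 * r" "e2 \<le> e1 + 2 * x + 258 * q"
      for a1 a2 s1 s2 p q r x e1 e2 :: real
      using that by (smt (verit))
    ultimately show ?case by blast
  qed
  have "e L \<le> 4 * (Y L)\<^sup>2 + 1290 * (\<Sum>j<L. (y j)\<^sup>2)"
  proof (cases L)
    case 0
    then show ?thesis by (simp add: e_def I_def V_def dpoly_def)
  next
    case (Suc l)
    have "0 \<le> (y l)\<^sup>2" by simp
    with e_le[of l] show ?thesis unfolding Suc by linarith
  qed
  also have "(\<Sum>j<L. (y j)\<^sup>2) \<le> (Y L)\<^sup>2"
    unfolding Y_def by (rule sum_squares_le_square_sum[OF y0])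
  finally show ?thesis
    unfolding e_def I_def V_def Y_def by simp
qed

text \<open>On the interval from 2^j to 2^(j+1), Cauchy-Schwarz gives about the square root of V + R
  / 2^j. The weight \<open>q j\<close> replaces this by a sum, with 3/4 a rational bound above 1 /
  sqrt 2; the geometric series yields 4 sqrt R, so only the V-part is paid once per
  interval.\<close>

lemma weighted_first_moment:
  fixes f :: "real \<Rightarrow> real"
  assumes cont: "continuous_on UNIV f" and nonneg: "\<And>t. f t \<ge> 0"
    and V: "V \<ge> 0" and R: "R > 0"
    and sq: "\<And>a b. a \<le> b \<Longrightarrow> integral {a..b} (\<lambda>t. (f t)\<^sup>2) \<le> (b - a) * V + R"
  shows "integral {2..2 ^ Suc J} (\<lambda>t. f t / t) \<le> real J * sqrt V + 4 * sqrt R"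
proof -
  have cont': "continuous_on S f" for S using cont continuous_on_subset by blast
  define q where "q j = sqrt V + sqrt R * (3/4) ^ j" for j :: nat
  have intf: "(\<lambda>t. f t / t) integrable_on {a..b}" if "a > 0" for a b
    using that by (intro integrable_continuous_interval continuous_intros cont') auto
  have piece: "integral {2 ^ j..2 ^ Suc j} (\<lambda>t. f t / t) \<le> q j" for j
  proof -
    have q: "q j > 0" unfolding q_def using V R by (intro add_nonneg_pos) auto
    have "integral {2 ^ j..2 ^ Suc j} (\<lambda>t. f t / t) \<le> integral {2 ^ j..2 ^ Suc j} (\<lambda>t. ((f t)\<^sup>2 * (1 / q j) + q j) / (2 * 2 ^ j))"
    proof (rule integral_le)
      show "(\<lambda>t. f t / t) integrable_on {2 ^ j..2 ^ Suc j}" by (rule intf) simp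
      show "(\<lambda>t. ((f t)\<^sup>2 * (1 / q j) + q j) / (2 * 2 ^ j)) integrable_on {2 ^ j..2 ^ Suc j}"
        by (intro integrable_continuous_interval continuous_intros cont') auto
      fix t :: real assume t: "t \<in> {2 ^ j..2 ^ Suc j}"
      have "0 < t" using t by (intro less_le_trans[of 0 "2 ^ j" t]) auto
      then have "f t / t \<le> f t / 2 ^ j"
        using t nonneg[of t] by (intro divide_left_mono) auto
      also have "f t \<le> ((f t)\<^sup>2 * (1 / q j) + q j) / 2"
        using sum_squares_bound[of "f t" "q j"] q by (simp add: field_simps power2_eq_square)
      then have "f t / 2 ^ j \<le> ((f t)\<^sup>2 * (1 / q j) + q j) / 2 / 2 ^ j"
        by (rule divide_right_mono) simp
      finally show "f t / t \<le> ((f t)\<^sup>2 * (1 / q j) + q j) / (2 * 2 ^ j)" by simp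
    qed
    also have "\<dots> = (integral {2 ^ j..2 ^ Suc j} (\<lambda>t. (f t)\<^sup>2) * (1 / q j) + q j * 2 ^ j) / (2 * 2 ^ j)"
    proof -
      have "((\<lambda>t. (f t)\<^sup>2) has_integral integral {2 ^ j..2 ^ Suc j} (\<lambda>t. (f t)\<^sup>2)) {2 ^ j..2 ^ Suc j}"
        by (intro integrable_integral integrable_continuous_interval continuous_intros cont')
      moreover have "((\<lambda>t. q j) has_integral (q j * 2 ^ j)) {2 ^ j..2 ^ Suc j :: real}"
        using has_integral_const_real[of "q j" "2 ^ j" "2 ^ Suc j"] by (simp add: mult.commute)
      ultimately have "((\<lambda>t. ((f t)\<^sup>2 * (1 / q j) + q j) / (2 * 2 ^ j)) has_integral
          ((integral {2 ^ j..2 ^ Suc j} (\<lambda>t. (f t)\<^sup>2) * (1 / q j) + q j * 2 ^ j) / (2 * 2 ^ j))) {2 ^ j..2 ^ Suc j}"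
        by (intro has_integral_divide has_integral_add has_integral_mult_left)
      then show ?thesis by (rule integral_unique)
    qed
    also have "\<dots> \<le> q j"
    proof -
      have "(1/2::real) ^ j \<le> ((3/4) ^ j)\<^sup>2"
        unfolding power_mult[symmetric] by (subst mult.commute, subst power_mult) (intro power_mono, auto simp: power2_eq_square)
      then have "R / 2 ^ j \<le> R * ((3/4) ^ j)\<^sup>2"
        using R by (simp add: power_divide field_simps)
      also have "\<dots> = (sqrt R * (3/4) ^ j)\<^sup>2" using R by (simp add: power_mult_distrib)
      finally have "V + R / 2 ^ j \<le> (sqrt V)\<^sup>2 + (sqrt R * (3/4) ^ j)\<^sup>2" using V by simp
      also have "\<dots> \<le> (q j)\<^sup>2"
        unfolding q_def power2_sum using V R by simp
      finally have "2 ^ j * V + R \<le> 2 ^ j * (q j)\<^sup>2"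
        by (simp add: field_simps)
      moreover have "integral {2 ^ j..2 ^ Suc j} (\<lambda>t. (f t)\<^sup>2) \<le> 2 ^ j * V + R"
        using sq[of "2 ^ j" "2 ^ Suc j"] by simp
      ultimately have "integral {2 ^ j..2 ^ Suc j} (\<lambda>t. (f t)\<^sup>2) \<le> 2 ^ j * (q j)\<^sup>2" by linarith
      then have "integral {2 ^ j..2 ^ Suc j} (\<lambda>t. (f t)\<^sup>2) * (1 / q j) \<le> 2 ^ j * q j"
        using q by (simp add: field_simps power2_eq_square)
      then show ?thesis by (simp add: field_simps)
    qed
    finally show ?thesis .
  qed
  have "integral {2..2 ^ Suc J} (\<lambda>t. f t / t) \<le> (\<Sum>j=1..J. q j)"
  proof (induction J)
    case (Suc J)
    have "integral {2..2 ^ Suc (Suc J)} (\<lambda>t. f t / t) = integral {2..2 ^ Suc J} (\<lambda>t. f t / t) + integral {2 ^ Suc J..2 ^ Suc (Suc J)} (\<lambda>t. f t / t)"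
    proof (rule Henstock_Kurzweil_Integration.integral_combine[symmetric])
      show "(2::real) \<le> 2 ^ Suc J" using one_le_power[of "2::real" J] by simp
    qed (auto intro!: intf)
    with Suc.IH piece[of "Suc J"] show ?case by simp
  qed simp
  also have "\<dots> = real J * sqrt V + sqrt R * (\<Sum>j=1..J. (3/4) ^ j)"
    by (simp add: q_def sum.distrib sum_distrib_left)
  also have "(\<Sum>j=1..J. (3/4) ^ j) \<le> (\<Sum>j. (3/4::real) ^ j)"
    by (rule sum_le_suminf) auto
  also have "(\<Sum>j. (3/4::real) ^ j) = 4" by (simp add: suminf_geometric)
  finally show ?thesis using R by (simp add: mult_left_mono mult.commute)
qed

text \<open>The difference of the squares is at most (w / t) (2 |S| + w / t), where S is the
  Dirichlet polynomial. The first part is a weighted first moment of |S|, and 1 / t^2 is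
  integrable.\<close>

lemma mean_square_perturb:
  fixes c :: "nat \<Rightarrow> complex" and y :: "nat \<Rightarrow> real" and Z :: "real \<Rightarrow> complex"
  assumes y: "\<And>j n. 2 ^ j \<le> n \<Longrightarrow> n < 2 ^ Suc j \<Longrightarrow> norm (c n) \<le> y j / 2 ^ j"
    and Y: "(\<Sum>j<L. y j) \<le> Y" "Y > 0"
    and Z: "continuous_on {2..T} Z"
    and w: "\<And>t. 2 \<le> t \<Longrightarrow> t \<le> T \<Longrightarrow> norm (Z t - dpoly c {1..<2 ^ L} t) \<le> w / t"
    and T: "2 \<le> T" "T \<le> 2 ^ Suc J"
  defines "V \<equiv> \<Sum>n\<in>{1..<2 ^ L}. (norm (c n))\<^sup>2"
  shows "\<bar>integral {2..T} (\<lambda>t. (norm (Z t))\<^sup>2) - T * V\<bar>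
    \<le> 2 * V + 1300 * Y\<^sup>2 + 2 * w * (real J * sqrt V + 160 * Y) + w\<^sup>2"
proof -
  define S where "S = dpoly c {1..<2 ^ L}"
  define R where "R = 1300 * Y\<^sup>2"
  have V0: "V \<ge> 0" unfolding V_def by (intro sum_nonneg) auto
  have y0: "y j \<ge> 0" for j
    using mult_nonneg_nonneg[OF order_trans[OF norm_ge_zero y[of j "2 ^ j"]], of "2 ^ j"] by simp
  have w0: "w \<ge> 0"
    using order_trans[OF norm_ge_zero w[of 2]] T by simp
  have Sint: "\<bar>integral {a..b} (\<lambda>t. (norm (S t))\<^sup>2) - (b - a) * V\<bar> \<le> R" if "a \<le> b" for a b
  proof -
    have "\<bar>integral {a..b} (\<lambda>t. (norm (S t))\<^sup>2) - (b - a) * V\<bar> \<le> 1300 * (\<Sum>j<L. y j)\<^sup>2"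
      unfolding S_def V_def by (intro mean_square_dyadic y that)
    also have "\<dots> \<le> R"
      unfolding R_def using Y by (intro mult_left_mono power_mono sum_nonneg y0) auto
    finally show ?thesis .
  qed
  have contS: "continuous_on X S" for X
    unfolding S_def by (rule continuous_on_dpoly)
  have "integral {2..2 ^ Suc J} (\<lambda>t. norm (S t) / t) \<le> real J * sqrt V + 4 * sqrt R"
  proof (rule weighted_first_moment)
    show "R > 0" using Y by (simp add: R_def)
    show "integral {a..b} (\<lambda>t. (norm (S t))\<^sup>2) \<le> (b - a) * V + R" if "a \<le> b" for a b
      using Sint[OF that] by (simp add: abs_le_iff)
  qed (use V0 in \<open>auto intro!: continuous_intros contS\<close>)
  moreover have "integral {2..T} (\<lambda>t. norm (S t) / t) \<le> integral {2..2 ^ Suc J} (\<lambda>t. norm (S t) / t)"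
    using T by (intro integral_subset_le integrable_continuous_interval continuous_intros contS) auto
  \<comment> \<open>40^2 = 1600 exceeds 1300, and \<open>weighted_first_moment\<close> multiplies
    this by 4, which gives 160.\<close>
  moreover have "sqrt R \<le> 40 * Y"
    unfolding R_def using Y by (intro real_le_lsqrt) (auto simp: power_mult_distrib)
  ultimately have M1: "integral {2..T} (\<lambda>t. norm (S t) / t) \<le> real J * sqrt V + 160 * Y"
    by linarith
  have I2: "((\<lambda>t. 1 / t\<^sup>2) has_integral (1 / 2 - 1 / T)) {2..T}"
  proof -
    have "((\<lambda>t. 1 / t\<^sup>2) has_integral ((- 1 / T) - (- 1 / 2))) {2..T}"
      using T(1) by (intro fundamental_theorem_of_calculus)
        (auto intro!: derivative_eq_intros simp: has_real_derivative_iff_has_vector_derivative[symmetric] power2_eq_square)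
    then show ?thesis by simp
  qed
  have intZ: "(\<lambda>t. (norm (Z t))\<^sup>2) integrable_on {2..T}"
    by (intro integrable_continuous_interval continuous_intros Z)
  have intS: "(\<lambda>t. (norm (S t))\<^sup>2) integrable_on {2..T}"
    by (intro integrable_continuous_interval continuous_intros contS)
  have intM: "(\<lambda>t. norm (S t) / t) integrable_on {2..T}"
    by (intro integrable_continuous_interval continuous_intros contS) auto
  have bound: "norm ((norm (Z t))\<^sup>2 - (norm (S t))\<^sup>2) \<le> 2 * w * (norm (S t) / t) + w\<^sup>2 * (1 / t\<^sup>2)" if t: "t \<in> {2..T}" for t
  proof -
    have d: "norm (Z t - S t) \<le> w / t"
      using w[of t] t by (simp add: S_def)
    have "\<bar>norm (Z t) - norm (S t)\<bar> \<le> w / t"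
      using order_trans[OF norm_triangle_ineq3 d] .
    moreover have "norm (Z t) + norm (S t) \<le> 2 * norm (S t) + w / t"
      using d norm_triangle_sub[of "Z t" "S t"] by linarith
    ultimately have "\<bar>norm (Z t) - norm (S t)\<bar> * (norm (Z t) + norm (S t)) \<le> w / t * (2 * norm (S t) + w / t)"
      using w0 t by (intro mult_mono) auto
    moreover have "(norm (Z t))\<^sup>2 - (norm (S t))\<^sup>2 = (norm (Z t) - norm (S t)) * (norm (Z t) + norm (S t))"
      by (simp add: power2_eq_square algebra_simps)
    moreover have "w / t * (2 * norm (S t) + w / t) = 2 * w * (norm (S t) / t) + w\<^sup>2 * (1 / t\<^sup>2)"
      by (simp add: power2_eq_square algebra_simps)
    ultimately show ?thesis by (simp add: abs_mult)
  qed
  have "norm (integral {2..T} (\<lambda>t. (norm (Z t))\<^sup>2 - (norm (S t))\<^sup>2))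
      \<le> integral {2..T} (\<lambda>t. 2 * w * (norm (S t) / t) + w\<^sup>2 * (1 / t\<^sup>2))"
    by (intro integral_norm_bound_integral integrable_diff integrable_add intZ intS
        integrable_on_mult_right intM has_integral_integrable[OF I2] bound)
  also have "\<dots> = 2 * w * integral {2..T} (\<lambda>t. norm (S t) / t) + w\<^sup>2 * (1 / 2 - 1 / T)"
    by (rule integral_unique) (intro has_integral_add has_integral_mult_right integrable_integral intM I2)
  also have "\<dots> \<le> 2 * w * (real J * sqrt V + 160 * Y) + w\<^sup>2 * 1"
  proof (intro add_mono mult_left_mono M1)
    have "0 \<le> 1 / T" using T by simp
    then show "1 / 2 - 1 / T \<le> 1" by linarith
  qed (use w0 in auto)
  finally have "\<bar>integral {2..T} (\<lambda>t. (norm (Z t))\<^sup>2) - integral {2..T} (\<lambda>t. (norm (S t))\<^sup>2)\<bar>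
      \<le> 2 * w * (real J * sqrt V + 160 * Y) + w\<^sup>2"
    by (simp add: integral_diff intZ intS)
  \<comment> \<open>The integral starts at 2, so its main term is (T - 2) V; the difference to T V
    is the error 2 V.\<close>
  moreover have "\<bar>integral {2..T} (\<lambda>t. (norm (S t))\<^sup>2) - (T - 2) * V\<bar> \<le> R"
    by (rule Sint[OF T(1)])
  ultimately show ?thesis
    using V0 unfolding R_def by (simp add: abs_le_iff algebra_simps)
qed

section \<open>Approximation by a Dirichlet polynomial\<close>

text \<open>The direct estimate \<open>norm_em_rem_le\<close> at order 0 carries a factor |s|;
  passing through \<open>hurwitz_zeta_approx\<close> removes it.\<close>

lemma norm_em_rem_0_le:
  assumes "s \<noteq> 1" "Re s \<ge> 1/2" "real n \<ge> 4 * norm s + 2"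
  shows "norm (em_rem 0 n s) \<le> 14 * real n powr (- Re s)"
proof -
  have n: "n \<ge> 1" using assms(3) norm_ge_zero[of s] by linarith
  have "em_rem 0 n s = hurwitz_zeta n s - of_nat n powr (1 - s) / (s - 1)"
    using hurwitz_zeta_eq[OF n assms(1), of 0] assms(2) by (simp add: em_poly_0)
  then show ?thesis using hurwitz_zeta_approx[OF assms] by simp
qed

text \<open>All three pieces of \<open>double_zeta_split\<close> beyond the partial sum gain 1 / t:
  the first through the denominator b - 1 of its main term, the second through its outer division by
  b - 1, and the series, like the error in the first piece, through an additional 1 / K <= 1 / t.
  \<open>\<delta>\<close> measures the distance from the pole at a + b = 2.\<close>

lemma tail_bound:
  assumes b: "Re b \<ge> 1/2" "b \<noteq> 1" and ab: "Re (a + b) \<ge> 3/2" and \<delta>: "norm (a + b - 2) \<ge> \<delta>" "\<delta> > 0"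
    and K: "real K \<ge> 4 * norm b + 2" "real K \<ge> 4 * norm (a + b - 1) + 2"
    and t: "t > 0" "norm (b - 1) \<ge> t" "real K \<ge> t"
  shows "norm (double_zeta (a, b) - (\<Sum>n=1..<K. zeta_psum a n * of_nat n powr (- b)))
    \<le> (74 + 1 / \<delta>) * (norm (zeta_psum a K) * real K powr (1 - Re b) + real K powr (2 - Re (a + b))) / t"
proof -
  have K1: "K \<ge> 1" using K(1) norm_ge_zero[of b] by linarith
  have ab2: "a + b - 1 \<noteq> 1" using \<delta> by (auto simp: algebra_simps)
  define p where "p = norm (zeta_psum a K) * real K powr (1 - Re b)"
  define q where "q = real K powr (2 - Re (a + b))"
  have p0: "p \<ge> 0" and q0: "q \<ge> 0" by (simp_all add: p_def q_def)
  have shift: "real K powr (u - 1) \<le> real K powr u / t" for u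
    using t K1 by (simp add: powr_diff divide_left_mono)
  have main_b: "norm (of_nat K powr (1 - b) / (b - 1)) \<le> real K powr (1 - Re b) / t"
    using t K1 by (simp add: norm_divide norm_of_nat_powr frac_le)
  have hurwitz_zeta_le: "norm (hurwitz_zeta K s) \<le> norm (of_nat K powr (1 - s) / (s - 1)) + 14 * real K powr (- Re s)"
    if "s \<noteq> 1" "Re s \<ge> 1/2" "real K \<ge> 4 * norm s + 2" for s
    using hurwitz_zeta_approx[OF that] norm_triangle_sub[of "hurwitz_zeta K s" "of_nat K powr (1 - s) / (s - 1)"] by linarith
  have "norm (hurwitz_zeta K b) \<le> 15 * (real K powr (1 - Re b) / t)"
    using hurwitz_zeta_le[OF b(2,1) K(1)] main_b shift[of "1 - Re b"] by simp
  then have "norm (zeta_psum a K * hurwitz_zeta K b) \<le> norm (zeta_psum a K) * (15 * (real K powr (1 - Re b) / t))"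
    unfolding norm_mult by (rule mult_left_mono) simp
  then have T1: "norm (zeta_psum a K * hurwitz_zeta K b) \<le> 15 * p / t"
    by (simp add: p_def mult_ac)
  have "norm (of_nat K powr (1 - (a + b - 1)) / (a + b - 1 - 1)) \<le> q / \<delta>"
  proof -
    have eq: "a + b - 1 - 1 = a + b - 2" "Re (1 - (a + b - 1)) = 2 - Re (a + b)" by simp_all
    show ?thesis
      unfolding norm_divide norm_of_nat_powr[OF K1] eq q_def using \<delta> by (intro frac_le) auto
  qed
  moreover have "real K powr (- Re (a + b - 1)) \<le> q"
    unfolding q_def using K1 by (intro powr_mono) auto
  ultimately have "norm (hurwitz_zeta K (a + b - 1)) \<le> q / \<delta> + 14 * q"
    using hurwitz_zeta_le[of "a + b - 1"] ab2 ab K(2) by simp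
  moreover have "q / \<delta> + 14 * q \<ge> 0" using q0 \<delta> by simp
  ultimately have T2: "norm (hurwitz_zeta K (a + b - 1) / (b - 1)) \<le> (q / \<delta> + 14 * q) / t"
    unfolding norm_divide using t by (intro frac_le) auto
  define f where "f j = of_nat (K + j) powr (- a) * (em_rem 0 (K + j) b - of_nat (K + j) powr (- b))" for j
  define \<tau> where "\<tau> = Re (a + b) - 1"
  have \<tau>: "\<tau> \<ge> 1/2" using ab by (simp add: \<tau>_def)
  have f_le: "norm (f j) \<le> 15 * real (K + j) powr (- \<tau> - 1)" for j
  proof -
    have "norm (em_rem 0 (K + j) b - of_nat (K + j) powr (- b)) \<le> 14 * real (K + j) powr (- Re b) + real (K + j) powr (- Re b)"
    proof (rule order_trans[OF norm_triangle_ineq4 add_mono])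
      show "norm (em_rem 0 (K + j) b) \<le> 14 * real (K + j) powr (- Re b)"
        using K by (intro norm_em_rem_0_le b) auto
      show "norm (of_nat (K + j) powr (- b) :: complex) \<le> real (K + j) powr (- Re b)"
        using norm_of_nat_powr[of "K + j" "- b"] K1 by simp
    qed
    then have "norm (f j) \<le> real (K + j) powr (- Re a) * (15 * real (K + j) powr (- Re b))"
      unfolding f_def norm_mult using K1 by (intro mult_mono) (auto simp: norm_of_nat_powr simp del: of_nat_add)
    also have "\<dots> = 15 * real (K + j) powr (- Re a + - Re b)"
      by (subst powr_add) simp
    also have "- Re a + - Re b = - \<tau> - 1" by (simp add: \<tau>_def)
    finally show ?thesis .
  qed
  have summ: "summable (\<lambda>j. 15 * real (K + j) powr (- \<tau> - 1))"
    using \<tau> K1 by (intro summable_mult sum_powr_tail) auto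
  have "norm (\<Sum>j. f j) \<le> (\<Sum>j. 15 * real (K + j) powr (- \<tau> - 1))"
    by (rule norm_suminf_le[OF f_le summ])
  also have "\<dots> = 15 * (\<Sum>j. real (K + j) powr (- \<tau> - 1))"
    using \<tau> K1 by (intro suminf_mult sum_powr_tail) auto
  also have "\<dots> \<le> 15 * (real K powr (- \<tau>) * (1 + 1 / \<tau>))"
    using \<tau> K1 by (intro mult_left_mono sum_powr_tail) auto
  also have "\<dots> \<le> 15 * (real K powr (- \<tau>) * 3)"
    using \<tau> by (intro mult_left_mono) (auto simp: field_simps)
  also have "real K powr (- \<tau>) \<le> q / t"
  proof -
    have "- \<tau> = 2 - Re (a + b) - 1" by (simp add: \<tau>_def)
    then show ?thesis using shift[of "2 - Re (a + b)"] unfolding q_def by (simp only:)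
  qed
  finally have T3: "norm (\<Sum>j. f j) \<le> 45 * q / t" by simp
  have "double_zeta (a, b) - (\<Sum>n=1..<K. zeta_psum a n * of_nat n powr (- b))
      = zeta_psum a K * hurwitz_zeta K b + hurwitz_zeta K (a + b - 1) / (b - 1) + (\<Sum>j. f j)"
  proof -
    have "Re b > 0" "Re (a + b) > 1" "a + b \<noteq> 2" using b ab \<delta> by auto
    then show ?thesis
      using double_zeta_split[of b a K] b K1 by (simp add: f_def)
  qed
  then have "norm (double_zeta (a, b) - (\<Sum>n=1..<K. zeta_psum a n * of_nat n powr (- b)))
      \<le> norm (zeta_psum a K * hurwitz_zeta K b) + norm (hurwitz_zeta K (a + b - 1) / (b - 1)) + norm (\<Sum>j. f j)"
    by (simp add: norm_triangle_le norm_triangle_ineq order_trans[OF norm_triangle_ineq] add_mono)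
  also have "\<dots> \<le> 15 * p / t + (q / \<delta> + 14 * q) / t + 45 * q / t"
    by (intro add_mono T1 T2 T3)
  \<comment> \<open>59 = 14 + 45; the sum 74 of 15 and 59 then serves for both p and q.\<close>
  also have "\<dots> = (15 * p + (59 + 1 / \<delta>) * q) / t"
    by (simp add: add_divide_distrib algebra_simps)
  also have "\<dots> \<le> ((74 + 1 / \<delta>) * (p + q)) / t"
  proof -
    have "15 * p \<le> (74 + 1 / \<delta>) * p" "(59 + 1 / \<delta>) * q \<le> (74 + 1 / \<delta>) * q"
      using p0 q0 \<delta> by (intro mult_right_mono; simp)+
    then have "15 * p + (59 + 1 / \<delta>) * q \<le> (74 + 1 / \<delta>) * (p + q)"
      by (simp add: distrib_left)
    then show ?thesis using t by (intro divide_right_mono) auto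
  qed
  finally show ?thesis unfolding p_def q_def .
qed

definition dcoeff :: "complex \<Rightarrow> real \<Rightarrow> nat \<Rightarrow> complex" where
  "dcoeff s \<sigma> n = zeta_psum s n * of_real (real n powr (- \<sigma>))"

definition diag_sum :: "complex \<Rightarrow> real \<Rightarrow> nat \<Rightarrow> real" where
  "diag_sum s \<sigma> N = (\<Sum>n=1..<N. (norm (dcoeff s \<sigma> n))\<^sup>2)"

lemma norm_dcoeff: "norm (dcoeff s \<sigma> n) = norm (zeta_psum s n) * real n powr (- \<sigma>)"
  by (simp add: dcoeff_def norm_mult)

lemma dpoly_dcoeff:
  "dpoly (dcoeff s \<sigma>) {1..<K} t = (\<Sum>n=1..<K. zeta_psum s n * of_nat n powr (- Complex \<sigma> t))"
  unfolding dpoly_def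
proof (intro sum.cong refl)
  fix n assume "n \<in> {1..<K}"
  then have n: "n > 0" by auto
  have "of_nat n powr (- Complex \<sigma> t) = exp (- Complex \<sigma> t * of_real (ln (real n)))"
    using n by (simp add: powr_def Ln_of_nat)
  also have "- Complex \<sigma> t * of_real (ln (real n)) = of_real (- \<sigma> * ln (real n)) + \<i> * of_real (- (t * ln (real n)))"
    by (simp add: complex_eq_iff)
  also have "exp \<dots> = of_real (real n powr (- \<sigma>)) * cis (- (t * ln (real n)))"
    unfolding exp_add cis_conv_exp exp_of_real using n by (simp add: powr_def)
  finally show "dcoeff s \<sigma> n * cis (- (t * ln (real n))) = zeta_psum s n * of_nat n powr (- Complex \<sigma> t)"
    by (simp add: dcoeff_def)
qed

lemma continuous_on_euler_double_zeta_line: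
  assumes ns: "\<And>t. t \<ge> 2 \<Longrightarrow> (s1, Complex \<sigma>2 t) \<notin> euler_double_zeta_singularities"
  shows "continuous_on {2..T} (\<lambda>t. euler_double_zeta s1 (Complex \<sigma>2 t))"
proof -
  have "open (- euler_double_zeta_singularities)" using closed_singularities by auto
  from holomorphic2_slice[OF holomorphic2_double_zeta this, of s1]
  have "continuous_on {w. (s1, w) \<in> - euler_double_zeta_singularities} (\<lambda>w. double_zeta (s1, w))"
    by (rule holomorphic_on_imp_continuous_on)
  then have "continuous_on {2..T} (\<lambda>t. double_zeta (s1, Complex \<sigma>2 t))"
    by (rule continuous_on_compose2) (use ns in \<open>auto simp: Complex_eq intro!: continuous_intros\<close>)
  then show ?thesis
    by (rule continuous_on_eq) (use ns euler_double_zeta_eq_double_zeta in auto)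
qed

text \<open>One dyadic length 2^L serves all t between 2 and T, so the Dirichlet polynomial has
  coefficients independent of t. The block bounds y and Y stay free for each case to insert its
  own.\<close>

lemma mean_square_approx:
  assumes \<sigma>: "\<sigma>2 \<ge> 1/2" "Re s1 + \<sigma>2 \<ge> 3/2"
    and ns: "\<And>t. t \<ge> 2 \<Longrightarrow> (s1, Complex \<sigma>2 t) \<notin> euler_double_zeta_singularities"
  obtains \<Lambda> C where "\<Lambda> \<ge> 1" "C > 0"
    "\<And>T L y Y. T \<ge> 2 \<Longrightarrow> \<Lambda> * T \<le> 2 ^ L \<Longrightarrow> Y > 0 \<Longrightarrow> (\<Sum>j<L. y j) \<le> Y \<Longrightarrow>
       (\<And>j n. 2 ^ j \<le> n \<Longrightarrow> n < 2 ^ Suc j \<Longrightarrow> norm (dcoeff s1 \<sigma>2 n) \<le> y j / 2 ^ j) \<Longrightarrow>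
       \<bar>mean_square s1 \<sigma>2 T - T * diag_sum s1 \<sigma>2 (2 ^ L)\<bar> \<le>
         (let V = diag_sum s1 \<sigma>2 (2 ^ L);
              w = C * (norm (zeta_psum s1 (2 ^ L)) * (2 ^ L) powr (1 - \<sigma>2) + (2 ^ L) powr (2 - Re s1 - \<sigma>2))
          in 2 * V + 1300 * Y\<^sup>2 + 2 * w * (real L * sqrt V + 160 * Y) + w\<^sup>2)"
proof -
  define X where "X = norm s1 + 1 + \<sigma>2"
  \<comment> \<open>For t >= 2 this gives 4 (X + t) + 2 <= \<open>\<Lambda>\<close> t, and X + t
    bounds the norms of s2 and of s1 + s2 - 1: the hypothesis of \<open>hurwitz_zeta_approx\<close>
    at both points.\<close>
  define \<Lambda> where "\<Lambda> = 5 + 2 * X"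
  have X: "X \<ge> 0" using \<sigma> by (simp add: X_def)
  \<comment> \<open>Off the line where s1 + s2 has real part 2, the real part keeps s1 + s2 away
    from 2. On that line the path would meet the singularity at t = - Im s1 unless Im s1 > -2, and
    then the imaginary part keeps it away.\<close>
  obtain \<delta> where \<delta>: "\<delta> > 0" "\<And>t. t \<ge> 2 \<Longrightarrow> norm (s1 + Complex \<sigma>2 t - 2) \<ge> \<delta>"
  proof (cases "Re s1 + \<sigma>2 = 2")
    case False
    show ?thesis
    proof (rule that)
      show "\<bar>Re s1 + \<sigma>2 - 2\<bar> > 0" using False by simp
      show "norm (s1 + Complex \<sigma>2 t - 2) \<ge> \<bar>Re s1 + \<sigma>2 - 2\<bar>" for t
        using abs_Re_le_cmod[of "s1 + Complex \<sigma>2 t - 2"] by simp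
    qed
  next
    case True
    have Im: "Im s1 > -2"
    proof (rule ccontr)
      assume "\<not> Im s1 > -2"
      then have "(s1, Complex \<sigma>2 (- Im s1)) \<notin> euler_double_zeta_singularities" by (intro ns) auto
      moreover have "s1 + Complex \<sigma>2 (- Im s1) = 2" using True by (simp add: complex_eq_iff)
      ultimately show False by (auto simp: euler_double_zeta_singularities_def)
    qed
    show ?thesis
    proof (rule that)
      show "Im s1 + 2 > 0" using Im by simp
      show "norm (s1 + Complex \<sigma>2 t - 2) \<ge> Im s1 + 2" if "t \<ge> 2" for t
        using abs_Im_le_cmod[of "s1 + Complex \<sigma>2 t - 2"] that by simp
    qed
  qed
  define C where "C = 74 + 1 / \<delta>"
  show ?thesis
  proof (rule that)
    show "\<Lambda> \<ge> 1" using X by (simp add: \<Lambda>_def)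
    show "C > 0" using \<delta> by (simp add: C_def add_pos_pos)
    fix T :: real and L y Y
    assume T: "T \<ge> 2" and L: "\<Lambda> * T \<le> 2 ^ L" and Y: "Y > 0" "(\<Sum>j<L. y j) \<le> Y"
      and y: "\<And>j n. 2 ^ j \<le> n \<Longrightarrow> n < 2 ^ Suc j \<Longrightarrow> norm (dcoeff s1 \<sigma>2 n) \<le> y j / 2 ^ j"
    define w where "w = C * (norm (zeta_psum s1 (2 ^ L)) * (2 ^ L) powr (1 - \<sigma>2) + (2 ^ L) powr (2 - Re s1 - \<sigma>2))"
    have "\<bar>integral {2..T} (\<lambda>t. (norm (euler_double_zeta s1 (Complex \<sigma>2 t)))\<^sup>2) - T * (\<Sum>n\<in>{1..<2 ^ L}. (norm (dcoeff s1 \<sigma>2 n))\<^sup>2)\<bar>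
      \<le> 2 * (\<Sum>n\<in>{1..<2 ^ L}. (norm (dcoeff s1 \<sigma>2 n))\<^sup>2) + 1300 * Y\<^sup>2
         + 2 * w * (real L * sqrt (\<Sum>n\<in>{1..<2 ^ L}. (norm (dcoeff s1 \<sigma>2 n))\<^sup>2) + 160 * Y) + w\<^sup>2"
    proof (rule mean_square_perturb[OF y Y(2,1)])
      show "continuous_on {2..T} (\<lambda>t. euler_double_zeta s1 (Complex \<sigma>2 t))"
        by (rule continuous_on_euler_double_zeta_line[OF ns])
      show "2 \<le> T" by (rule T)
      have "1 * T \<le> \<Lambda> * T" using X T by (intro mult_right_mono) (auto simp: \<Lambda>_def)
      then have TL: "T \<le> 2 ^ L" using L by simp
      then show "T \<le> 2 ^ Suc L" using T by simp
      fix t assume t: "2 \<le> t" "t \<le> T"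
      let ?b = "Complex \<sigma>2 t"
      have nsing: "(s1, ?b) \<notin> euler_double_zeta_singularities" using ns t by auto
      have "4 * (X + t) + 2 \<le> \<Lambda> * t"
      proof -
        have "2 * (2 * X + 1) \<le> t * (2 * X + 1)" using t X by (intro mult_right_mono) auto
        then show ?thesis by (simp add: \<Lambda>_def algebra_simps)
      qed
      also have "\<Lambda> * t \<le> \<Lambda> * T" using t X by (intro mult_left_mono) (auto simp: \<Lambda>_def)
      also note L
      finally have K: "4 * (X + t) + 2 \<le> 2 ^ L" .
      have nb: "norm ?b \<le> \<sigma>2 + t"
        using cmod_le[of ?b] t \<sigma> by simp
      have nab: "norm (s1 + ?b - 1) \<le> X + t"
        using norm_triangle_ineq4[of "s1 + ?b" 1] norm_triangle_ineq[of s1 ?b] nb by (simp add: X_def)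
      have nb': "norm ?b \<le> X + t"
        using nb norm_ge_zero[of s1] unfolding X_def by linarith
      have "norm (double_zeta (s1, ?b) - (\<Sum>n=1..<2 ^ L. zeta_psum s1 n * of_nat n powr (- ?b)))
        \<le> (74 + 1 / \<delta>) * (norm (zeta_psum s1 (2 ^ L)) * real (2 ^ L) powr (1 - Re ?b) + real (2 ^ L) powr (2 - Re (s1 + ?b))) / t"
      proof (rule tail_bound)
        show "?b \<noteq> 1" using t by (auto simp: complex_eq_iff)
        show "norm (s1 + ?b - 2) \<ge> \<delta>" by (rule \<delta>(2)[OF t(1)])
        show "real (2 ^ L) \<ge> 4 * norm ?b + 2" using nb' K by simp
        show "real (2 ^ L) \<ge> 4 * norm (s1 + ?b - 1) + 2" using nab K by simp
        show "norm (?b - 1) \<ge> t"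
          by (rule order_trans[OF _ abs_Im_le_cmod[of "?b - 1"]]) simp
        show "real (2 ^ L) \<ge> t" using TL t by simp
        show "Re ?b \<ge> 1/2" "Re (s1 + ?b) \<ge> 3/2" "t > 0" using \<sigma> t by simp_all
      qed (fact \<delta>(1))
      then show "norm (euler_double_zeta s1 ?b - dpoly (dcoeff s1 \<sigma>2) {1..<2 ^ L} t) \<le> w / t"
        unfolding euler_double_zeta_eq_double_zeta[OF nsing] dpoly_dcoeff
        by (simp add: w_def C_def diff_diff_eq)
    qed
    then show "\<bar>mean_square s1 \<sigma>2 T - T * diag_sum s1 \<sigma>2 (2 ^ L)\<bar> \<le>
         (let V = diag_sum s1 \<sigma>2 (2 ^ L);
              w = C * (norm (zeta_psum s1 (2 ^ L)) * (2 ^ L) powr (1 - \<sigma>2) + (2 ^ L) powr (2 - Re s1 - \<sigma>2))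
          in 2 * V + 1300 * Y\<^sup>2 + 2 * w * (real L * sqrt V + 160 * Y) + w\<^sup>2)"
      unfolding Let_def w_def[symmetric] mean_square_def diag_sum_def .
  qed
qed

text \<open>The last two bounds have different purposes: L + 2 <= c ln T turns powers of L into
  powers of the logarithm, while the additive bound allows ln (2^L) to be replaced by ln T in a main
  term.\<close>

lemma dyadic_scale:
  assumes "\<Lambda> \<ge> (1::real)"
  obtains c where "c > 0"
    "\<And>T. T \<ge> 2 \<Longrightarrow> \<exists>L. \<Lambda> * T \<le> 2 ^ L \<and> 2 ^ L \<le> 2 * \<Lambda> * T \<and> real L + 2 \<le> c * ln T \<and> \<bar>real L * ln 2 - ln T\<bar> \<le> c"
proof -
  define c where "c = ((ln (2 * \<Lambda>) / ln 2 + 2) / ln 2 + 1 / ln 2) + ln (2 * \<Lambda>)"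
  have l2: "ln 2 > (0::real)" by simp
  have l\<Lambda>: "ln (2 * \<Lambda>) > 0" using assms by simp
  have "\<exists>L. \<Lambda> * T \<le> 2 ^ L \<and> 2 ^ L \<le> 2 * \<Lambda> * T \<and> real L + 2 \<le> c * ln T \<and> \<bar>real L * ln 2 - ln T\<bar> \<le> c"
    if T: "T \<ge> 2" for T
  proof -
    define X where "X = \<Lambda> * T"
    have "1 * 2 \<le> \<Lambda> * T" using assms T by (intro mult_mono) auto
    then have X: "X \<ge> 2" by (simp add: X_def)
    define L where "L = nat \<lceil>log 2 X\<rceil>"
    have "log 2 X \<ge> 0" using X by simp
    then have L: "log 2 X \<le> real L" "real L \<le> log 2 X + 1"
      unfolding L_def by linarith+
    have "X = 2 powr log 2 X" using X by simp
    also have "\<dots> \<le> 2 powr real L" by (intro powr_mono L) auto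
    finally have L1: "X \<le> 2 ^ L" by (simp add: powr_realpow)
    have "2 powr real L \<le> 2 powr (log 2 X + 1)" by (intro powr_mono L) auto
    also have "\<dots> = 2 * X" using X by (simp add: powr_add)
    finally have L2: "2 ^ L \<le> 2 * X" by (simp add: powr_realpow)
    have lnX: "ln X = ln \<Lambda> + ln T" using assms T by (simp add: X_def ln_mult)
    have "ln (2 ^ L) \<le> ln (2 * X)" using L2 X by (subst ln_le_cancel_iff) auto
    then have up: "real L * ln 2 \<le> ln (2 * \<Lambda>) + ln T"
      using X lnX assms by (simp add: ln_realpow ln_mult)
    have "ln X \<le> ln (2 ^ L)" using L1 X by (subst ln_le_cancel_iff) auto
    then have low: "ln T \<le> real L * ln 2"
      using lnX assms by (simp add: ln_realpow) (meson add_increasing2 ln_ge_zero order_trans order_refl add_mono le_add_same_cancel2)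
    have lT: "ln 2 \<le> ln T" using T by simp
    have "real L \<le> ln (2 * \<Lambda>) / ln 2 + ln T / ln 2"
      using up l2 by (simp add: field_simps)
    moreover have "ln (2 * \<Lambda>) / ln 2 + 2 \<le> (ln (2 * \<Lambda>) / ln 2 + 2) / ln 2 * ln T"
    proof -
      have "(ln (2 * \<Lambda>) / ln 2 + 2) / ln 2 * ln 2 \<le> (ln (2 * \<Lambda>) / ln 2 + 2) / ln 2 * ln T"
        using lT l2 l\<Lambda> by (intro mult_left_mono) auto
      then show ?thesis using l2 by simp
    qed
    moreover have "0 \<le> ln (2 * \<Lambda>) * ln T" using T l\<Lambda> by (intro mult_nonneg_nonneg) auto
    ultimately have "real L + 2 \<le> c * ln T"
      unfolding c_def distrib_right by simp
    moreover have "\<bar>real L * ln 2 - ln T\<bar> \<le> c"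
    proof -
      have "0 \<le> ((ln (2 * \<Lambda>) / ln 2 + 2) / ln 2 + 1 / ln 2)" using l2 l\<Lambda> by simp
      then show ?thesis using up low unfolding c_def by linarith
    qed
    ultimately show ?thesis using L1 L2 unfolding X_def by (intro exI[of _ L]) auto
  qed
  moreover have "c > 0" unfolding c_def using l2 l\<Lambda> by (intro add_pos_pos add_nonneg_pos divide_nonneg_pos) auto
  ultimately show ?thesis using that by blast
qed

section \<open>Coefficient bounds and the exponent \<open>\<kappa>\<close>\<close>

lemma powr_power_two: "(2 ^ j :: real) powr \<kappa> = (2 powr \<kappa>) ^ j"
  by (simp add: powr_powr powr_realpow[symmetric] mult.commute powr_power)

lemma dcoeff_le:
  assumes B: "norm (zeta_psum s n) \<le> B * real n powr \<beta> * (1 + ln (real n)) ^ e" and n: "n \<ge> 1"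
  shows "norm (dcoeff s \<sigma> n) \<le> B * real n powr (\<beta> - \<sigma>) * (1 + ln (real n)) ^ e"
proof -
  have "norm (dcoeff s \<sigma> n) \<le> B * real n powr \<beta> * (1 + ln (real n)) ^ e * real n powr (- \<sigma>)"
    unfolding norm_dcoeff by (intro mult_right_mono B) auto
  also have "\<dots> = B * real n powr (\<beta> + - \<sigma>) * (1 + ln (real n)) ^ e"
    by (subst powr_add) simp
  finally show ?thesis by simp
qed

text \<open>On the j-th block n powr (\<kappa> - 1) is of order (2 powr \<kappa>)^j / 2^j. As
  \<kappa> - 1 may have either sign, the variation of n inside the block costs 2 powr |\<kappa> -
  1|; j + 2 dominates 1 + ln n because ln 2 < 1.\<close>

lemma dcoeff_dyadic_le:
  assumes B: "norm (zeta_psum s n) \<le> B * real n powr \<beta> * (1 + ln (real n)) ^ e" "B \<ge> 0"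
    and n: "2 ^ j \<le> n" "n < 2 ^ Suc j" and \<kappa>: "\<kappa> = \<beta> + 1 - \<sigma>"
  shows "norm (dcoeff s \<sigma> n) \<le> B * 2 powr \<bar>\<kappa> - 1\<bar> * ((2 powr \<kappa>) ^ j * (real j + 2) ^ e) / 2 ^ j"
proof -
  have n1: "n \<ge> 1" by (rule order_trans[OF one_le_power n(1)]) simp
  have n2: "2 ^ j \<le> real n" "real n \<le> 2 * 2 ^ j"
    using of_nat_mono[OF n(1), where 'a = real] of_nat_mono[OF less_imp_le[OF n(2)], where 'a = real] by simp_all
  have pos: "(0::real) < 2 ^ j" by simp
  define r where "r = real n / 2 ^ j"
  have r: "1 \<le> r" "r \<le> 2" using n2 pos by (simp_all add: r_def field_simps)
  have "real n powr (\<kappa> - 1) = (2 ^ j) powr (\<kappa> - 1) * r powr (\<kappa> - 1)"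
    using pos n1 by (simp add: r_def powr_divide)
  also have "r powr (\<kappa> - 1) \<le> r powr \<bar>\<kappa> - 1\<bar>" using r by (intro powr_mono) auto
  also have "r powr \<bar>\<kappa> - 1\<bar> \<le> 2 powr \<bar>\<kappa> - 1\<bar>" using r by (intro powr_mono2) auto
  also have "(2 ^ j :: real) powr (\<kappa> - 1) = (2 powr \<kappa>) ^ j / 2 ^ j"
    by (simp add: powr_diff powr_power_two)
  finally have p: "real n powr (\<kappa> - 1) \<le> (2 powr \<kappa>) ^ j / 2 ^ j * 2 powr \<bar>\<kappa> - 1\<bar>"
    by simp
  have "ln (real n) \<le> ln (2 ^ Suc j)" using n2 n1 by (subst ln_le_cancel_iff) auto
  also have "\<dots> = real (Suc j) * ln 2" by (rule ln_realpow)
  also have "\<dots> \<le> real (Suc j) * 1" using ln_2_less_1 by (intro mult_left_mono) auto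
  finally have l: "1 + ln (real n) \<le> real j + 2" by simp
  have "norm (dcoeff s \<sigma> n) \<le> B * real n powr (\<kappa> - 1) * (1 + ln (real n)) ^ e"
    using dcoeff_le[OF B(1) n1, of \<sigma>] by (simp add: \<kappa>)
  also have "\<dots> \<le> B * ((2 powr \<kappa>) ^ j / 2 ^ j * 2 powr \<bar>\<kappa> - 1\<bar>) * (real j + 2) ^ e"
    using B(2) n1 by (intro mult_mono power_mono l p) auto
  finally show ?thesis by (simp add: mult_ac)
qed

text \<open>The condition 1 - Re s1 <= \<beta> makes both parts of the truncation error
  \<open>w\<close> at most a multiple of the summand j = L, hence of Q. For this reason the sum
  bounded by Q includes j = L.\<close>

lemma mean_square_weighted:
  assumes \<sigma>: "\<sigma>2 \<ge> 1/2" "Re s1 + \<sigma>2 \<ge> 3/2"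
    and ns: "\<And>t. t \<ge> 2 \<Longrightarrow> (s1, Complex \<sigma>2 t) \<notin> euler_double_zeta_singularities"
    and B: "\<And>n. n \<ge> 1 \<Longrightarrow> norm (zeta_psum s1 n) \<le> B * real n powr \<beta> * (1 + ln (real n)) ^ e" "B > 0"
    and \<beta>: "1 - Re s1 \<le> \<beta>" and \<kappa>: "\<kappa> = \<beta> + 1 - \<sigma>2"
  obtains \<Lambda> C where "\<Lambda> \<ge> 1" "C > 0"
    "\<And>T L Q. T \<ge> 2 \<Longrightarrow> \<Lambda> * T \<le> 2 ^ L \<Longrightarrow> (\<Sum>j\<le>L. (2 powr \<kappa>) ^ j * (real j + 2) ^ e) \<le> Q \<Longrightarrow>
       \<bar>mean_square s1 \<sigma>2 T - T * diag_sum s1 \<sigma>2 (2 ^ L)\<bar> \<le>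
         C * (diag_sum s1 \<sigma>2 (2 ^ L) + Q\<^sup>2 +
           (2 powr \<kappa>) ^ L * (real L + 2) ^ e * (real L * sqrt (diag_sum s1 \<sigma>2 (2 ^ L))))"
proof (rule mean_square_approx[OF \<sigma>])
  show "(s1, Complex \<sigma>2 t) \<notin> euler_double_zeta_singularities" if "t \<ge> 2" for t
    by (rule ns[OF that])
next
  fix \<Lambda> C0 :: real
  assume \<Lambda>: "\<Lambda> \<ge> 1" and C0: "C0 > 0" and approx:
    "\<And>T L y Y. T \<ge> 2 \<Longrightarrow> \<Lambda> * T \<le> 2 ^ L \<Longrightarrow> Y > 0 \<Longrightarrow> (\<Sum>j<L. y j) \<le> Y \<Longrightarrow>
       (\<And>j n. 2 ^ j \<le> n \<Longrightarrow> n < 2 ^ Suc j \<Longrightarrow> norm (dcoeff s1 \<sigma>2 n) \<le> y j / 2 ^ j) \<Longrightarrow>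
       \<bar>mean_square s1 \<sigma>2 T - T * diag_sum s1 \<sigma>2 (2 ^ L)\<bar> \<le>
         (let V = diag_sum s1 \<sigma>2 (2 ^ L);
              w = C0 * (norm (zeta_psum s1 (2 ^ L)) * (2 ^ L) powr (1 - \<sigma>2) + (2 ^ L) powr (2 - Re s1 - \<sigma>2))
          in 2 * V + 1300 * Y\<^sup>2 + 2 * w * (real L * sqrt V + 160 * Y) + w\<^sup>2)"
  define B' where "B' = B * 2 powr \<bar>\<kappa> - 1\<bar>"
  define C1 where "C1 = C0 * (B + 1)"
  have B': "B' > 0" using B by (simp add: B'_def)
  have C1: "C1 > 0" using B C0 by (simp add: C1_def)
  define C where "C = 2 + (1300 * B'\<^sup>2 + 320 * C1 * B' + C1\<^sup>2) + 2 * C1"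
  show thesis
  proof (rule that)
    show "\<Lambda> \<ge> 1" by fact
    show "C > 0" using B' C1 by (simp add: C_def add_pos_pos add_pos_nonneg)
    fix T :: real and L Q
    assume T: "T \<ge> 2" and L: "\<Lambda> * T \<le> 2 ^ L" and Q: "(\<Sum>j\<le>L. (2 powr \<kappa>) ^ j * (real j + 2) ^ e) \<le> Q"
    define V where "V = diag_sum s1 \<sigma>2 (2 ^ L)"
    define w where "w = C0 * (norm (zeta_psum s1 (2 ^ L)) * (2 ^ L) powr (1 - \<sigma>2) + (2 ^ L) powr (2 - Re s1 - \<sigma>2))"
    define u where "u = (2 powr \<kappa>) ^ L * (real L + 2) ^ e"
    have V: "V \<ge> 0" unfolding V_def diag_sum_def by (intro sum_nonneg) auto
    have u: "u > 0" unfolding u_def by simp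
    have sum_Q: "(\<Sum>j<L. (2 powr \<kappa>) ^ j * (real j + 2) ^ e) + u \<le> Q"
      using Q by (simp add: u_def lessThan_Suc_atMost[symmetric])
    moreover have "0 \<le> (\<Sum>j<L. (2 powr \<kappa>) ^ j * (real j + 2) ^ e)" by (intro sum_nonneg) auto
    ultimately have uQ: "u \<le> Q" and Q0: "Q > 0" using u by linarith+
    have w_le: "w \<le> C1 * u"
    proof -
      have lnL: "1 + ln (2 ^ L) \<le> real L + 2"
      proof -
        have "ln (2 ^ L) = real L * ln 2" by (rule ln_realpow)
        also have "\<dots> \<le> real L * 1" using ln_2_less_1 by (intro mult_left_mono) auto
        finally show ?thesis by simp
      qed
      have ge1: "(1::real) \<le> 2 ^ L" by simp
      have "norm (zeta_psum s1 (2 ^ L)) * (2 ^ L) powr (1 - \<sigma>2) \<le> B * (2 ^ L) powr \<beta> * (1 + ln (2 ^ L)) ^ e * (2 ^ L) powr (1 - \<sigma>2)"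
        using B(1)[of "2 ^ L"] by (intro mult_right_mono) auto
      also have "\<dots> = B * (2 ^ L) powr (\<beta> + (1 - \<sigma>2)) * (1 + ln (2 ^ L)) ^ e"
        by (subst powr_add) simp
      also have "\<beta> + (1 - \<sigma>2) = \<kappa>" by (simp add: \<kappa>)
      also have "B * (2 ^ L) powr \<kappa> * (1 + ln (2 ^ L)) ^ e \<le> B * (2 ^ L) powr \<kappa> * (real L + 2) ^ e"
        using B(2) ge1 by (intro mult_left_mono power_mono lnL) auto
      finally have 1: "norm (zeta_psum s1 (2 ^ L)) * (2 ^ L) powr (1 - \<sigma>2) \<le> B * u"
        by (simp add: u_def powr_power_two)
      have "(2 ^ L) powr (2 - Re s1 - \<sigma>2) \<le> (2 ^ L) powr \<kappa>"
        using \<beta> by (intro powr_mono) (auto simp: \<kappa>)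
      also have "\<dots> * 1 \<le> (2 ^ L) powr \<kappa> * (real L + 2) ^ e"
        by (intro mult_left_mono one_le_power) auto
      finally have 2: "(2 ^ L) powr (2 - Re s1 - \<sigma>2) \<le> u" by (simp add: u_def powr_power_two)
      have "w \<le> C0 * (B * u + u)"
        unfolding w_def using C0 by (intro mult_left_mono add_mono 1 2) auto
      then show ?thesis by (simp add: C1_def algebra_simps)
    qed
    have w0: "w \<ge> 0" unfolding w_def using C0 by (intro mult_nonneg_nonneg add_nonneg_nonneg) auto
    have "(\<Sum>j<L. B' * ((2 powr \<kappa>) ^ j * (real j + 2) ^ e)) \<le> B' * Q"
      unfolding sum_distrib_left[symmetric] using B' sum_Q u by (intro mult_left_mono) auto
    moreover have "norm (dcoeff s1 \<sigma>2 n) \<le> B' * ((2 powr \<kappa>) ^ j * (real j + 2) ^ e) / 2 ^ j"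
      if n: "2 ^ j \<le> n" "n < 2 ^ Suc j" for j n
    proof -
      have "n \<ge> 1" by (rule order_trans[OF one_le_power n(1)]) simp
      from dcoeff_dyadic_le[OF B(1)[OF this] _ n \<kappa>] B(2) show ?thesis
        by (simp add: B'_def)
    qed
    moreover have "0 < B' * Q" using B' Q0 by simp
    ultimately have "\<bar>mean_square s1 \<sigma>2 T - T * V\<bar> \<le> 2 * V + 1300 * (B' * Q)\<^sup>2 + 2 * w * (real L * sqrt V + 160 * (B' * Q)) + w\<^sup>2"
      using approx[OF T L, of "B' * Q" "\<lambda>j. B' * ((2 powr \<kappa>) ^ j * (real j + 2) ^ e)"]
      unfolding Let_def V_def[symmetric] w_def[symmetric] by blast
    also have "\<dots> \<le> 2 * V + 1300 * (B' * Q)\<^sup>2 + 2 * (C1 * u) * (real L * sqrt V + 160 * (B' * Q)) + (C1 * u)\<^sup>2"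
      using w_le w0 V B' Q0 by (intro add_mono mult_mono power_mono order_refl add_nonneg_nonneg) auto
    also have "\<dots> = 2 * V + 1300 * B'\<^sup>2 * Q\<^sup>2 + 2 * C1 * (u * (real L * sqrt V)) + 320 * C1 * B' * (u * Q) + C1\<^sup>2 * u\<^sup>2"
      by (simp add: power_mult_distrib algebra_simps)
    also have "\<dots> \<le> 2 * V + 1300 * B'\<^sup>2 * Q\<^sup>2 + 2 * C1 * (u * (real L * sqrt V)) + 320 * C1 * B' * Q\<^sup>2 + C1\<^sup>2 * Q\<^sup>2"
    proof (intro add_mono mult_left_mono power_mono order_refl)
      show "u * Q \<le> Q\<^sup>2" using uQ Q0 by (simp add: power2_eq_square)
    qed (use uQ u B' C1 in auto)
    also have "\<dots> \<le> C * (V + Q\<^sup>2 + u * (real L * sqrt V))"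
    proof -
      have "2 * V \<le> C * V" "(1300 * B'\<^sup>2 + 320 * C1 * B' + C1\<^sup>2) * Q\<^sup>2 \<le> C * Q\<^sup>2"
        "2 * C1 * (u * (real L * sqrt V)) \<le> C * (u * (real L * sqrt V))"
        using V u C1 B' by (intro mult_right_mono; simp add: C_def)+
      then show ?thesis by (simp add: algebra_simps)
    qed
    finally show "\<bar>mean_square s1 \<sigma>2 T - T * diag_sum s1 \<sigma>2 (2 ^ L)\<bar> \<le>
         C * (diag_sum s1 \<sigma>2 (2 ^ L) + Q\<^sup>2 +
           (2 powr \<kappa>) ^ L * (real L + 2) ^ e * (real L * sqrt (diag_sum s1 \<sigma>2 (2 ^ L))))"
      unfolding V_def u_def .
  qed
qed

lemma one_plus_ln_le_powr:
  assumes "\<eta> > 0" "\<eta> \<le> 1" "x \<ge> (1::real)"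
  shows "1 + ln x \<le> x powr \<eta> / \<eta>"
proof -
  have "ln (x powr \<eta>) \<le> x powr \<eta> - 1"
    using assms by (intro ln_le_minus_one) auto
  then have "\<eta> * ln x \<le> x powr \<eta> - 1"
    using assms by (simp add: ln_powr)
  then have "\<eta> * (1 + ln x) \<le> x powr \<eta>"
    using assms by (simp add: distrib_left)
  then show ?thesis
    using assms by (simp add: pos_le_divide_eq mult.commute)
qed

text \<open>The growth of the logarithm beyond K is charged to a small power of n / K, so that a
  tail starting at K keeps the exact power of 1 + ln K.\<close>

lemma log_power_shift:
  assumes "\<eta> > 0" "\<eta> \<le> 1" "K \<ge> (1::real)" "n \<ge> K" "e \<le> 1"
  shows "(1 + ln n) ^ e \<le> (1 + ln K) ^ e * ((n / K) powr \<eta> / \<eta>)"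
proof -
  have nK: "n / K \<ge> 1" using assms by simp
  have l: "1 + ln (n / K) \<le> (n / K) powr \<eta> / \<eta>"
    by (rule one_plus_ln_le_powr[OF assms(1,2) nK])
  have l0: "ln K \<ge> 0" "ln (n / K) \<ge> 0" using assms nK by auto
  consider "e = 0" | "e = 1" using assms(5) by linarith
  then show ?thesis
  proof cases
    case 1
    then show ?thesis using l l0 by simp
  next
    case 2
    have "1 + ln n = 1 + ln K + ln (n / K)" using assms by (simp add: ln_div)
    also have "\<dots> \<le> (1 + ln K) * (1 + ln (n / K))"
      using mult_nonneg_nonneg[OF l0] by (simp add: algebra_simps)
    also have "\<dots> \<le> (1 + ln K) * ((n / K) powr \<eta> / \<eta>)"
      using l0 by (intro mult_left_mono l) auto
    finally show ?thesis by (simp add: 2)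
  qed
qed

lemma powr_square: "(x powr a)\<^sup>2 = x powr (2 * a)" for x a :: real
  by (simp add: power2_eq_square flip: powr_add)

text \<open>\<open>\<eta>\<close> is small enough that a = 1 - 2 \<kappa> - 2 \<eta> is positive,
  which makes the exponent -a - 1 summable. The factor K powr (-2 \<eta>) and the tail K powr (-a)
  then recombine to K powr (2 \<kappa> - 1), free of \<eta>.\<close>

lemma dcoeff_tail:
  assumes B: "\<And>n. n \<ge> 1 \<Longrightarrow> norm (zeta_psum s n) \<le> B * real n powr \<beta> * (1 + ln (real n)) ^ e" "B > 0"
    and e: "e \<le> 1" and \<kappa>: "\<kappa> = \<beta> + 1 - \<sigma>" "\<kappa> < 1/2"
  obtains C where "C \<ge> 0" "summable (\<lambda>n. (norm (dcoeff s \<sigma> n))\<^sup>2)"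
    "\<And>K. K \<ge> 1 \<Longrightarrow> (\<Sum>j. (norm (dcoeff s \<sigma> (K + j)))\<^sup>2) \<le> C * real K powr (2 * \<kappa> - 1) * (1 + ln (real K)) ^ (2 * e)"
proof -
  define \<eta> where "\<eta> = min ((1 - 2 * \<kappa>) / 4) 1"
  define a where "a = 1 - 2 * \<kappa> - 2 * \<eta>"
  have \<eta>: "\<eta> > 0" "\<eta> \<le> 1" using \<kappa>(2) by (auto simp: \<eta>_def)
  have \<eta>_le: "\<eta> \<le> (1 - 2 * \<kappa>) / 4" unfolding \<eta>_def by (rule min.cobounded1)
  have a: "a > 0" using \<eta>_le \<kappa>(2) by (simp add: a_def)
  define D where "D = B\<^sup>2 / \<eta>\<^sup>2"
  have D: "D \<ge> 0" by (simp add: D_def)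
  have term_le: "(norm (dcoeff s \<sigma> (K + j)))\<^sup>2 \<le>
      D * (1 + ln (real K)) ^ (2 * e) * real K powr (- (2 * \<eta>)) * real (K + j) powr (- a - 1)" if K: "K \<ge> 1" for K j
  proof -
    let ?n = "real (K + j)"
    have n: "?n \<ge> real K" "real K \<ge> 1" "?n > 0" using K by auto
    have "norm (dcoeff s \<sigma> (K + j)) \<le> B * ?n powr (\<beta> - \<sigma>) * (1 + ln ?n) ^ e"
      using K by (intro dcoeff_le B) auto
    also have "\<dots> \<le> B * ?n powr (\<beta> - \<sigma>) * ((1 + ln (real K)) ^ e * ((?n / real K) powr \<eta> / \<eta>))"
      using n B(2) \<eta> e by (intro mult_left_mono log_power_shift) auto
    finally have "(norm (dcoeff s \<sigma> (K + j)))\<^sup>2 \<le> (B * ?n powr (\<beta> - \<sigma>) * ((1 + ln (real K)) ^ e * ((?n / real K) powr \<eta> / \<eta>)))\<^sup>2"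
      by (intro power_mono) auto
    also have "\<dots> = D * (1 + ln (real K)) ^ (2 * e) * ((?n powr (\<beta> - \<sigma>))\<^sup>2 * ((?n / real K) powr \<eta>)\<^sup>2)"
      by (simp add: D_def power_mult_distrib power_divide power_mult mult.commute[of 2 e])
    also have "(?n powr (\<beta> - \<sigma>))\<^sup>2 * ((?n / real K) powr \<eta>)\<^sup>2 = ?n powr (2 * (\<beta> - \<sigma>)) * (?n / real K) powr (2 * \<eta>)"
      unfolding powr_square ..
    also have "(?n / real K) powr (2 * \<eta>) = ?n powr (2 * \<eta>) * real K powr (- (2 * \<eta>))"
      using n by (simp add: powr_divide powr_minus_divide)
    also have "?n powr (2 * (\<beta> - \<sigma>)) * (?n powr (2 * \<eta>) * real K powr (- (2 * \<eta>)))
        = real K powr (- (2 * \<eta>)) * ?n powr (2 * (\<beta> - \<sigma>) + 2 * \<eta>)"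
      by (subst powr_add) simp
    also have "2 * (\<beta> - \<sigma>) + 2 * \<eta> = - a - 1" by (simp add: a_def \<kappa>(1))
    finally show ?thesis by (simp add: mult.assoc)
  qed
  have summ: "summable (\<lambda>j. D * (1 + ln (real K)) ^ (2 * e) * real K powr (- (2 * \<eta>)) * real (K + j) powr (- a - 1))"
    if "K \<ge> 1" for K using a that by (intro summable_mult sum_powr_tail)
  have summ': "summable (\<lambda>j. (norm (dcoeff s \<sigma> (K + j)))\<^sup>2)" if "K \<ge> 1" for K
    by (rule summable_comparison_test'[OF summ[OF that]]) (use term_le[OF that] in auto)
  have "summable (\<lambda>n. (norm (dcoeff s \<sigma> (n + 1)))\<^sup>2)"
    using summ'[of 1] by (simp add: add.commute)
  then have S: "summable (\<lambda>n. (norm (dcoeff s \<sigma> n))\<^sup>2)"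
    by (subst (asm) summable_iff_shift)
  show ?thesis
  proof (rule that)
    show "D * (1 + 1 / a) \<ge> 0" using D a by simp
    show "summable (\<lambda>n. (norm (dcoeff s \<sigma> n))\<^sup>2)" by fact
    fix K :: nat assume K: "K \<ge> 1"
    let ?c = "D * (1 + ln (real K)) ^ (2 * e) * real K powr (- (2 * \<eta>))"
    have "(\<Sum>j. (norm (dcoeff s \<sigma> (K + j)))\<^sup>2) \<le> (\<Sum>j. ?c * real (K + j) powr (- a - 1))"
      by (intro suminf_le term_le summ summ' K)
    also have "\<dots> = ?c * (\<Sum>j. real (K + j) powr (- a - 1))"
      using a K by (intro suminf_mult sum_powr_tail)
    also have "\<dots> \<le> ?c * (real K powr (- a) * (1 + 1 / a))"
    proof (intro mult_left_mono sum_powr_tail a K)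
      show "0 \<le> ?c" using K D by (intro mult_nonneg_nonneg zero_le_power add_nonneg_nonneg) auto
    qed
    also have "\<dots> = D * (1 + 1 / a) * (real K powr (- (2 * \<eta>)) * real K powr (- a)) * (1 + ln (real K)) ^ (2 * e)"
      by simp
    also have "real K powr (- (2 * \<eta>)) * real K powr (- a) = real K powr (2 * \<kappa> - 1)"
      by (simp add: a_def flip: powr_add)
    finally show "(\<Sum>j. (norm (dcoeff s \<sigma> (K + j)))\<^sup>2) \<le> D * (1 + 1 / a) * real K powr (2 * \<kappa> - 1) * (1 + ln (real K)) ^ (2 * e)" .
  qed
qed

lemma zeta2_sq_term_eq: "zeta2_sq_term s (2 * \<sigma>) n = (norm (dcoeff s \<sigma> n))\<^sup>2"
proof (cases "n = 0")
  case False
  have "1 / real n powr (2 * \<sigma>) = (real n powr (- \<sigma>))\<^sup>2"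
    using False by (simp add: powr_power powr_minus_divide mult.commute power_one_over)
  then show ?thesis
    by (simp add: zeta2_sq_term_def norm_dcoeff power_mult_distrib zeta_psum_eq)
qed (simp add: zeta2_sq_term_def dcoeff_def)

lemma dcoeff_0 [simp]: "dcoeff s \<sigma> 0 = 0"
  by (simp add: dcoeff_def)

lemma dcoeff_1 [simp]: "dcoeff s \<sigma> (Suc 0) = 0"
  by (simp add: dcoeff_def zeta_psum_def)

lemma
  assumes "summable (\<lambda>n. (norm (dcoeff s \<sigma> n))\<^sup>2)"
  shows zeta2_sq_summable: "zeta2_sq_term s (2 * \<sigma>) summable_on {2..}"
    and zeta2_sq_eq: "zeta2_sq s (2 * \<sigma>) = (\<Sum>n. (norm (dcoeff s \<sigma> n))\<^sup>2)"
proof -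
  let ?f = "\<lambda>n. (norm (dcoeff s \<sigma> n))\<^sup>2"
  have f: "zeta2_sq_term s (2 * \<sigma>) = ?f" by (rule ext) (rule zeta2_sq_term_eq)
  have hs: "(?f has_sum (\<Sum>n. ?f n)) UNIV"
    by (rule norm_summable_imp_has_sum) (use assms summable_sums in auto)
  have "(?f has_sum (\<Sum>n. ?f n)) {2..} \<longleftrightarrow> (?f has_sum (\<Sum>n. ?f n)) UNIV"
  proof (rule has_sum_cong_neutral)
    fix n :: nat assume "n \<in> UNIV - {2..}"
    \<comment> \<open>The series starts at n = 2, but nothing is lost: \<open>zeta_psum\<close> is
      an empty sum for n = 0 and n = 1.\<close>
    then have "n = 0 \<or> n = Suc 0" by auto
    then show "?f n = 0" by auto
  qed auto
  with hs have hs2: "(?f has_sum (\<Sum>n. ?f n)) {2..}" by simp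
  then show "zeta2_sq_term s (2 * \<sigma>) summable_on {2..}"
    unfolding f by (rule has_sum_imp_summable)
  show "zeta2_sq s (2 * \<sigma>) = (\<Sum>n. ?f n)"
    unfolding zeta2_sq_def f by (rule infsumI[OF hs2])
qed

lemma diag_sum_split:
  assumes "summable (\<lambda>n. (norm (dcoeff s \<sigma> n))\<^sup>2)" "K \<ge> 1"
  shows "zeta2_sq s (2 * \<sigma>) = diag_sum s \<sigma> K + (\<Sum>j. (norm (dcoeff s \<sigma> (K + j)))\<^sup>2)"
proof -
  have "(\<Sum>n. (norm (dcoeff s \<sigma> n))\<^sup>2) = (\<Sum>j. (norm (dcoeff s \<sigma> (j + K)))\<^sup>2) + (\<Sum>n<K. (norm (dcoeff s \<sigma> n))\<^sup>2)"
    by (rule suminf_split_initial_segment[OF assms(1)])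
  also have "(\<Sum>n<K. (norm (dcoeff s \<sigma> n))\<^sup>2) = diag_sum s \<sigma> K"
    unfolding diag_sum_def by (intro sum.mono_neutral_right) (auto simp: not_le)
  finally show ?thesis
    by (simp add: zeta2_sq_eq[OF assms(1)] add.commute)
qed

text \<open>For \<kappa> < 1/2 the diagonal sum is completed to the full series, and T times the
  added tail is the term with T powr (2 \<kappa>). Q stays quantified because each range of \<kappa>
  bounds its sum over blocks in its own way.\<close>

lemma mean_square_convergent:
  assumes \<sigma>: "\<sigma>2 \<ge> 1/2" "Re s1 + \<sigma>2 \<ge> 3/2"
    and ns: "\<And>t. t \<ge> 2 \<Longrightarrow> (s1, Complex \<sigma>2 t) \<notin> euler_double_zeta_singularities"
    and B: "\<And>n. n \<ge> 1 \<Longrightarrow> norm (zeta_psum s1 n) \<le> B * real n powr \<beta> * (1 + ln (real n)) ^ e" "B > 0"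
    and e: "e \<le> 1" and \<beta>: "1 - Re s1 \<le> \<beta>" and \<kappa>: "\<kappa> = \<beta> + 1 - \<sigma>2" "\<kappa> < 1/2"
  obtains C c \<Lambda> where "C > 0" "c > 0" "\<Lambda> \<ge> 1"
    "\<And>T. T \<ge> 2 \<Longrightarrow> \<exists>L. T \<le> 2 ^ L \<and> 2 ^ L \<le> 2 * \<Lambda> * T \<and> real L + 2 \<le> c * ln T \<and>
       (\<forall>Q. (\<Sum>j\<le>L. (2 powr \<kappa>) ^ j * (real j + 2) ^ e) \<le> Q \<longrightarrow>
       \<bar>mean_square s1 \<sigma>2 T - zeta2_sq s1 (2 * \<sigma>2) * T\<bar> \<le>
         C * (1 + Q\<^sup>2 + (2 powr \<kappa>) ^ L * (real L + 2) ^ e * real L + T powr (2 * \<kappa>) * (real L + 2) ^ (2 * e)))"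
proof -
  obtain C2 where C2: "C2 \<ge> 0" and summ: "summable (\<lambda>n. (norm (dcoeff s1 \<sigma>2 n))\<^sup>2)"
    and tail: "\<And>K. K \<ge> 1 \<Longrightarrow> (\<Sum>j. (norm (dcoeff s1 \<sigma>2 (K + j)))\<^sup>2) \<le> C2 * real K powr (2 * \<kappa> - 1) * (1 + ln (real K)) ^ (2 * e)"
    by (rule dcoeff_tail[OF B e \<kappa>]) (assumption, rule that)
  define Z where "Z = zeta2_sq s1 (2 * \<sigma>2)"
  have Z0: "Z \<ge> 0" unfolding Z_def zeta2_sq_eq[OF summ] by (intro suminf_nonneg summ) auto
  show ?thesis
  proof (rule mean_square_weighted[OF \<sigma> ns B \<beta> \<kappa>(1)])
    fix \<Lambda> C0 :: real
    assume \<Lambda>: "\<Lambda> \<ge> 1" and C0: "C0 > 0" and main: "\<And>T L Q. T \<ge> 2 \<Longrightarrow> \<Lambda> * T \<le> 2 ^ L \<Longrightarrow> (\<Sum>j\<le>L. (2 powr \<kappa>) ^ j * (real j + 2) ^ e) \<le> Q \<Longrightarrow>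
       \<bar>mean_square s1 \<sigma>2 T - T * diag_sum s1 \<sigma>2 (2 ^ L)\<bar> \<le>
         C0 * (diag_sum s1 \<sigma>2 (2 ^ L) + Q\<^sup>2 +
           (2 powr \<kappa>) ^ L * (real L + 2) ^ e * (real L * sqrt (diag_sum s1 \<sigma>2 (2 ^ L))))"
    from dyadic_scale[OF \<Lambda>] obtain c where c: "c > 0" and scale:
      "\<And>T. T \<ge> 2 \<Longrightarrow> \<exists>L. \<Lambda> * T \<le> 2 ^ L \<and> 2 ^ L \<le> 2 * \<Lambda> * T \<and> real L + 2 \<le> c * ln T \<and> \<bar>real L * ln 2 - ln T\<bar> \<le> c"
      by metis
    define C where "C = C0 * (Z + 1 + sqrt Z) + C2 + 1"
    have C: "C > 0" unfolding C_def using C0 C2 Z0 by (intro add_nonneg_pos add_nonneg_nonneg mult_nonneg_nonneg) auto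
    show ?thesis
    proof (rule that[OF C c \<Lambda>])
      fix T :: real assume T: "T \<ge> 2"
      from scale[OF T] obtain L where L: "\<Lambda> * T \<le> 2 ^ L" "2 ^ L \<le> 2 * \<Lambda> * T" "real L + 2 \<le> c * ln T" by blast
      have "1 * T \<le> \<Lambda> * T" using \<Lambda> T by (intro mult_right_mono) auto
      then have TL: "T \<le> 2 ^ L" using L(1) by simp
      have one: "(1::nat) \<le> 2 ^ L" by simp
      define V where "V = diag_sum s1 \<sigma>2 (2 ^ L)"
      define R where "R = (\<Sum>j. (norm (dcoeff s1 \<sigma>2 (2 ^ L + j)))\<^sup>2)"
      have ZV: "Z = V + R" unfolding Z_def V_def R_def by (rule diag_sum_split[OF summ one])
      have V0: "V \<ge> 0" unfolding V_def diag_sum_def by (intro sum_nonneg) auto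
      have R0: "R \<ge> 0" unfolding R_def using summ
        by (intro suminf_nonneg) (auto simp: add.commute[of "2 ^ L"] summable_iff_shift[where f = "\<lambda>n. (norm (dcoeff s1 \<sigma>2 n))\<^sup>2"])
      have TR: "T * R \<le> C2 * (T powr (2 * \<kappa>) * (real L + 2) ^ (2 * e))"
      proof -
        have lnL: "1 + ln (2 ^ L) \<le> real L + 2"
        proof -
          have "ln (2 ^ L) = real L * ln 2" by (rule ln_realpow)
          also have "\<dots> \<le> real L * 1" using ln_2_less_1 by (intro mult_left_mono) auto
          finally show ?thesis by simp
        qed
        have "R \<le> C2 * (2 ^ L) powr (2 * \<kappa> - 1) * (1 + ln (2 ^ L)) ^ (2 * e)"
          using tail[OF one] by (simp add: R_def)
        also have "\<dots> \<le> C2 * T powr (2 * \<kappa> - 1) * (real L + 2) ^ (2 * e)"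
          using TL T \<kappa>(2) C2 by (intro mult_mono power_mono lnL powr_mono2' mult_nonneg_nonneg) auto
        finally have "T * R \<le> T * (C2 * T powr (2 * \<kappa> - 1) * (real L + 2) ^ (2 * e))"
          using T by (intro mult_left_mono) auto
        also have "\<dots> = C2 * (T powr (2 * \<kappa>) * (real L + 2) ^ (2 * e))"
          using T by (simp add: powr_diff)
        finally show ?thesis .
      qed
      show "\<exists>L. T \<le> 2 ^ L \<and> 2 ^ L \<le> 2 * \<Lambda> * T \<and> real L + 2 \<le> c * ln T \<and>
       (\<forall>Q. (\<Sum>j\<le>L. (2 powr \<kappa>) ^ j * (real j + 2) ^ e) \<le> Q \<longrightarrow>
       \<bar>mean_square s1 \<sigma>2 T - zeta2_sq s1 (2 * \<sigma>2) * T\<bar> \<le>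
         C * (1 + Q\<^sup>2 + (2 powr \<kappa>) ^ L * (real L + 2) ^ e * real L + T powr (2 * \<kappa>) * (real L + 2) ^ (2 * e)))"
      proof (intro exI[of _ L] conjI allI impI TL L(2,3))
        fix Q assume Q: "(\<Sum>j\<le>L. (2 powr \<kappa>) ^ j * (real j + 2) ^ e) \<le> Q"
        define u where "u = (2 powr \<kappa>) ^ L * (real L + 2) ^ e * real L"
        define v where "v = T powr (2 * \<kappa>) * (real L + 2) ^ (2 * e)"
        have u0: "u \<ge> 0" and v0: "v \<ge> 0" by (auto simp: u_def v_def)
        have "\<bar>mean_square s1 \<sigma>2 T - T * V\<bar> \<le> C0 * (V + Q\<^sup>2 + u * sqrt V)"
          using main[OF T L(1) Q] by (simp add: u_def V_def mult.assoc)
        also have "\<dots> \<le> C0 * (Z + Q\<^sup>2 + u * sqrt Z)"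
          using C0 ZV R0 u0 by (intro mult_left_mono add_mono order_refl real_sqrt_le_mono) auto
        finally have "\<bar>mean_square s1 \<sigma>2 T - T * V\<bar> \<le> C0 * (Z + Q\<^sup>2 + u * sqrt Z)" .
        moreover have "Z * T = T * V + T * R" by (simp add: ZV algebra_simps)
        moreover have "0 \<le> T * R" using R0 T by simp
        ultimately have "\<bar>mean_square s1 \<sigma>2 T - Z * T\<bar> \<le> C0 * (Z + Q\<^sup>2 + u * sqrt Z) + T * R"
          by linarith
        also have "\<dots> \<le> C0 * (Z + Q\<^sup>2 + u * sqrt Z) + C2 * v"
          using TR by (simp add: v_def)
        also have "\<dots> \<le> C * (1 + Q\<^sup>2 + u + v)"
        proof -
          have "0 \<le> C0 * Z" "0 \<le> C0 * sqrt Z" using C0 Z0 by simp_all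
          then have "C0 * Z \<le> C" "C0 \<le> C" "C0 * sqrt Z \<le> C" "C2 \<le> C"
            using C0 C2 unfolding C_def distrib_left by linarith+
          then have "C0 * Q\<^sup>2 \<le> C * Q\<^sup>2" "C0 * sqrt Z * u \<le> C * u" "C2 * v \<le> C * v" "C0 * Z \<le> C"
            using u0 v0 by (auto intro: mult_right_mono)
          then show ?thesis by (simp add: algebra_simps)
        qed
        finally show "\<bar>mean_square s1 \<sigma>2 T - zeta2_sq s1 (2 * \<sigma>2) * T\<bar> \<le>
         C * (1 + Q\<^sup>2 + (2 powr \<kappa>) ^ L * (real L + 2) ^ e * real L + T powr (2 * \<kappa>) * (real L + 2) ^ (2 * e))"
          unfolding Z_def u_def v_def .
      qed
    qed
  qed
qed

section \<open>The error term according to the sign of \<open>\<kappa>\<close>\<close>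

lemma sum_power_log_le:
  assumes "x > 0"
  shows "(\<Sum>j\<le>L. x ^ j * (real j + 2) ^ e) \<le> (real L + 2) ^ e * (\<Sum>j\<le>L. x ^ j)"
  unfolding sum_distrib_left using assms
  by (intro sum_mono) (auto simp: mult.commute intro!: mult_left_mono power_mono)

lemma geometric_le_last:
  assumes "x > (1::real)"
  shows "(\<Sum>j\<le>L. x ^ j) \<le> x / (x - 1) * x ^ L"
proof -
  have "(\<Sum>j\<le>L. x ^ j) = (x ^ Suc L - 1) / (x - 1)"
    using geometric_sum[of x "Suc L"] assms by (simp add: lessThan_Suc_atMost)
  also have "\<dots> \<le> x ^ Suc L / (x - 1)"
    using assms by (intro divide_right_mono) auto
  finally show ?thesis by simp
qed

lemma two_powr_power_le:
  fixes \<kappa> \<Lambda> T :: real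
  assumes "2 ^ L \<le> 2 * \<Lambda> * T" "\<kappa> \<ge> 0" "\<Lambda> \<ge> 1" "T \<ge> 2"
  shows "(2 powr \<kappa>) ^ L \<le> (2 * \<Lambda>) powr \<kappa> * T powr \<kappa>"
proof -
  have "(2 powr \<kappa>) ^ L = (2 ^ L) powr \<kappa>" by (simp add: powr_power_two)
  also have "\<dots> \<le> (2 * \<Lambda> * T) powr \<kappa>" using assms by (intro powr_mono2) auto
  also have "\<dots> = (2 * \<Lambda>) powr \<kappa> * T powr \<kappa>" using assms by (simp add: powr_mult)
  finally show ?thesis .
qed

lemma ln_le_powr:
  assumes "\<kappa> > 0" "T \<ge> (1::real)"
  shows "ln T \<le> T powr \<kappa> / \<kappa>"
  using ln_powr_bound[of T \<kappa>] assms by simp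

context
  fixes s1 :: complex and \<sigma>2 \<beta> B \<kappa> :: real and e :: nat
  assumes \<sigma>: "\<sigma>2 \<ge> 1/2" "Re s1 + \<sigma>2 \<ge> 3/2"
    and ns: "\<And>t. t \<ge> 2 \<Longrightarrow> (s1, Complex \<sigma>2 t) \<notin> euler_double_zeta_singularities"
    and B: "\<And>n. n \<ge> 1 \<Longrightarrow> norm (zeta_psum s1 n) \<le> B * real n powr \<beta> * (1 + ln (real n)) ^ e" "B > 0"
    and e: "e \<le> 1" and \<beta>: "1 - Re s1 \<le> \<beta>" and \<kappa>: "\<kappa> = \<beta> + 1 - \<sigma>2"
begin

lemma mean_square_kappa_neg:
  assumes "\<kappa> < 0" "e = 0"
  shows "\<exists>C. \<forall>T\<ge>2. \<bar>mean_square s1 \<sigma>2 T - zeta2_sq s1 (2 * \<sigma>2) * T\<bar> \<le> C"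
proof (rule mean_square_convergent[OF \<sigma> ns B e \<beta> \<kappa>])
  show "\<kappa> < 1/2" using assms by simp
  fix C c \<Lambda> :: real
  assume C: "C > 0" and main: "\<And>T. T \<ge> 2 \<Longrightarrow> \<exists>L. T \<le> 2 ^ L \<and> 2 ^ L \<le> 2 * \<Lambda> * T \<and> real L + 2 \<le> c * ln T \<and>
       (\<forall>Q. (\<Sum>j\<le>L. (2 powr \<kappa>) ^ j * (real j + 2) ^ e) \<le> Q \<longrightarrow>
       \<bar>mean_square s1 \<sigma>2 T - zeta2_sq s1 (2 * \<sigma>2) * T\<bar> \<le>
         C * (1 + Q\<^sup>2 + (2 powr \<kappa>) ^ L * (real L + 2) ^ e * real L + T powr (2 * \<kappa>) * (real L + 2) ^ (2 * e)))"
  define x where "x = 2 powr \<kappa>"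
  have x: "0 < x" "x < 1" using assms by (simp_all add: x_def powr_less_one)
  define Q where "Q = 1 / (1 - x)"
  have geo: "(\<Sum>j<n. x ^ j) \<le> Q" for n
  proof -
    have "(\<Sum>j<n. x ^ j) \<le> (\<Sum>j. x ^ j)" using x by (intro sum_le_suminf) auto
    then show ?thesis using x by (simp add: Q_def suminf_geometric)
  qed
  have "\<bar>mean_square s1 \<sigma>2 T - zeta2_sq s1 (2 * \<sigma>2) * T\<bar> \<le> C * (1 + Q\<^sup>2 + Q + 1)" if T: "T \<ge> 2" for T
  proof -
    obtain L where L: "\<And>Q. (\<Sum>j\<le>L. x ^ j * (real j + 2) ^ e) \<le> Q \<Longrightarrow>
       \<bar>mean_square s1 \<sigma>2 T - zeta2_sq s1 (2 * \<sigma>2) * T\<bar> \<le>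
         C * (1 + Q\<^sup>2 + x ^ L * (real L + 2) ^ e * real L + T powr (2 * \<kappa>) * (real L + 2) ^ (2 * e))"
      using main[OF T] unfolding x_def by blast
    have "(\<Sum>j\<le>L. x ^ j * (real j + 2) ^ e) \<le> Q"
      using geo[of "Suc L"] by (simp add: assms lessThan_Suc_atMost)
    from L[OF this] have "\<bar>mean_square s1 \<sigma>2 T - zeta2_sq s1 (2 * \<sigma>2) * T\<bar> \<le> C * (1 + Q\<^sup>2 + x ^ L * real L + T powr (2 * \<kappa>))"
      by (simp add: assms)
    also have "\<dots> \<le> C * (1 + Q\<^sup>2 + Q + 1)"
    proof (intro mult_left_mono add_mono order_refl)
      \<comment> \<open>As x < 1, the L copies of x^L are dominated by the earlier powers, so the
        factor L costs no logarithm.\<close>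
      have "x ^ L * real L = (\<Sum>j<L. x ^ L)" by simp
      also have "\<dots> \<le> (\<Sum>j<L. x ^ j)" using x by (intro sum_mono power_decreasing) auto
      also note geo
      finally show "x ^ L * real L \<le> Q" .
      have "T powr (2 * \<kappa>) \<le> T powr 0" using T assms by (intro powr_mono) auto
      then show "T powr (2 * \<kappa>) \<le> 1" using T by simp
    qed (use C in auto)
    finally show ?thesis .
  qed
  then show ?thesis by blast
qed

text \<open>All blocks weigh the same up to (j + 2)^e, so their sum is of order (log T)^(1 + e), and
  it enters squared.\<close>

lemma mean_square_kappa_zero:
  assumes "\<kappa> = 0"
  shows "\<exists>C. \<forall>T\<ge>2. \<bar>mean_square s1 \<sigma>2 T - zeta2_sq s1 (2 * \<sigma>2) * T\<bar> \<le> C * ln T ^ (2 + 2 * e)"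
proof (rule mean_square_convergent[OF \<sigma> ns B e \<beta> \<kappa>])
  show "\<kappa> < 1/2" using assms by simp
  fix C c \<Lambda> :: real
  assume C: "C > 0" "c > 0" and main: "\<And>T. T \<ge> 2 \<Longrightarrow> \<exists>L. T \<le> 2 ^ L \<and> 2 ^ L \<le> 2 * \<Lambda> * T \<and> real L + 2 \<le> c * ln T \<and>
       (\<forall>Q. (\<Sum>j\<le>L. (2 powr \<kappa>) ^ j * (real j + 2) ^ e) \<le> Q \<longrightarrow>
       \<bar>mean_square s1 \<sigma>2 T - zeta2_sq s1 (2 * \<sigma>2) * T\<bar> \<le>
         C * (1 + Q\<^sup>2 + (2 powr \<kappa>) ^ L * (real L + 2) ^ e * real L + T powr (2 * \<kappa>) * (real L + 2) ^ (2 * e)))"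
  have "\<bar>mean_square s1 \<sigma>2 T - zeta2_sq s1 (2 * \<sigma>2) * T\<bar> \<le> 4 * C * c ^ (2 + 2 * e) * ln T ^ (2 + 2 * e)"
    if T: "T \<ge> 2" for T
  proof -
    obtain L where Lc: "real L + 2 \<le> c * ln T" and L: "\<And>Q. (\<Sum>j\<le>L. (real j + 2) ^ e) \<le> Q \<Longrightarrow>
       \<bar>mean_square s1 \<sigma>2 T - zeta2_sq s1 (2 * \<sigma>2) * T\<bar> \<le>
         C * (1 + Q\<^sup>2 + (real L + 2) ^ e * real L + (real L + 2) ^ (2 * e))"
      using main[OF T] T unfolding assms by auto
    define p where "p = real L + 2"
    have p: "p \<ge> 1" "real L \<le> p" by (auto simp: p_def)
    have "(\<Sum>j\<le>L. (real j + 2) ^ e) \<le> p ^ e * (\<Sum>j\<le>L. 1 ^ j)"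
      using sum_power_log_le[where x = 1 and L = L and e = e] by (simp add: p_def)
    also have "\<dots> \<le> p ^ e * p" using p by (intro mult_left_mono) (auto simp: p_def)
    finally have "(\<Sum>j\<le>L. (real j + 2) ^ e) \<le> p ^ (1 + e)" by (simp add: mult.commute)
    from L[OF this] have "\<bar>mean_square s1 \<sigma>2 T - zeta2_sq s1 (2 * \<sigma>2) * T\<bar> \<le> C * (1 + (p ^ (1 + e))\<^sup>2 + p ^ e * real L + p ^ (2 * e))"
      by (simp add: p_def)
    also have "\<dots> \<le> C * (p ^ (2 + 2 * e) + p ^ (2 + 2 * e) + p ^ (2 + 2 * e) + p ^ (2 + 2 * e))"
    proof (intro mult_left_mono add_mono)
      show "1 \<le> p ^ (2 + 2 * e)" using p by (intro one_le_power)
      have "(1 + e) * 2 = 2 + 2 * e" by simp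
      then show "(p ^ (1 + e))\<^sup>2 \<le> p ^ (2 + 2 * e)" by (simp only: power_mult[symmetric] order_refl)
      have "p ^ e * real L \<le> p ^ e * p" using p by (intro mult_left_mono) auto
      also have "\<dots> = p ^ (1 + e)" by (simp add: mult.commute)
      also have "\<dots> \<le> p ^ (2 + 2 * e)" using p by (intro power_increasing) auto
      finally show "p ^ e * real L \<le> p ^ (2 + 2 * e)" .
      show "p ^ (2 * e) \<le> p ^ (2 + 2 * e)" using p by (intro power_increasing) auto
    qed (use C in auto)
    also have "\<dots> = 4 * C * p ^ (2 + 2 * e)" by simp
    also have "\<dots> \<le> 4 * C * (c * ln T) ^ (2 + 2 * e)"
      using C Lc p by (intro mult_left_mono power_mono) (auto simp: p_def)
    finally show ?thesis by (simp only: power_mult_distrib mult.assoc)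
  qed
  then show ?thesis by blast
qed

text \<open>The last block dominates. The factor L in the cross term is absorbed by a second T powr
  \<kappa>, so it adds no logarithm.\<close>

lemma mean_square_kappa_pos:
  assumes k: "0 < \<kappa>" "\<kappa> < 1/2"
  shows "\<exists>C. \<forall>T\<ge>2. \<bar>mean_square s1 \<sigma>2 T - zeta2_sq s1 (2 * \<sigma>2) * T\<bar> \<le> C * (T powr (2 * \<kappa>) * ln T ^ (2 * e))"
proof (rule mean_square_convergent[OF \<sigma> ns B e \<beta> \<kappa> k(2)])
  fix C c \<Lambda> :: real
  assume C: "C > 0" "c > 0" and \<Lambda>: "\<Lambda> \<ge> 1" and main: "\<And>T. T \<ge> 2 \<Longrightarrow> \<exists>L. T \<le> 2 ^ L \<and> 2 ^ L \<le> 2 * \<Lambda> * T \<and> real L + 2 \<le> c * ln T \<and>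
       (\<forall>Q. (\<Sum>j\<le>L. (2 powr \<kappa>) ^ j * (real j + 2) ^ e) \<le> Q \<longrightarrow>
       \<bar>mean_square s1 \<sigma>2 T - zeta2_sq s1 (2 * \<sigma>2) * T\<bar> \<le>
         C * (1 + Q\<^sup>2 + (2 powr \<kappa>) ^ L * (real L + 2) ^ e * real L + T powr (2 * \<kappa>) * (real L + 2) ^ (2 * e)))"
  define x where "x = 2 powr \<kappa>"
  have x: "x > 1" using k by (simp add: x_def)
  define D where "D = (2 * \<Lambda>) powr \<kappa>"
  define E where "E = x / (x - 1) * D"
  have D: "D \<ge> 0" and E: "E \<ge> 0" using x by (simp_all add: D_def E_def)
  define C' where "C' = C * (1 + E\<^sup>2 + D * (c / \<kappa>) + 1)"
  have C': "C' \<ge> 0" using C D k by (simp add: C'_def)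
  have "\<bar>mean_square s1 \<sigma>2 T - zeta2_sq s1 (2 * \<sigma>2) * T\<bar> \<le> C' * c ^ (2 * e) * (T powr (2 * \<kappa>) * ln T ^ (2 * e))"
    if T: "T \<ge> 2" for T
  proof -
    obtain L where Lc: "real L + 2 \<le> c * ln T" "2 ^ L \<le> 2 * \<Lambda> * T" and L: "\<And>Q. (\<Sum>j\<le>L. x ^ j * (real j + 2) ^ e) \<le> Q \<Longrightarrow>
       \<bar>mean_square s1 \<sigma>2 T - zeta2_sq s1 (2 * \<sigma>2) * T\<bar> \<le>
         C * (1 + Q\<^sup>2 + x ^ L * (real L + 2) ^ e * real L + T powr (2 * \<kappa>) * (real L + 2) ^ (2 * e))"
      using main[OF T] unfolding x_def by blast
    define p where "p = real L + 2"
    define t where "t = T powr \<kappa>"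
    have p: "p \<ge> 1" "real L \<le> p" by (auto simp: p_def)
    have "T powr 0 \<le> t" unfolding t_def using T k by (intro powr_mono) auto
    then have t: "t \<ge> 1" using T by simp
    have tt: "T powr (2 * \<kappa>) = t\<^sup>2" by (simp add: t_def powr_square)
    have xL: "x ^ L \<le> D * t"
      unfolding x_def D_def t_def using Lc k \<Lambda> T by (intro two_powr_power_le) auto
    have "(\<Sum>j\<le>L. x ^ j * (real j + 2) ^ e) \<le> p ^ e * (\<Sum>j\<le>L. x ^ j)"
      unfolding p_def using x by (intro sum_power_log_le) auto
    also have "\<dots> \<le> p ^ e * (x / (x - 1) * x ^ L)"
      using p x by (intro mult_left_mono geometric_le_last) auto
    also have "\<dots> \<le> p ^ e * (x / (x - 1) * (D * t))"
      using p x xL by (intro mult_left_mono) auto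
    also have "\<dots> = p ^ e * (E * t)" by (simp add: E_def)
    finally have Q: "(\<Sum>j\<le>L. x ^ j * (real j + 2) ^ e) \<le> p ^ e * (E * t)" .
    have "real L \<le> c * (t / \<kappa>)"
    proof -
      have "c * ln T \<le> c * (T powr \<kappa> / \<kappa>)" using C T k by (intro mult_left_mono ln_le_powr) auto
      then show ?thesis using Lc by (simp add: t_def)
    qed
    then have u: "x ^ L * p ^ e * real L \<le> (D * t) * p ^ e * (c * (t / \<kappa>))"
      using xL p x D t by (intro mult_mono mult_nonneg_nonneg) auto
    have "p ^ e \<le> p ^ (2 * e)" using p by (intro power_increasing) auto
    then have "(D * t) * p ^ e * (c * (t / \<kappa>)) \<le> (D * t) * p ^ (2 * e) * (c * (t / \<kappa>))"
      using D t C k p by (intro mult_right_mono mult_left_mono) auto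
    with u have u': "x ^ L * p ^ e * real L \<le> D * (c / \<kappa>) * (t\<^sup>2 * p ^ (2 * e))"
      by (simp add: power2_eq_square mult_ac)
    have one: "1 \<le> t\<^sup>2 * p ^ (2 * e)"
      using mult_mono[OF one_le_power[OF t, of 2] one_le_power[OF p(1), of "2 * e"]] by simp
    have "\<bar>mean_square s1 \<sigma>2 T - zeta2_sq s1 (2 * \<sigma>2) * T\<bar> \<le> C * (1 + (p ^ e * (E * t))\<^sup>2 + x ^ L * p ^ e * real L + t\<^sup>2 * p ^ (2 * e))"
      using L[OF Q] by (simp add: p_def tt)
    also have "\<dots> \<le> C * (t\<^sup>2 * p ^ (2 * e) + E\<^sup>2 * (t\<^sup>2 * p ^ (2 * e)) + D * (c / \<kappa>) * (t\<^sup>2 * p ^ (2 * e)) + t\<^sup>2 * p ^ (2 * e))"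
    proof (intro mult_left_mono add_mono one u')
      show "(p ^ e * (E * t))\<^sup>2 \<le> E\<^sup>2 * (t\<^sup>2 * p ^ (2 * e))"
        by (simp add: power_mult_distrib power_mult mult_ac flip: power_mult)
    qed (use C in auto)
    also have "\<dots> = C' * (t\<^sup>2 * p ^ (2 * e))"
      unfolding C'_def by algebra
    also have "\<dots> \<le> C' * (t\<^sup>2 * (c * ln T) ^ (2 * e))"
      using C' Lc p by (intro mult_left_mono power_mono) (auto simp: p_def)
    finally show ?thesis unfolding tt by (simp add: power_mult_distrib mult_ac)
  qed
  then show ?thesis by blast
qed

end

section \<open>Harmonic sums and the critical exponent 1/2\<close>

lemma ln_Suc_diff:
  assumes "n \<ge> 1"
  shows "1 / real (Suc n) \<le> ln (real (Suc n)) - ln (real n)" "ln (real (Suc n)) - ln (real n) \<le> 1 / real n"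
proof -
  show "1 / real (Suc n) \<le> ln (real (Suc n)) - ln (real n)"
    using ln_diff_ge_nat[of n "Suc n" "real (Suc n)"] assms by simp
  have "ln (real (Suc n) / real n) \<le> real (Suc n) / real n - 1"
    using assms by (intro ln_le_minus_one) auto
  then show "ln (real (Suc n)) - ln (real n) \<le> 1 / real n"
    using assms by (simp add: ln_div field_simps)
qed

definition harmonic_sum :: "nat \<Rightarrow> real" where
  "harmonic_sum N = (\<Sum>n=1..<N. 1 / real n)"

lemma harmonic_sum_Suc: "n \<ge> 1 \<Longrightarrow> harmonic_sum (Suc n) = harmonic_sum n + 1 / real n"
  by (simp add: harmonic_sum_def)

lemma harmonic_sum_bounds:
  assumes "N \<ge> 1"
  shows "ln (real N) \<le> harmonic_sum N" "harmonic_sum N \<le> 1 + ln (real N)"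
proof -
  show "ln (real N) \<le> harmonic_sum N"
    using assms
  proof (induction N rule: dec_induct)
    case (step n)
    then show ?case using ln_Suc_diff(2)[of n] harmonic_sum_Suc[of n] by simp
  qed (simp add: harmonic_sum_def)
  \<comment> \<open>With 1 / N included, the induction step adds 1 / (n + 1), which is what the
    increment of ln dominates.\<close>
  have "harmonic_sum N + 1 / real N \<le> 1 + ln (real N)"
    using assms
  proof (induction N rule: dec_induct)
    case (step n)
    then show ?case using ln_Suc_diff(1)[of n] harmonic_sum_Suc[of n] by simp
  qed (simp add: harmonic_sum_def)
  moreover have "0 \<le> 1 / real N" by simp
  ultimately show "harmonic_sum N \<le> 1 + ln (real N)" by linarith
qed

text \<open>At \<kappa> = 1/2 the diagonal sum may grow like a power of log T and becomes the main
  term. It therefore stays in the conclusion, with the closeness of L ln 2 to ln T for evaluating it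
  later.\<close>

lemma mean_square_critical:
  assumes \<sigma>: "\<sigma>2 \<ge> 1/2" "Re s1 + \<sigma>2 \<ge> 3/2"
    and ns: "\<And>t. t \<ge> 2 \<Longrightarrow> (s1, Complex \<sigma>2 t) \<notin> euler_double_zeta_singularities"
    and B: "\<And>n. n \<ge> 1 \<Longrightarrow> norm (zeta_psum s1 n) \<le> B * real n powr \<beta> * (1 + ln (real n)) ^ e" "B > 0"
    and \<beta>: "1 - Re s1 \<le> \<beta>" and \<kappa>: "1/2 = \<beta> + 1 - \<sigma>2"
  shows "\<exists>C c. c > 0 \<and> (\<forall>T\<ge>2. \<exists>L. real L + 2 \<le> c * ln T \<and> \<bar>real L * ln 2 - ln T\<bar> \<le> c \<and>
       \<bar>mean_square s1 \<sigma>2 T - T * diag_sum s1 \<sigma>2 (2 ^ L)\<bar> \<le> C * (T * ln T ^ (2 * e)))"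
proof (rule mean_square_weighted[OF \<sigma> ns B \<beta> \<kappa>])
  fix \<Lambda> C0 :: real
  assume \<Lambda>: "\<Lambda> \<ge> 1" and C0: "C0 > 0" and main: "\<And>T L Q. T \<ge> 2 \<Longrightarrow> \<Lambda> * T \<le> 2 ^ L \<Longrightarrow> (\<Sum>j\<le>L. (2 powr (1/2)) ^ j * (real j + 2) ^ e) \<le> Q \<Longrightarrow>
       \<bar>mean_square s1 \<sigma>2 T - T * diag_sum s1 \<sigma>2 (2 ^ L)\<bar> \<le>
         C0 * (diag_sum s1 \<sigma>2 (2 ^ L) + Q\<^sup>2 +
           (2 powr (1/2)) ^ L * (real L + 2) ^ e * (real L * sqrt (diag_sum s1 \<sigma>2 (2 ^ L))))"
  from dyadic_scale[OF \<Lambda>] obtain c where c: "c > 0" and scale: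
    "\<And>T. T \<ge> 2 \<Longrightarrow> \<exists>L. \<Lambda> * T \<le> 2 ^ L \<and> 2 ^ L \<le> 2 * \<Lambda> * T \<and> real L + 2 \<le> c * ln T \<and> \<bar>real L * ln 2 - ln T\<bar> \<le> c"
    by metis
  define x :: real where "x = 2 powr (1/2)"
  have x: "x > 1" by (simp add: x_def)
  define D where "D = (2 * \<Lambda>) powr (1/2)"
  define E where "E = x / (x - 1) * D"
  have D: "D \<ge> 0" and E: "E \<ge> 0" using x by (simp_all add: D_def E_def)
  define C' where "C' = C0 * (B\<^sup>2 * c + E\<^sup>2 + D * B * sqrt (27 * c ^ 3))"
  have C': "C' \<ge> 0" using C0 D B c by (simp add: C'_def)
  have "\<exists>L. real L + 2 \<le> c * ln T \<and> \<bar>real L * ln 2 - ln T\<bar> \<le> c \<and>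
       \<bar>mean_square s1 \<sigma>2 T - T * diag_sum s1 \<sigma>2 (2 ^ L)\<bar> \<le> C' * c ^ (2 * e) * (T * ln T ^ (2 * e))"
    if T: "T \<ge> 2" for T
  proof -
    from scale[OF T] obtain L where L: "\<Lambda> * T \<le> 2 ^ L" "2 ^ L \<le> 2 * \<Lambda> * T" "real L + 2 \<le> c * ln T" "\<bar>real L * ln 2 - ln T\<bar> \<le> c"
      by blast
    define p where "p = real L + 2"
    define t where "t = T powr (1/2)"
    define V where "V = diag_sum s1 \<sigma>2 (2 ^ L)"
    have p: "p \<ge> 1" "real L \<le> p" "real L + 1 \<le> p" by (auto simp: p_def)
    have t: "t\<^sup>2 = T" "t > 0" using T by (simp_all add: t_def powr_square)
    have ln2L: "ln (2 ^ L) \<le> real L"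
    proof -
      have "ln (2 ^ L) = real L * ln 2" by (rule ln_realpow)
      also have "\<dots> \<le> real L * 1" using ln_2_less_1 by (intro mult_left_mono) auto
      finally show ?thesis by simp
    qed
    have V_le: "V \<le> (B * p ^ e)\<^sup>2 * p"
    proof -
      have "V \<le> (\<Sum>n=1..<2 ^ L. (B * p ^ e)\<^sup>2 * (1 / real n))"
        unfolding V_def diag_sum_def
      proof (rule sum_mono)
        fix n assume "n \<in> {1..<2 ^ L :: nat}"
        then have n: "n \<ge> 1" "real n \<le> 2 ^ L"
          using of_nat_mono[of n "2 ^ L", where 'a = real] by auto
        have "ln (real n) \<le> ln (2 ^ L)" using n by (subst ln_le_cancel_iff) auto
        moreover have "0 \<le> ln (real n)" using n by simp
        ultimately have l: "0 \<le> 1 + ln (real n)" "1 + ln (real n) \<le> p" using ln2L p by linarith+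
        have "norm (dcoeff s1 \<sigma>2 n) \<le> B * real n powr (\<beta> - \<sigma>2) * (1 + ln (real n)) ^ e"
          using n by (intro dcoeff_le B) auto
        also have "\<dots> \<le> B * real n powr (\<beta> - \<sigma>2) * p ^ e"
          using B l by (intro mult_left_mono power_mono) auto
        also have "\<beta> - \<sigma>2 = - 1 / 2" using \<kappa> by simp
        finally have "(norm (dcoeff s1 \<sigma>2 n))\<^sup>2 \<le> (B * real n powr (- 1 / 2) * p ^ e)\<^sup>2"
          by (intro power_mono) auto
        also have "\<dots> = (B * p ^ e)\<^sup>2 * (1 / real n)"
          unfolding power_mult_distrib powr_square using n by (simp add: powr_minus_divide)
        finally show "(norm (dcoeff s1 \<sigma>2 n))\<^sup>2 \<le> (B * p ^ e)\<^sup>2 * (1 / real n)" .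
      qed
      also have "\<dots> = (B * p ^ e)\<^sup>2 * harmonic_sum (2 ^ L)" by (simp add: harmonic_sum_def sum_distrib_left)
      also have "\<dots> \<le> (B * p ^ e)\<^sup>2 * p"
        using harmonic_sum_bounds(2)[of "2 ^ L"] ln2L p by (intro mult_left_mono) auto
      finally show ?thesis .
    qed
    have V0: "V \<ge> 0" unfolding V_def diag_sum_def by (intro sum_nonneg) auto
    have pT: "p \<le> c * T"
    proof -
      have "c * ln T \<le> c * T" using T c ln_le_minus_one[of T] by (intro mult_left_mono) auto
      then show ?thesis using L(3) by (simp add: p_def)
    qed
    \<comment> \<open>L sqrt V is at most of order p^(3/2) apart from the weights, and has to be
      bounded by a multiple of sqrt T. The estimate ln T <= 3 T powr (1/3) provides this, hence 27 =
      3^3.\<close>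
    have p3: "p ^ 3 \<le> 27 * c ^ 3 * T"
    proof -
      have "c * ln T \<le> c * (T powr (1/3) / (1/3))"
        using c T by (intro mult_left_mono ln_le_powr) auto
      then have "p \<le> c * (T powr (1/3) / (1/3))"
        using L(3) unfolding p_def by linarith
      then have "p ^ 3 \<le> (c * (T powr (1/3) / (1/3))) ^ 3"
        using p by (intro power_mono) auto
      also have "\<dots> = 27 * c ^ 3 * (T powr (1/3)) ^ 3"
        by (simp add: power_mult_distrib)
      also have "(T powr (1/3)) ^ 3 = T" using T by (simp add: powr_power)
      finally show ?thesis .
    qed
    have sqrtV: "real L * sqrt V \<le> B * p ^ e * (sqrt (27 * c ^ 3) * t)"
    proof -
      have "real L * sqrt V \<le> p * sqrt ((B * p ^ e)\<^sup>2 * p)"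
        using p V0 V_le by (intro mult_mono real_sqrt_le_mono) auto
      also have "\<dots> = B * p ^ e * sqrt (p ^ 3)"
        using p B by (simp add: real_sqrt_mult power3_eq_cube)
      also have "\<dots> \<le> B * p ^ e * sqrt (27 * c ^ 3 * T)"
        using p B p3 by (intro mult_left_mono real_sqrt_le_mono) auto
      also have "sqrt (27 * c ^ 3 * T) = sqrt (27 * c ^ 3) * t"
        using t by (simp add: real_sqrt_mult flip: t(1))
      finally show ?thesis .
    qed
    have xL: "x ^ L \<le> D * t"
      unfolding x_def D_def t_def using L \<Lambda> T by (intro two_powr_power_le) auto
    have "(\<Sum>j\<le>L. x ^ j * (real j + 2) ^ e) \<le> p ^ e * (\<Sum>j\<le>L. x ^ j)"
      unfolding p_def using x by (intro sum_power_log_le) auto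
    also have "\<dots> \<le> p ^ e * (x / (x - 1) * x ^ L)"
      using p x by (intro mult_left_mono geometric_le_last) auto
    also have "\<dots> \<le> p ^ e * (x / (x - 1) * (D * t))"
      using p x xL by (intro mult_left_mono) auto
    also have "\<dots> = p ^ e * (E * t)" by (simp add: E_def)
    finally have Q: "(\<Sum>j\<le>L. x ^ j * (real j + 2) ^ e) \<le> p ^ e * (E * t)" .
    have "\<bar>mean_square s1 \<sigma>2 T - T * V\<bar> \<le> C0 * (V + (p ^ e * (E * t))\<^sup>2 + x ^ L * p ^ e * (real L * sqrt V))"
      using main[OF T L(1), of "p ^ e * (E * t)"] Q unfolding x_def[symmetric] V_def p_def by simp
    also have "\<dots> \<le> C0 * ((B * p ^ e)\<^sup>2 * (c * T) + (p ^ e * (E * t))\<^sup>2 + D * t * p ^ e * (B * p ^ e * (sqrt (27 * c ^ 3) * t)))"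
    proof (intro mult_left_mono add_mono order_refl)
      show "V \<le> (B * p ^ e)\<^sup>2 * (c * T)"
        by (rule order_trans[OF V_le mult_left_mono[OF pT]]) simp
      show "x ^ L * p ^ e * (real L * sqrt V) \<le> D * t * p ^ e * (B * p ^ e * (sqrt (27 * c ^ 3) * t))"
        by (rule mult_mono[OF mult_right_mono[OF xL] sqrtV]) (use p V0 D t(2) in auto)
    qed (use C0 in auto)
    also have "\<dots> = C' * (T * (p ^ e)\<^sup>2)"
      unfolding C'_def t(1)[symmetric] by algebra
    also have "\<dots> \<le> C' * (T * ((c * ln T) ^ e)\<^sup>2)"
      using C' L(3) p T by (intro mult_left_mono power_mono) (auto simp: p_def)
    also have "\<dots> = C' * c ^ (2 * e) * (T * ln T ^ (2 * e))"
      by (simp add: power_mult_distrib mult_ac flip: power_mult)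
    finally show ?thesis using L unfolding V_def by blast
  qed
  then show ?thesis using c by blast
qed

section \<open>Diagonal sums on the critical lines\<close>

lemma zeta_psum_asymp:
  assumes s: "s \<noteq> 1"
  obtains C where "C > 0" "\<And>n. n \<ge> 1 \<Longrightarrow>
    norm (zeta_psum s n - (riemann_zeta s + of_nat n powr (1 - s) / (1 - s))) \<le> C * real n powr (- Re s)"
proof -
  from hurwitz_zeta_asymp[OF s] obtain C where C: "C \<ge> 0"
    "\<And>n. n \<ge> 1 \<Longrightarrow> norm (hurwitz_zeta n s - of_nat n powr (1 - s) / (s - 1)) \<le> C * real n powr (- Re s)" by metis
  have "norm (zeta_psum s n - (riemann_zeta s + of_nat n powr (1 - s) / (1 - s))) \<le> (C + 1) * real n powr (- Re s)"
    if n: "n \<ge> 1" for n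
  proof -
    have "zeta_psum s n = riemann_zeta s - hurwitz_zeta n s"
      using hurwitz_zeta_eq_sum[of 1 s n] n s by (simp add: zeta_psum_def riemann_zeta_eq_hurwitz_zeta)
    moreover have "of_nat n powr (1 - s) / (1 - s) = - (of_nat n powr (1 - s) / (s - 1))"
      by (metis minus_diff_eq minus_divide_right)
    ultimately have "norm (zeta_psum s n - (riemann_zeta s + of_nat n powr (1 - s) / (1 - s)))
        = norm (hurwitz_zeta n s - of_nat n powr (1 - s) / (s - 1))"
      by (simp add: norm_minus_commute)
    also have "\<dots> \<le> C * real n powr (- Re s)" by (rule C(2)[OF n])
    also have "\<dots> \<le> (C + 1) * real n powr (- Re s)" by (intro mult_right_mono) auto
    finally show ?thesis .
  qed
  then show ?thesis using that[of "C + 1"] C(1) by auto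
qed

text \<open>On the line Re s = 1 the term n powr (1 - s) / (1 - s) is still bounded, so no logarithm
  arises there; it arises only at s = 1.\<close>

lemma zeta_psum_bound:
  assumes s: "s \<noteq> 1"
  obtains B where "B > 0" "\<And>n. n \<ge> 1 \<Longrightarrow> norm (zeta_psum s n) \<le> B * real n powr (max 0 (1 - Re s))"
proof -
  from zeta_psum_asymp[OF s] obtain C where C: "C > 0" "\<And>n. n \<ge> 1 \<Longrightarrow>
    norm (zeta_psum s n - (riemann_zeta s + of_nat n powr (1 - s) / (1 - s))) \<le> C * real n powr (- Re s)" by metis
  define B where "B = norm (riemann_zeta s) + 1 / norm (1 - s) + C"
  have "norm (zeta_psum s n) \<le> B * real n powr (max 0 (1 - Re s))" if n: "n \<ge> 1" for n
  proof -
    let ?m = "real n powr (max 0 (1 - Re s))"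
    have m: "1 \<le> ?m" using n by (intro ge_one_powr_ge_zero) auto
    have "norm (zeta_psum s n) \<le> norm (riemann_zeta s) + norm (of_nat n powr (1 - s) / (1 - s)) + C * real n powr (- Re s)"
      using C(2)[OF n] norm_triangle_sub[of "zeta_psum s n" "riemann_zeta s + of_nat n powr (1 - s) / (1 - s)"]
        norm_triangle_ineq[of "riemann_zeta s" "of_nat n powr (1 - s) / (1 - s)"] by linarith
    also have "norm (of_nat n powr (1 - s) / (1 - s)) = 1 / norm (1 - s) * real n powr (1 - Re s)"
      using n by (simp add: norm_divide norm_of_nat_powr)
    also have "norm (riemann_zeta s) + 1 / norm (1 - s) * real n powr (1 - Re s) + C * real n powr (- Re s)
        \<le> norm (riemann_zeta s) * ?m + 1 / norm (1 - s) * ?m + C * ?m"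
      using n C(1) m mult_left_mono[OF m, of "norm (riemann_zeta s)"]
      by (intro add_mono mult_left_mono powr_mono) auto
    finally show ?thesis by (simp add: B_def algebra_simps)
  qed
  moreover have "B > 0" using C(1) by (simp add: B_def add_nonneg_pos)
  ultimately show ?thesis using that by blast
qed

lemma zeta_psum_1: "zeta_psum 1 n = of_real (harmonic_sum n)"
  unfolding zeta_psum_def harmonic_sum_def of_real_sum
  by (intro sum.cong refl) (simp add: powr_minus_divide)

lemma zeta_psum_1_bound:
  assumes "n \<ge> 1"
  shows "norm (zeta_psum 1 n) \<le> 1 + ln (real n)"
proof -
  have "0 \<le> harmonic_sum n" unfolding harmonic_sum_def by (intro sum_nonneg) auto
  then show ?thesis using harmonic_sum_bounds(2)[OF assms] by (simp add: zeta_psum_1)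
qed

lemma norm_square_diff_le:
  "\<bar>(norm x)\<^sup>2 - (norm y)\<^sup>2\<bar> \<le> norm (x - y) * (2 * norm y + norm (x - y))" for x y :: complex
proof -
  have "(norm x)\<^sup>2 - (norm y)\<^sup>2 = (norm x - norm y) * (norm x + norm y)"
    by (simp add: power2_eq_square algebra_simps)
  then have "\<bar>(norm x)\<^sup>2 - (norm y)\<^sup>2\<bar> = \<bar>norm x - norm y\<bar> * (norm x + norm y)"
    by (simp add: abs_mult)
  also have "\<dots> \<le> norm (x - y) * (2 * norm y + norm (x - y))"
    using norm_triangle_ineq3[of x y] norm_triangle_sub[of x y] by (intro mult_mono) auto
  finally show ?thesis .
qed

text \<open>\<open>b\<close> stands for an oscillating part that is controlled only through its
  partial sums. It occurs on the line Re s = 1; on either side of that line it is taken to be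
  0.\<close>

lemma diag_sum_log:
  assumes r: "\<And>n. n \<ge> 1 \<Longrightarrow> \<bar>(norm (dcoeff s \<sigma> n))\<^sup>2 - a / real n - b n\<bar> \<le> C * real n powr (- \<epsilon> - 1)"
    and \<epsilon>: "\<epsilon> > 0" and C: "C \<ge> 0" and b: "\<And>N. N \<ge> 1 \<Longrightarrow> \<bar>\<Sum>n=1..<N. b n\<bar> \<le> D"
  shows "\<exists>D. \<forall>N\<ge>1. \<bar>diag_sum s \<sigma> N - a * ln (real N)\<bar> \<le> D"
proof (intro exI allI impI)
  fix N :: nat assume N: "N \<ge> 1"
  have "diag_sum s \<sigma> N - a * harmonic_sum N - (\<Sum>n=1..<N. b n) = (\<Sum>n=1..<N. (norm (dcoeff s \<sigma> n))\<^sup>2 - a / real n - b n)"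
    by (simp add: diag_sum_def harmonic_sum_def sum_subtractf sum_distrib_left)
  also have "\<bar>\<dots>\<bar> \<le> (\<Sum>n=1..<N. C * real n powr (- \<epsilon> - 1))"
    by (intro order_trans[OF sum_abs] sum_mono r) auto
  also have "\<dots> = C * (\<Sum>j<N - 1. real (1 + j) powr (- \<epsilon> - 1))"
    unfolding sum_distrib_left
    by (rule sum.reindex_bij_witness[of _ "\<lambda>j. 1 + j" "\<lambda>n. n - 1"]) auto
  also have "\<dots> \<le> C * (\<Sum>j. real (1 + j) powr (- \<epsilon> - 1))"
    using C \<epsilon> by (intro mult_left_mono sum_le_suminf sum_powr_tail) auto
  finally have 1: "\<bar>diag_sum s \<sigma> N - a * harmonic_sum N - (\<Sum>n=1..<N. b n)\<bar> \<le> C * (\<Sum>j. real (1 + j) powr (- \<epsilon> - 1))" .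
  have "\<bar>a * harmonic_sum N - a * ln (real N)\<bar> = \<bar>a\<bar> * \<bar>harmonic_sum N - ln (real N)\<bar>"
    by (simp add: right_diff_distrib flip: abs_mult)
  also have "\<dots> \<le> \<bar>a\<bar> * 1"
    using harmonic_sum_bounds[OF N] by (intro mult_left_mono) auto
  finally have 2: "\<bar>a * harmonic_sum N - a * ln (real N)\<bar> \<le> \<bar>a\<bar>" by simp
  show "\<bar>diag_sum s \<sigma> N - a * ln (real N)\<bar> \<le> C * (\<Sum>j. real (1 + j) powr (- \<epsilon> - 1)) + \<bar>a\<bar> + D"
    using 1 2 b[OF N] by linarith
qed

text \<open>\<open>zeta_psum s n\<close> tends to \<open>riemann_zeta s\<close> with an error of
  order n powr (1 - Re s), so the squared coefficients are |zeta(s)|^2 / n up to a summable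
  error.\<close>

lemma diag_sum_right:
  assumes s: "Re s > 1"
  shows "\<exists>D. \<forall>N\<ge>1. \<bar>diag_sum s (1/2) N - (norm (riemann_zeta s))\<^sup>2 * ln (real N)\<bar> \<le> D"
proof -
  have s1: "s \<noteq> 1" using s by auto
  from zeta_psum_asymp[OF s1] obtain C where C: "C > 0" "\<And>n. n \<ge> 1 \<Longrightarrow>
    norm (zeta_psum s n - (riemann_zeta s + of_nat n powr (1 - s) / (1 - s))) \<le> C * real n powr (- Re s)" by metis
  define E where "E = 1 / norm (1 - s) + C"
  have E: "E > 0" using C by (simp add: E_def add_nonneg_pos)
  show ?thesis
  proof (rule diag_sum_log[where b = "\<lambda>_. 0" and D = 0 and \<epsilon> = "Re s - 1" and C = "E * (2 * norm (riemann_zeta s) + E)"])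
    fix n :: nat assume n: "n \<ge> 1"
    have "norm (zeta_psum s n - riemann_zeta s) \<le> norm (of_nat n powr (1 - s) / (1 - s)) + C * real n powr (- Re s)"
      using C(2)[OF n] norm_triangle_sub[of "zeta_psum s n - riemann_zeta s" "of_nat n powr (1 - s) / (1 - s)"]
      by (simp add: diff_diff_eq)
    also have "norm (of_nat n powr (1 - s) / (1 - s)) = 1 / norm (1 - s) * real n powr (1 - Re s)"
      using n by (simp add: norm_divide norm_of_nat_powr)
    also have "1 / norm (1 - s) * real n powr (1 - Re s) + C * real n powr (- Re s) \<le> 1 / norm (1 - s) * real n powr (1 - Re s) + C * real n powr (1 - Re s)"
      using C n by (intro add_left_mono mult_left_mono powr_mono) auto
    finally have d: "norm (zeta_psum s n - riemann_zeta s) \<le> E * real n powr (1 - Re s)"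
      by (simp add: E_def algebra_simps)
    have "real n powr (1 - Re s) \<le> real n powr 0" using s n by (intro powr_mono) auto
    then have "E * real n powr (1 - Re s) \<le> E * 1" using E n by (intro mult_left_mono) auto
    with d have d1: "norm (zeta_psum s n - riemann_zeta s) \<le> E" by simp
    have "\<bar>(norm (zeta_psum s n))\<^sup>2 - (norm (riemann_zeta s))\<^sup>2\<bar> \<le> norm (zeta_psum s n - riemann_zeta s) * (2 * norm (riemann_zeta s) + norm (zeta_psum s n - riemann_zeta s))"
      by (rule norm_square_diff_le)
    also have "\<dots> \<le> E * real n powr (1 - Re s) * (2 * norm (riemann_zeta s) + E)"
      using d d1 E by (intro mult_mono add_mono) auto
    finally have "\<bar>(norm (zeta_psum s n))\<^sup>2 - (norm (riemann_zeta s))\<^sup>2\<bar> * (1 / real n)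
        \<le> E * real n powr (1 - Re s) * (2 * norm (riemann_zeta s) + E) * (1 / real n)"
      by (intro mult_right_mono) auto
    also have "\<dots> = E * (2 * norm (riemann_zeta s) + E) * real n powr (- (Re s - 1) - 1)"
      using n by (simp add: powr_diff powr_minus_divide)
    also have "\<bar>(norm (zeta_psum s n))\<^sup>2 - (norm (riemann_zeta s))\<^sup>2\<bar> * (1 / real n)
        = \<bar>(norm (dcoeff s (1/2) n))\<^sup>2 - (norm (riemann_zeta s))\<^sup>2 / real n - 0\<bar>"
    proof -
      have "(norm (dcoeff s (1/2) n))\<^sup>2 = (norm (zeta_psum s n))\<^sup>2 * (1 / real n)"
        unfolding norm_dcoeff power_mult_distrib powr_square using n by (simp add: powr_minus_divide)
      then show ?thesis by (simp add: diff_divide_distrib[symmetric])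
    qed
    finally show "\<bar>(norm (dcoeff s (1/2) n))\<^sup>2 - (norm (riemann_zeta s))\<^sup>2 / real n - 0\<bar>
        \<le> E * (2 * norm (riemann_zeta s) + E) * real n powr (- (Re s - 1) - 1)" .
  qed (use s E in auto)
qed

lemma diag_sum_left:
  assumes s: "Re s < 1" and \<sigma>: "Re s + \<sigma> = 3/2"
  shows "\<exists>D. \<forall>N\<ge>1. \<bar>diag_sum s \<sigma> N - 1 / (norm (s - 1))\<^sup>2 * ln (real N)\<bar> \<le> D"
proof -
  have s1: "s \<noteq> 1" using s by auto
  from zeta_psum_asymp[OF s1] obtain C where C: "C > 0" "\<And>n. n \<ge> 1 \<Longrightarrow>
    norm (zeta_psum s n - (riemann_zeta s + of_nat n powr (1 - s) / (1 - s))) \<le> C * real n powr (- Re s)" by metis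
  \<comment> \<open>n powr \<open>\<mu>\<close> bounds both the constant zeta(s) and the error n
    powr (- Re s), and is smaller than the main term n powr (1 - Re s) by a positive power.\<close>
  define \<mu> where "\<mu> = max 0 (- Re s)"
  define E where "E = norm (riemann_zeta s) + C"
  define F where "F = 1 / norm (s - 1)"
  have E: "E > 0" using C by (simp add: E_def add_nonneg_pos)
  have F: "F \<ge> 0" by (simp add: F_def)
  have \<mu>: "\<mu> \<le> 1 - Re s" using s by (simp add: \<mu>_def)
  show ?thesis
  proof (rule diag_sum_log[where b = "\<lambda>_. 0" and D = 0 and \<epsilon> = "1 - Re s - \<mu>" and C = "E * (2 * F + E)"])
    fix n :: nat assume n: "n \<ge> 1"
    define y where "y = of_nat n powr (1 - s) / (1 - s)"
    have ny: "norm y = F * real n powr (1 - Re s)"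
      using n by (simp add: y_def F_def norm_divide norm_of_nat_powr norm_minus_commute)
    have n\<mu>: "1 \<le> real n powr \<mu>" using n by (intro ge_one_powr_ge_zero) (auto simp: \<mu>_def)
    have "norm (zeta_psum s n - y) \<le> norm (riemann_zeta s) + C * real n powr (- Re s)"
      using C(2)[OF n] norm_triangle_sub[of "zeta_psum s n - y" "riemann_zeta s"]
      by (simp add: y_def algebra_simps)
    also have "\<dots> \<le> norm (riemann_zeta s) * real n powr \<mu> + C * real n powr \<mu>"
      using C n mult_left_mono[OF n\<mu>, of "norm (riemann_zeta s)"]
      by (intro add_mono mult_left_mono powr_mono) (auto simp: \<mu>_def)
    finally have d: "norm (zeta_psum s n - y) \<le> E * real n powr \<mu>"
      by (simp add: E_def algebra_simps)
    have "E * real n powr \<mu> \<le> E * real n powr (1 - Re s)"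
      using E n \<mu> by (intro mult_left_mono powr_mono) auto
    with d have d1: "norm (zeta_psum s n - y) \<le> E * real n powr (1 - Re s)" by simp
    have "\<bar>(norm (zeta_psum s n))\<^sup>2 - (norm y)\<^sup>2\<bar> \<le> norm (zeta_psum s n - y) * (2 * norm y + norm (zeta_psum s n - y))"
      by (rule norm_square_diff_le)
    also have "\<dots> \<le> E * real n powr \<mu> * (2 * (F * real n powr (1 - Re s)) + E * real n powr (1 - Re s))"
      using d d1 E F unfolding ny by (intro mult_mono add_mono) auto
    also have "\<dots> = E * (2 * F + E) * (real n powr \<mu> * real n powr (1 - Re s))"
      by (simp add: algebra_simps)
    finally have "\<bar>(norm (zeta_psum s n))\<^sup>2 - (norm y)\<^sup>2\<bar> * real n powr (- 2 * \<sigma>)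
        \<le> E * (2 * F + E) * (real n powr \<mu> * real n powr (1 - Re s)) * real n powr (- 2 * \<sigma>)"
      by (intro mult_right_mono) auto
    also have "\<dots> = E * (2 * F + E) * real n powr (\<mu> + (1 - Re s) + - 2 * \<sigma>)"
      unfolding powr_add by simp
    also have "\<mu> + (1 - Re s) + - 2 * \<sigma> = - (1 - Re s - \<mu>) - 1"
    proof -
      have "\<sigma> = 3/2 - Re s" using \<sigma> by simp
      then show ?thesis by simp
    qed
    also have "\<bar>(norm (zeta_psum s n))\<^sup>2 - (norm y)\<^sup>2\<bar> * real n powr (- 2 * \<sigma>)
        = \<bar>(norm (dcoeff s \<sigma> n))\<^sup>2 - 1 / (norm (s - 1))\<^sup>2 / real n - 0\<bar>"
    proof -
      have ex: "2 * (1 - Re s) + - 2 * \<sigma> = - 1" using \<sigma> by simp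
      have e: "real n powr (2 * (1 - Re s)) * real n powr (- 2 * \<sigma>) = 1 / real n"
        unfolding powr_add[symmetric] ex using n by (simp add: powr_minus_divide)
      have "(norm y)\<^sup>2 * real n powr (- 2 * \<sigma>) = F\<^sup>2 * (real n powr (2 * (1 - Re s)) * real n powr (- 2 * \<sigma>))"
        unfolding ny power_mult_distrib powr_square by simp
      then have "(norm y)\<^sup>2 * real n powr (- 2 * \<sigma>) = 1 / (norm (s - 1))\<^sup>2 / real n"
        unfolding e by (simp add: F_def power_divide)
      moreover have "(norm (dcoeff s \<sigma> n))\<^sup>2 = (norm (zeta_psum s n))\<^sup>2 * real n powr (- 2 * \<sigma>)"
        unfolding norm_dcoeff power_mult_distrib powr_square by simp
      moreover have "\<bar>(norm (zeta_psum s n))\<^sup>2 - (norm y)\<^sup>2\<bar> * real n powr (- 2 * \<sigma>)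
          = \<bar>(norm (zeta_psum s n))\<^sup>2 * real n powr (- 2 * \<sigma>) - (norm y)\<^sup>2 * real n powr (- 2 * \<sigma>)\<bar>"
        by (simp add: abs_mult flip: left_diff_distrib)
      ultimately show ?thesis by simp
    qed
    finally show "\<bar>(norm (dcoeff s \<sigma> n))\<^sup>2 - 1 / (norm (s - 1))\<^sup>2 / real n - 0\<bar>
        \<le> E * (2 * F + E) * real n powr (- (1 - Re s - \<mu>) - 1)" .
  qed (use s E F in \<open>auto simp: \<mu>_def\<close>)
qed

text \<open>Here zeta(s) and n powr (1 - s) / (1 - s) both have modulus independent of n. Their
  mixed term, divided by n, is the real part of a multiple of n powr (-s), so its partial sums come
  from \<open>zeta_psum\<close>, which is bounded on this line.\<close>

lemma diag_sum_line:
  assumes s: "Re s = 1" "s \<noteq> 1"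
  shows "\<exists>D. \<forall>N\<ge>1. \<bar>diag_sum s (1/2) N - (1 / (norm (s - 1))\<^sup>2 + (norm (riemann_zeta s))\<^sup>2) * ln (real N)\<bar> \<le> D"
proof -
  let ?z = "riemann_zeta s"
  from zeta_psum_asymp[OF s(2)] obtain C where C: "C > 0" "\<And>n. n \<ge> 1 \<Longrightarrow>
    norm (zeta_psum s n - (?z + of_nat n powr (1 - s) / (1 - s))) \<le> C * real n powr (- Re s)" by metis
  from zeta_psum_bound[OF s(2)] obtain B where B: "B > 0" "\<And>n. n \<ge> 1 \<Longrightarrow> norm (zeta_psum s n) \<le> B * real n powr (max 0 (1 - Re s))"
    by metis
  define F where "F = 1 / norm (s - 1)"
  define G where "G = norm ?z + F"
  have F: "F \<ge> 0" and G: "G \<ge> 0" by (simp_all add: F_def G_def)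
  define b where "b n = 2 * Re (of_nat n powr (- s) / (1 - s) * cnj ?z)" for n :: nat
  show ?thesis
  proof (rule diag_sum_log[where b = b and \<epsilon> = 1 and C = "C * (2 * G + C)" and D = "2 * (B * F * norm ?z)"])
    fix n :: nat assume n: "n \<ge> 1"
    define y where "y = of_nat n powr (1 - s) / (1 - s)"
    have ny: "norm y = F"
      using n s by (simp add: y_def F_def norm_divide norm_of_nat_powr norm_minus_commute)
    have d: "norm (zeta_psum s n - (?z + y)) \<le> C / real n"
      using C(2)[OF n] s n by (simp add: y_def powr_minus_divide)
    have zy: "norm (?z + y) \<le> G"
      using norm_triangle_ineq[of ?z y] by (simp add: G_def ny)
    have "C / real n \<le> C / 1" using C n by (intro divide_left_mono) auto
    with d have d1: "norm (zeta_psum s n - (?z + y)) \<le> C" by simp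
    have "\<bar>(norm (zeta_psum s n))\<^sup>2 - (norm (?z + y))\<^sup>2\<bar> \<le> norm (zeta_psum s n - (?z + y)) * (2 * norm (?z + y) + norm (zeta_psum s n - (?z + y)))"
      by (rule norm_square_diff_le)
    also have "\<dots> \<le> C / real n * (2 * G + C)"
      using d d1 C zy by (intro mult_mono add_mono mult_left_mono) auto
    finally have "\<bar>(norm (zeta_psum s n))\<^sup>2 - (norm (?z + y))\<^sup>2\<bar> * (1 / real n) \<le> C / real n * (2 * G + C) * (1 / real n)"
      by (intro mult_right_mono) auto
    also have "\<dots> = C * (2 * G + C) * real n powr (- 1 - 1)"
    proof -
      have "real n powr (- 1 - 1) = 1 / (real n * real n)"
        unfolding powr_diff using n by (simp add: powr_minus_divide)
      then show ?thesis by simp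
    qed
    also have "\<bar>(norm (zeta_psum s n))\<^sup>2 - (norm (?z + y))\<^sup>2\<bar> * (1 / real n)
        = \<bar>(norm (dcoeff s (1/2) n))\<^sup>2 - (1 / (norm (s - 1))\<^sup>2 + (norm ?z)\<^sup>2) / real n - b n\<bar>"
    proof -
      have "(norm (dcoeff s (1/2) n))\<^sup>2 = (norm (zeta_psum s n))\<^sup>2 * (1 / real n)"
        unfolding norm_dcoeff power_mult_distrib powr_square using n by (simp add: powr_minus_divide)
      moreover have "(norm (?z + y))\<^sup>2 * (1 / real n) = (1 / (norm (s - 1))\<^sup>2 + (norm ?z)\<^sup>2) / real n + b n"
      proof -
        have "of_nat n powr (- s) = of_nat n powr (1 - s) / of_nat n"
          using powr_diff[of "of_nat n :: complex" "1 - s" 1] n by simp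
        then have "of_nat n powr (- s) / (1 - s) * cnj ?z = y * cnj ?z / of_nat n"
          by (simp add: y_def)
        then have bn: "b n = 2 * Re (y * cnj ?z) / real n"
          unfolding b_def by (simp only: Re_divide_of_nat times_divide_eq_right)
        have "(norm (?z + y))\<^sup>2 = (norm y)\<^sup>2 + 2 * Re (y * cnj ?z) + (norm ?z)\<^sup>2"
          using norm_add_square[of y ?z] by (simp only: add.commute)
        then show ?thesis
          unfolding bn ny by (simp add: F_def power_divide add_divide_distrib)
      qed
      moreover have "\<bar>(norm (zeta_psum s n))\<^sup>2 - (norm (?z + y))\<^sup>2\<bar> * (1 / real n)
          = \<bar>(norm (zeta_psum s n))\<^sup>2 * (1 / real n) - (norm (?z + y))\<^sup>2 * (1 / real n)\<bar>"
        by (simp add: abs_mult diff_divide_distrib[symmetric])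
      ultimately show ?thesis by (simp only: diff_diff_eq)
    qed
    finally show "\<bar>(norm (dcoeff s (1/2) n))\<^sup>2 - (1 / (norm (s - 1))\<^sup>2 + (norm ?z)\<^sup>2) / real n - b n\<bar>
        \<le> C * (2 * G + C) * real n powr (- 1 - 1)" .
  next
    fix N :: nat assume N: "N \<ge> 1"
    have "(\<Sum>n=1..<N. b n) = 2 * Re (zeta_psum s N / (1 - s) * cnj ?z)"
      by (simp only: b_def zeta_psum_def sum_divide_distrib sum_distrib_right sum_distrib_left Re_sum)
    also have "\<bar>\<dots>\<bar> \<le> 2 * norm (zeta_psum s N / (1 - s) * cnj ?z)"
      using abs_Re_le_cmod[of "zeta_psum s N / (1 - s) * cnj ?z"] by simp
    also have "\<dots> = 2 * (norm (zeta_psum s N) * F * norm ?z)"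
      by (simp add: norm_mult norm_divide F_def norm_minus_commute)
    also have "\<dots> \<le> 2 * (B * F * norm ?z)"
      using B(2)[OF N] s N F by (intro mult_left_mono mult_right_mono) auto
    finally show "\<bar>\<Sum>n=1..<N. b n\<bar> \<le> 2 * (B * F * norm ?z)" .
  qed (use C G in auto)
qed

text \<open>With h the harmonic sum, h^2 / n is a third of the increment of h^3 up to lower-order
  terms, so the sum telescopes to h^3 / 3.\<close>

lemma diag_sum_one:
  "\<exists>D. \<forall>N\<ge>1. \<bar>diag_sum 1 (1/2) N - ln (real N) ^ 3 / 3\<bar> \<le> D * (1 + ln (real N))\<^sup>2"
proof (intro exI allI impI)
  fix N :: nat assume N: "N \<ge> 1"
  have hs0: "harmonic_sum n \<ge> 0" for n unfolding harmonic_sum_def by (intro sum_nonneg) auto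
  have mono: "harmonic_sum n \<le> harmonic_sum N" if "n \<le> N" for n
    unfolding harmonic_sum_def using that by (intro sum_mono2) auto
  have "diag_sum 1 (1/2) N = (\<Sum>n=1..<N. (harmonic_sum n)\<^sup>2 / real n)"
    unfolding diag_sum_def
  proof (intro sum.cong refl)
    fix n assume "n \<in> {1..<N}"
    then show "(norm (dcoeff 1 (1/2) n))\<^sup>2 = (harmonic_sum n)\<^sup>2 / real n"
      unfolding norm_dcoeff power_mult_distrib powr_square by (simp add: zeta_psum_1 powr_minus_divide)
  qed
  moreover have "(harmonic_sum N) ^ 3 = (\<Sum>n=1..<N. 3 * (harmonic_sum n)\<^sup>2 / real n + (3 * harmonic_sum n / (real n)\<^sup>2 + 1 / real n ^ 3))"
    using N
  proof (induction N rule: dec_induct)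
    case (step n)
    have "(harmonic_sum (Suc n)) ^ 3 = (harmonic_sum n) ^ 3 + (3 * (harmonic_sum n)\<^sup>2 / real n + (3 * harmonic_sum n / (real n)\<^sup>2 + 1 / real n ^ 3))"
      using step(1) by (simp add: harmonic_sum_Suc power3_eq_cube power2_eq_square field_simps)
    with step show ?case by simp
  qed (simp add: harmonic_sum_def)
  moreover have "\<dots> = 3 * (\<Sum>n=1..<N. (harmonic_sum n)\<^sup>2 / real n) + (\<Sum>n=1..<N. 3 * harmonic_sum n / (real n)\<^sup>2 + 1 / real n ^ 3)"
    by (simp add: sum.distrib sum_distrib_left)
  ultimately have eq: "diag_sum 1 (1/2) N = (harmonic_sum N) ^ 3 / 3 - (\<Sum>n=1..<N. 3 * harmonic_sum n / (real n)\<^sup>2 + 1 / real n ^ 3) / 3"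
    by (simp add: add_divide_distrib)
  define l where "l = ln (real N)"
  have l: "l \<ge> 0" "l \<le> harmonic_sum N" "harmonic_sum N \<le> 1 + l" using harmonic_sum_bounds[OF N] N by (auto simp: l_def)
  have "(\<Sum>n=1..<N. 3 * harmonic_sum n / (real n)\<^sup>2 + 1 / real n ^ 3) \<le> (\<Sum>n=1..<N. (3 * harmonic_sum N + 1) * (1 / (real n)\<^sup>2))"
  proof (rule sum_mono)
    fix n assume n: "n \<in> {1..<N}"
    have "3 * harmonic_sum n / (real n)\<^sup>2 \<le> 3 * harmonic_sum N / (real n)\<^sup>2"
      using mono[of n] n by (intro divide_right_mono) auto
    moreover have "1 / real n ^ 3 \<le> 1 / (real n)\<^sup>2"
      using n by (intro divide_left_mono power_increasing) auto
    ultimately show "3 * harmonic_sum n / (real n)\<^sup>2 + 1 / real n ^ 3 \<le> (3 * harmonic_sum N + 1) * (1 / (real n)\<^sup>2)"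
      by (simp add: add_divide_distrib)
  qed
  also have "\<dots> = (3 * harmonic_sum N + 1) * (\<Sum>n=1..<N. 1 / (real n)\<^sup>2)" by (simp add: sum_distrib_left)
  also have "\<dots> \<le> (3 * harmonic_sum N + 1) * 2"
  proof (intro mult_left_mono)
    have "(\<Sum>n=1..<N. 1 / (real n)\<^sup>2) \<le> (\<Sum>n=1..N. 1 / (real n)\<^sup>2)" by (intro sum_mono2) auto
    also have "\<dots> \<le> 2 - 1 / real N" by (rule sum_inverse_squares_le[OF N])
    also have "\<dots> \<le> 2" by simp
    finally show "(\<Sum>n=1..<N. 1 / (real n)\<^sup>2) \<le> 2" .
  qed (use hs0[of N] in auto)
  also have "\<dots> \<le> 6 * (1 + l) + 2" using l(3) by simp
  finally have up: "(\<Sum>n=1..<N. 3 * harmonic_sum n / (real n)\<^sup>2 + 1 / real n ^ 3) \<le> 6 * (1 + l) + 2" .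
  have low: "0 \<le> (\<Sum>n=1..<N. 3 * harmonic_sum n / (real n)\<^sup>2 + 1 / real n ^ 3)"
    using hs0 by (intro sum_nonneg add_nonneg_nonneg divide_nonneg_nonneg) auto
  have cube1: "l ^ 3 \<le> (harmonic_sum N) ^ 3" using l by (intro power_mono) auto
  have cube2: "(harmonic_sum N) ^ 3 \<le> l ^ 3 + 3 * (1 + l)\<^sup>2"
  proof -
    have "(harmonic_sum N) ^ 3 \<le> (1 + l) ^ 3" using l hs0 by (intro power_mono) auto
    also have "\<dots> \<le> l ^ 3 + 3 * (1 + l)\<^sup>2"
      using l by (simp add: power3_eq_cube power2_eq_square algebra_simps)
    finally show ?thesis .
  qed
  define q where "q = (1 + l)\<^sup>2"
  define S where "S = (\<Sum>n=1..<N. 3 * harmonic_sum n / (real n)\<^sup>2 + 1 / real n ^ 3)"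
  have q: "1 + l \<le> q" "1 \<le> q"
    using l by (auto simp: q_def power2_eq_square algebra_simps)
  have "6 * (1 + l) + 2 \<le> 6 * q + 2 * q" using q by (intro add_mono) auto
  then have S: "0 \<le> S" "S \<le> 8 * q" using up low unfolding S_def by simp_all
  \<comment> \<open>\<open>cube2\<close> gives 3 q from above and S gives 8 q from below; 15 exceeds
    both and is divisible by 3.\<close>
  have "(harmonic_sum N) ^ 3 - S - l ^ 3 \<le> 15 * q"
    using cube2 S(1) q by (fold q_def) simp
  moreover have "- ((harmonic_sum N) ^ 3 - S - l ^ 3) \<le> 15 * q"
    using cube1 S(2) q by simp
  ultimately have "\<bar>(harmonic_sum N) ^ 3 - S - l ^ 3\<bar> \<le> 15 * q"
    by (rule abs_leI)
  then have "\<bar>((harmonic_sum N) ^ 3 - S - l ^ 3) / 3\<bar> \<le> 5 * q"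
    by simp
  then show "\<bar>diag_sum 1 (1/2) N - ln (real N) ^ 3 / 3\<bar> \<le> 5 * (1 + ln (real N))\<^sup>2"
    unfolding eq l_def[symmetric] S_def[symmetric] q_def[symmetric] by (simp add: diff_divide_distrib)
qed

section \<open>Assembling the cases\<close>

lemma eq_up_to_OI:
  assumes "\<And>T. T \<ge> 2 \<Longrightarrow> \<bar>f T - g T\<bar> \<le> C * h T"
  shows "eq_up_to_O f g h"
  unfolding eq_up_to_O_def
proof (rule bigoI[where c = "\<bar>C\<bar>"])
  have "norm (f T - g T) \<le> \<bar>C\<bar> * norm (h T)" if "T \<ge> 2" for T
    using assms[OF that] abs_ge_self[of "C * h T"] by (simp add: abs_mult)
  then show "\<forall>\<^sub>F T in principal {2..}. norm (f T - g T) \<le> \<bar>C\<bar> * norm (h T)"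
    by (auto simp: eventually_principal)
qed

text \<open>Together the two conditions say that max 0 (1 - Re s) + 1 - \<sigma> is below 1/2, the
  hypothesis of \<open>dcoeff_tail\<close>.\<close>

lemma zeta2_sq_term_summable_on:
  assumes "Re s + \<sigma> > 3/2" "\<sigma> > 1/2"
  shows "zeta2_sq_term s (2 * \<sigma>) summable_on {2..}"
proof (cases "s = 1")
  case True
  show ?thesis
  proof (rule dcoeff_tail[of s 1 0 1 "0 + 1 - \<sigma>" \<sigma>])
    show "norm (zeta_psum s n) \<le> 1 * real n powr 0 * (1 + ln (real n)) ^ 1" if "n \<ge> 1" for n
      using zeta_psum_1_bound[OF that] that by (simp add: True)
    show "0 + 1 - \<sigma> < 1 / 2" using assms by simp
    show ?thesis if "summable (\<lambda>n. (norm (dcoeff s \<sigma> n))\<^sup>2)"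
      by (rule zeta2_sq_summable[OF that])
  qed auto
next
  case False
  from zeta_psum_bound[OF this] obtain B where B: "B > 0" "\<And>n. n \<ge> 1 \<Longrightarrow> norm (zeta_psum s n) \<le> B * real n powr (max 0 (1 - Re s))"
    by metis
  show ?thesis
  proof (rule dcoeff_tail[of s B "max 0 (1 - Re s)" 0 "max 0 (1 - Re s) + 1 - \<sigma>" \<sigma>])
    show "max 0 (1 - Re s) + 1 - \<sigma> < 1 / 2" using assms by (auto simp: max_def)
    show "norm (zeta_psum s n) \<le> B * real n powr max 0 (1 - Re s) * (1 + ln (real n)) ^ 0" if "n \<ge> 1" for n
      using B(2)[OF that] by simp
    show ?thesis if "summable (\<lambda>n. (norm (dcoeff s \<sigma> n))\<^sup>2)"
      by (rule zeta2_sq_summable[OF that])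
  qed (use B(1) in auto)
qed

text \<open>ln (2^L) differs from ln T by a bounded amount, so evaluating the diagonal sum at 2^L
  instead of T costs O(T).\<close>

lemma mean_square_log:
  assumes \<sigma>: "\<sigma>2 \<ge> 1/2" "Re s1 + \<sigma>2 \<ge> 3/2"
    and ns: "\<And>t. t \<ge> 2 \<Longrightarrow> (s1, Complex \<sigma>2 t) \<notin> euler_double_zeta_singularities"
    and s1: "s1 \<noteq> 1" and \<kappa>: "max 0 (1 - Re s1) + 1 - \<sigma>2 = 1/2"
    and diag: "\<exists>D. \<forall>N\<ge>1. \<bar>diag_sum s1 \<sigma>2 N - a * ln (real N)\<bar> \<le> D"
  shows "eq_up_to_O (mean_square s1 \<sigma>2) (\<lambda>T. a * T * ln T) (\<lambda>T. T)"
proof -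
  from zeta_psum_bound[OF s1] obtain B where B: "B > 0" "\<And>n. n \<ge> 1 \<Longrightarrow> norm (zeta_psum s1 n) \<le> B * real n powr (max 0 (1 - Re s1))"
    by metis
  have "\<exists>C c. c > 0 \<and> (\<forall>T\<ge>2. \<exists>L. real L + 2 \<le> c * ln T \<and> \<bar>real L * ln 2 - ln T\<bar> \<le> c \<and>
       \<bar>mean_square s1 \<sigma>2 T - T * diag_sum s1 \<sigma>2 (2 ^ L)\<bar> \<le> C * (T * ln T ^ (2 * 0)))"
  proof (rule mean_square_critical[OF \<sigma> ns])
    show "norm (zeta_psum s1 n) \<le> B * real n powr max 0 (1 - Re s1) * (1 + ln (real n)) ^ 0" if "n \<ge> 1" for n
      using B(2)[OF that] by simp
  qed (use B \<kappa> in auto)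
  then obtain C c where full: "\<forall>T\<ge>2. \<exists>L. real L + 2 \<le> c * ln T \<and> \<bar>real L * ln 2 - ln T\<bar> \<le> c \<and>
       \<bar>mean_square s1 \<sigma>2 T - T * diag_sum s1 \<sigma>2 (2 ^ L)\<bar> \<le> C * (T * ln T ^ (2 * 0))"
    by blast
  have main: "\<exists>L. \<bar>real L * ln 2 - ln T\<bar> \<le> c \<and>
       \<bar>mean_square s1 \<sigma>2 T - T * diag_sum s1 \<sigma>2 (2 ^ L)\<bar> \<le> C * T" if "T \<ge> 2" for T
    using full[rule_format, OF that] by auto
  from diag obtain D where D: "\<And>N. N \<ge> 1 \<Longrightarrow> \<bar>diag_sum s1 \<sigma>2 N - a * ln (real N)\<bar> \<le> D" by blast
  show ?thesis
  proof (rule eq_up_to_OI)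
    fix T :: real assume T: "T \<ge> 2"
    from main[OF T] obtain L where L: "\<bar>real L * ln 2 - ln T\<bar> \<le> c"
      "\<bar>mean_square s1 \<sigma>2 T - T * diag_sum s1 \<sigma>2 (2 ^ L)\<bar> \<le> C * T" by blast
    have "\<bar>diag_sum s1 \<sigma>2 (2 ^ L) - a * (real L * ln 2)\<bar> \<le> D"
      using D[of "2 ^ L"] by (simp add: ln_realpow)
    moreover have "\<bar>a * (real L * ln 2) - a * ln T\<bar> \<le> \<bar>a\<bar> * c"
      using mult_left_mono[OF L(1), of "\<bar>a\<bar>"] by (simp add: right_diff_distrib flip: abs_mult)
    ultimately have "\<bar>diag_sum s1 \<sigma>2 (2 ^ L) - a * ln T\<bar> \<le> D + \<bar>a\<bar> * c" by linarith
    then have "\<bar>T * (diag_sum s1 \<sigma>2 (2 ^ L) - a * ln T)\<bar> \<le> T * (D + \<bar>a\<bar> * c)"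
      using T unfolding abs_mult by (intro mult_mono) auto
    moreover have "mean_square s1 \<sigma>2 T - a * T * ln T = (mean_square s1 \<sigma>2 T - T * diag_sum s1 \<sigma>2 (2 ^ L)) + T * (diag_sum s1 \<sigma>2 (2 ^ L) - a * ln T)"
      by (simp add: algebra_simps)
    ultimately have "\<bar>mean_square s1 \<sigma>2 T - a * T * ln T\<bar> \<le> C * T + T * (D + \<bar>a\<bar> * c)"
      using L(2) by linarith
    then show "\<bar>mean_square s1 \<sigma>2 T - a * T * ln T\<bar> \<le> (C + (D + \<bar>a\<bar> * c)) * T"
      by (simp add: algebra_simps)
  qed
qed

text \<open>Replacing L ln 2 by ln T inside the cube costs the bounded difference times the square
  of a logarithm, which the error term admits.\<close>

lemma mean_square_log_cube:
  assumes ns: "\<And>t. t \<ge> 2 \<Longrightarrow> (1, Complex (1/2) t) \<notin> euler_double_zeta_singularities"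
  shows "eq_up_to_O (mean_square 1 (1/2)) (\<lambda>T. T * (ln T) ^ 3 / 3) (\<lambda>T. T * (ln T)\<^sup>2)"
proof -
  have "\<exists>C c. c > 0 \<and> (\<forall>T\<ge>2. \<exists>L. real L + 2 \<le> c * ln T \<and> \<bar>real L * ln 2 - ln T\<bar> \<le> c \<and>
       \<bar>mean_square 1 (1/2) T - T * diag_sum 1 (1/2) (2 ^ L)\<bar> \<le> C * (T * ln T ^ (2 * 1)))"
  proof (rule mean_square_critical[OF _ _ ns])
    show "norm (zeta_psum 1 n) \<le> 1 * real n powr 0 * (1 + ln (real n)) ^ 1" if "n \<ge> 1" for n
      using zeta_psum_1_bound[OF that] that by simp
  qed auto
  then obtain C c where c: "c > 0" and main: "\<And>T. T \<ge> 2 \<Longrightarrow> \<exists>L. real L + 2 \<le> c * ln T \<and> \<bar>real L * ln 2 - ln T\<bar> \<le> c \<and>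
       \<bar>mean_square 1 (1/2) T - T * diag_sum 1 (1/2) (2 ^ L)\<bar> \<le> C * (T * (ln T)\<^sup>2)"
    unfolding mult_1_right by blast
  from diag_sum_one obtain D where D: "\<And>N. N \<ge> 1 \<Longrightarrow> \<bar>diag_sum 1 (1/2) N - ln (real N) ^ 3 / 3\<bar> \<le> D * (1 + ln (real N))\<^sup>2"
    by blast
  \<comment> \<open>From y <= c l one gets y^2 + y l + l^2 <= (c^2 + c + 1) l^2, the quadratic
    factor of y^3 - l^3.\<close>
  define b where "b = c\<^sup>2 + c + 1"
  show ?thesis
  proof (rule eq_up_to_OI)
    fix T :: real assume T: "T \<ge> 2"
    from main[OF T] obtain L where L: "real L + 2 \<le> c * ln T" "\<bar>real L * ln 2 - ln T\<bar> \<le> c"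
      "\<bar>mean_square 1 (1/2) T - T * diag_sum 1 (1/2) (2 ^ L)\<bar> \<le> C * (T * (ln T)\<^sup>2)" by blast
    define y l where "y = real L * ln 2" and "l = ln T"
    have l: "l \<ge> 0" using T by (simp add: l_def)
    have "real L * ln 2 \<le> real L * 1" using ln_2_less_1 by (intro mult_left_mono) auto
    then have y: "0 \<le> y" "1 + y \<le> c * l" using L(1) by (simp_all add: y_def l_def)
    have "\<bar>diag_sum 1 (1/2) (2 ^ L) - y ^ 3 / 3\<bar> \<le> D * (1 + y)\<^sup>2"
      using D[of "2 ^ L"] by (simp add: ln_realpow y_def)
    also have "\<dots> \<le> \<bar>D\<bar> * (c * l)\<^sup>2"
      using y by (intro mult_mono power_mono) auto
    finally have 1: "\<bar>diag_sum 1 (1/2) (2 ^ L) - y ^ 3 / 3\<bar> \<le> \<bar>D\<bar> * c\<^sup>2 * l\<^sup>2"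
      by (simp add: power_mult_distrib mult_ac)
    have 2: "\<bar>y ^ 3 / 3 - l ^ 3 / 3\<bar> \<le> c * b * l\<^sup>2"
    proof -
      have yc: "y \<le> c * l" using y by simp
      have "y\<^sup>2 + y * l + l\<^sup>2 \<le> (c * l)\<^sup>2 + (c * l) * l + l\<^sup>2"
        using y yc l by (intro add_mono mult_right_mono power_mono) auto
      also have "\<dots> = b * l\<^sup>2" by (simp add: b_def power2_eq_square algebra_simps)
      finally have q: "y\<^sup>2 + y * l + l\<^sup>2 \<le> b * l\<^sup>2" .
      have cube: "y ^ 3 / 3 - l ^ 3 / 3 = (y - l) * (y\<^sup>2 + y * l + l\<^sup>2) / 3"
        by (simp add: power2_eq_square power3_eq_cube algebra_simps diff_divide_distrib add_divide_distrib)
      have "\<bar>y ^ 3 / 3 - l ^ 3 / 3\<bar> = \<bar>y - l\<bar> * \<bar>y\<^sup>2 + y * l + l\<^sup>2\<bar> / 3"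
        unfolding cube abs_divide abs_mult by simp
      also have "\<dots> \<le> \<bar>y - l\<bar> * \<bar>y\<^sup>2 + y * l + l\<^sup>2\<bar>" by simp
      also have "\<bar>y\<^sup>2 + y * l + l\<^sup>2\<bar> = y\<^sup>2 + y * l + l\<^sup>2" using y l by simp
      also have "\<bar>y - l\<bar> * (y\<^sup>2 + y * l + l\<^sup>2) \<le> c * (b * l\<^sup>2)"
        using L(2) q y l c unfolding y_def[symmetric] l_def[symmetric] by (intro mult_mono) auto
      finally show ?thesis by simp
    qed
    have "\<bar>diag_sum 1 (1/2) (2 ^ L) - l ^ 3 / 3\<bar> \<le> (\<bar>D\<bar> * c\<^sup>2 + c * b) * l\<^sup>2"
      using 1 2 unfolding distrib_right by linarith
    then have "\<bar>T * (diag_sum 1 (1/2) (2 ^ L) - l ^ 3 / 3)\<bar> \<le> T * ((\<bar>D\<bar> * c\<^sup>2 + c * b) * l\<^sup>2)"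
      using T unfolding abs_mult by (intro mult_mono) auto
    moreover have "mean_square 1 (1/2) T - T * l ^ 3 / 3 = (mean_square 1 (1/2) T - T * diag_sum 1 (1/2) (2 ^ L)) + T * (diag_sum 1 (1/2) (2 ^ L) - l ^ 3 / 3)"
      by (simp add: algebra_simps)
    ultimately have "\<bar>mean_square 1 (1/2) T - T * l ^ 3 / 3\<bar> \<le> C * (T * l\<^sup>2) + T * ((\<bar>D\<bar> * c\<^sup>2 + c * b) * l\<^sup>2)"
      using L(3) unfolding l_def by linarith
    then show "\<bar>mean_square 1 (1/2) T - T * ln T ^ 3 / 3\<bar> \<le> (C + (\<bar>D\<bar> * c\<^sup>2 + c * b)) * (T * (ln T)\<^sup>2)"
      by (simp add: l_def algebra_simps)
  qed
qed

text \<open>\<open>mean_square_kappa_neg\<close> works without logarithms, so at s1 = 1 the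
  logarithm is traded for n powr \<eta>, with \<eta> small enough to keep \<eta> + 1 - \<sigma>2
  negative.\<close>

lemma mean_square_absolute:
  assumes \<sigma>: "\<sigma>2 > 1" "Re s1 + \<sigma>2 > 2"
    and ns: "\<And>t. t \<ge> 2 \<Longrightarrow> (s1, Complex \<sigma>2 t) \<notin> euler_double_zeta_singularities"
  shows "eq_up_to_O (mean_square s1 \<sigma>2) (\<lambda>T. zeta2_sq s1 (2 * \<sigma>2) * T) (\<lambda>T. 1)"
proof -
  obtain B \<beta> where B: "B > 0" "1 - Re s1 \<le> \<beta>" "\<beta> + 1 - \<sigma>2 < 0"
    "\<And>n. n \<ge> 1 \<Longrightarrow> norm (zeta_psum s1 n) \<le> B * real n powr \<beta> * (1 + ln (real n)) ^ 0"
  proof (cases "s1 = 1")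
    case True
    define \<eta> where "\<eta> = min ((\<sigma>2 - 1) / 2) 1"
    have \<eta>: "\<eta> > 0" "\<eta> \<le> 1" using \<sigma> by (auto simp: \<eta>_def)
    have \<eta>': "\<eta> \<le> (\<sigma>2 - 1) / 2" unfolding \<eta>_def by (rule min.cobounded1)
    show ?thesis
    proof (rule that[of "1 / \<eta>" \<eta>])
      fix n :: nat assume n: "n \<ge> 1"
      have "1 + ln (real n) \<le> real n powr \<eta> / \<eta>" using \<eta> n by (intro one_plus_ln_le_powr) auto
      then show "norm (zeta_psum s1 n) \<le> 1 / \<eta> * real n powr \<eta> * (1 + ln (real n)) ^ 0"
        using zeta_psum_1_bound[OF n] by (simp add: True)
    qed (use \<eta> \<eta>' \<sigma> True in auto)
  next
    case False
    from zeta_psum_bound[OF this] obtain B where "B > 0" "\<And>n. n \<ge> 1 \<Longrightarrow> norm (zeta_psum s1 n) \<le> B * real n powr (max 0 (1 - Re s1))"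
      by metis
    with \<sigma> show ?thesis by (intro that[of B "max 0 (1 - Re s1)"]) auto
  qed
  have "\<exists>C. \<forall>T\<ge>2. \<bar>mean_square s1 \<sigma>2 T - zeta2_sq s1 (2 * \<sigma>2) * T\<bar> \<le> C"
    by (rule mean_square_kappa_neg[OF _ _ ns B(4,1) _ B(2) refl B(3)]) (use \<sigma> in auto)
  then obtain C where "\<And>T. T \<ge> 2 \<Longrightarrow> \<bar>mean_square s1 \<sigma>2 T - zeta2_sq s1 (2 * \<sigma>2) * T\<bar> \<le> C" by blast
  then show ?thesis by (intro eq_up_to_OI[where C = C]) auto
qed

text \<open>\<open>e\<close> records the logarithm in \<open>zeta_psum\<close> at s1 = 1. The
  exponent \<open>\<kappa>\<close> is 1 - \<sigma>2 for Re s1 >= 1 and 2 - Re s1 - \<sigma>2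
  otherwise, which covers all error terms of the convergent cases outside absolute
  convergence.\<close>

lemma mean_square_strip:
  assumes \<sigma>: "\<sigma>2 \<ge> 1/2" "Re s1 + \<sigma>2 \<ge> 3/2"
    and ns: "\<And>t. t \<ge> 2 \<Longrightarrow> (s1, Complex \<sigma>2 t) \<notin> euler_double_zeta_singularities"
    and e: "s1 = 1 \<and> e = 1 \<or> s1 \<noteq> 1 \<and> e = 0"
    and \<kappa>: "\<kappa> = max 0 (1 - Re s1) + 1 - \<sigma>2" "0 \<le> \<kappa>" "\<kappa> < 1/2"
  shows "\<kappa> \<noteq> 0 \<Longrightarrow> eq_up_to_O (mean_square s1 \<sigma>2) (\<lambda>T. zeta2_sq s1 (2 * \<sigma>2) * T) (\<lambda>T. T powr (2 * \<kappa>) * ln T ^ (2 * e))"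
    and "\<kappa> = 0 \<Longrightarrow> eq_up_to_O (mean_square s1 \<sigma>2) (\<lambda>T. zeta2_sq s1 (2 * \<sigma>2) * T) (\<lambda>T. ln T ^ (2 + 2 * e))"
proof -
  obtain B where B: "B > 0"
    "\<And>n. n \<ge> 1 \<Longrightarrow> norm (zeta_psum s1 n) \<le> B * real n powr (max 0 (1 - Re s1)) * (1 + ln (real n)) ^ e"
  proof (cases "s1 = 1")
    case True
    show ?thesis
      by (rule that[of 1]) (use e True zeta_psum_1_bound in auto)
  next
    case False
    from zeta_psum_bound[OF this] obtain B where "B > 0" "\<And>n. n \<ge> 1 \<Longrightarrow> norm (zeta_psum s1 n) \<le> B * real n powr (max 0 (1 - Re s1))"
      by metis
    with e False show ?thesis by (intro that[of B]) auto
  qed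
  have e1: "e \<le> 1" using e by auto
  have m: "1 - Re s1 \<le> max 0 (1 - Re s1)" by simp
  show "eq_up_to_O (mean_square s1 \<sigma>2) (\<lambda>T. zeta2_sq s1 (2 * \<sigma>2) * T) (\<lambda>T. T powr (2 * \<kappa>) * ln T ^ (2 * e))" if "\<kappa> \<noteq> 0"
  proof -
    have "\<exists>C. \<forall>T\<ge>2. \<bar>mean_square s1 \<sigma>2 T - zeta2_sq s1 (2 * \<sigma>2) * T\<bar> \<le> C * (T powr (2 * \<kappa>) * ln T ^ (2 * e))"
      by (rule mean_square_kappa_pos[OF \<sigma> ns B(2,1) e1 m \<kappa>(1) _ \<kappa>(3)]) (use that \<kappa>(2) in auto)
    then show ?thesis by (meson eq_up_to_OI)
  qed
  show "eq_up_to_O (mean_square s1 \<sigma>2) (\<lambda>T. zeta2_sq s1 (2 * \<sigma>2) * T) (\<lambda>T. ln T ^ (2 + 2 * e))" if "\<kappa> = 0"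
  proof -
    have "\<exists>C. \<forall>T\<ge>2. \<bar>mean_square s1 \<sigma>2 T - zeta2_sq s1 (2 * \<sigma>2) * T\<bar> \<le> C * ln T ^ (2 + 2 * e)"
      by (rule mean_square_kappa_zero[OF \<sigma> ns B(2,1) e1 m \<kappa>(1) that])
    then show ?thesis by (meson eq_up_to_OI)
  qed
qed

theorem theorem1p2:
  fixes s1 :: complex and \<sigma>1 \<sigma>2 :: real
  assumes "\<sigma>1 = Re s1"
  shows
    "(\<sigma>1 + \<sigma>2 > 3/2 \<and> \<sigma>2 > 1/2 \<longrightarrow> zeta2_sq_term s1 (2 * \<sigma>2) summable_on {2..}) \<and>
     ((\<forall>t2\<ge>2. (s1, Complex \<sigma>2 t2) \<notin> euler_double_zeta_singularities) \<longrightarrow>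
       (\<sigma>2 > 1 \<and> \<sigma>1 + \<sigma>2 > 2 \<longrightarrow>
          eq_up_to_O (mean_square s1 \<sigma>2) (\<lambda>T. zeta2_sq s1 (2 * \<sigma>2) * T) (\<lambda>T. 1)) \<and>
       (\<sigma>1 > 1 \<and> 1/2 < \<sigma>2 \<and> \<sigma>2 \<le> 1 \<longrightarrow>
          (\<sigma>2 \<noteq> 1 \<longrightarrow> eq_up_to_O (mean_square s1 \<sigma>2) (\<lambda>T. zeta2_sq s1 (2 * \<sigma>2) * T)
                        (\<lambda>T. T powr (2 - 2 * \<sigma>2))) \<and>
          (\<sigma>2 = 1 \<longrightarrow> eq_up_to_O (mean_square s1 \<sigma>2) (\<lambda>T. zeta2_sq s1 (2 * \<sigma>2) * T)
                        (\<lambda>T. (ln T)\<^sup>2))) \<and>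
       (\<sigma>1 \<le> 1 \<and> 3/2 < \<sigma>1 + \<sigma>2 \<and> \<sigma>1 + \<sigma>2 \<le> 2 \<and> s1 \<noteq> 1 \<longrightarrow>
          (\<sigma>1 + \<sigma>2 \<noteq> 2 \<longrightarrow> eq_up_to_O (mean_square s1 \<sigma>2) (\<lambda>T. zeta2_sq s1 (2 * \<sigma>2) * T)
                        (\<lambda>T. T powr (4 - 2 * \<sigma>1 - 2 * \<sigma>2))) \<and>
          (\<sigma>1 + \<sigma>2 = 2 \<longrightarrow> eq_up_to_O (mean_square s1 \<sigma>2) (\<lambda>T. zeta2_sq s1 (2 * \<sigma>2) * T)
                        (\<lambda>T. (ln T)\<^sup>2))) \<and>
       (s1 = 1 \<and> 1/2 < \<sigma>2 \<and> \<sigma>2 \<le> 1 \<longrightarrow>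
          (\<sigma>2 \<noteq> 1 \<longrightarrow> eq_up_to_O (mean_square s1 \<sigma>2) (\<lambda>T. zeta2_sq s1 (2 * \<sigma>2) * T)
                        (\<lambda>T. T powr (2 - 2 * \<sigma>2) * (ln T)\<^sup>2)) \<and>
          (\<sigma>2 = 1 \<longrightarrow> eq_up_to_O (mean_square s1 \<sigma>2) (\<lambda>T. zeta2_sq s1 (2 * \<sigma>2) * T)
                        (\<lambda>T. (ln T) ^ 4))) \<and>
       (\<sigma>1 > 1 \<and> \<sigma>2 = 1/2 \<longrightarrow>
          eq_up_to_O (mean_square s1 \<sigma>2) (\<lambda>T. (cmod (riemann_zeta s1))\<^sup>2 * T * ln T) (\<lambda>T. T)) \<and>
       (\<sigma>1 + \<sigma>2 = 3/2 \<and> \<sigma>2 > 1/2 \<longrightarrow>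
          eq_up_to_O (mean_square s1 \<sigma>2) (\<lambda>T. 1 / (cmod (s1 - 1))\<^sup>2 * T * ln T) (\<lambda>T. T)) \<and>
       (\<sigma>2 = 1/2 \<and> \<sigma>1 = 1 \<and> s1 \<noteq> 1 \<longrightarrow>
          eq_up_to_O (mean_square s1 \<sigma>2)
            (\<lambda>T. (1 / (cmod (s1 - 1))\<^sup>2 + (cmod (riemann_zeta s1))\<^sup>2) * T * ln T) (\<lambda>T. T)) \<and>
       (\<sigma>2 = 1/2 \<and> s1 = 1 \<longrightarrow>
          eq_up_to_O (mean_square s1 \<sigma>2) (\<lambda>T. T * (ln T) ^ 3 / 3) (\<lambda>T. T * (ln T)\<^sup>2)))"
proof (intro conjI impI)
  let ?ns = "\<forall>t2\<ge>2. (s1, Complex \<sigma>2 t2) \<notin> euler_double_zeta_singularities"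
  let ?Z = "\<lambda>T. zeta2_sq s1 (2 * \<sigma>2) * T"
  note \<sigma>1 = \<open>\<sigma>1 = Re s1\<close>
  show "zeta2_sq_term s1 (2 * \<sigma>2) summable_on {2..}" if "\<sigma>1 + \<sigma>2 > 3/2 \<and> \<sigma>2 > 1/2"
    using that by (intro zeta2_sq_term_summable_on) (auto simp: \<sigma>1)
  assume ns: ?ns
  then have ns': "(s1, Complex \<sigma>2 t) \<notin> euler_double_zeta_singularities" if "t \<ge> 2" for t
    using that by blast
  show "eq_up_to_O (mean_square s1 \<sigma>2) ?Z (\<lambda>T. 1)" if "\<sigma>2 > 1 \<and> \<sigma>1 + \<sigma>2 > 2"
    using that by (intro mean_square_absolute ns') (auto simp: \<sigma>1)
  show "eq_up_to_O (mean_square s1 \<sigma>2) ?Z (\<lambda>T. T powr (2 - 2 * \<sigma>2))"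
    if "\<sigma>1 > 1 \<and> 1/2 < \<sigma>2 \<and> \<sigma>2 \<le> 1" "\<sigma>2 \<noteq> 1"
  proof -
    have "s1 \<noteq> 1" using that(1) by (auto simp: \<sigma>1)
    then show ?thesis
      using mean_square_strip(1)[of \<sigma>2 s1 0 "1 - \<sigma>2"] that ns' by (simp add: \<sigma>1 right_diff_distrib)
  qed
  show "eq_up_to_O (mean_square s1 \<sigma>2) ?Z (\<lambda>T. (ln T)\<^sup>2)"
    if "\<sigma>1 > 1 \<and> 1/2 < \<sigma>2 \<and> \<sigma>2 \<le> 1" "\<sigma>2 = 1"
  proof -
    have "s1 \<noteq> 1" using that(1) by (auto simp: \<sigma>1)
    then show ?thesis
      using mean_square_strip(2)[of \<sigma>2 s1 0 "1 - \<sigma>2"] that ns' by (simp add: \<sigma>1 right_diff_distrib)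
  qed
  show "eq_up_to_O (mean_square s1 \<sigma>2) ?Z (\<lambda>T. T powr (4 - 2 * \<sigma>1 - 2 * \<sigma>2))"
    if "\<sigma>1 \<le> 1 \<and> 3/2 < \<sigma>1 + \<sigma>2 \<and> \<sigma>1 + \<sigma>2 \<le> 2 \<and> s1 \<noteq> 1" "\<sigma>1 + \<sigma>2 \<noteq> 2"
    using mean_square_strip(1)[of \<sigma>2 s1 0 "2 - \<sigma>1 - \<sigma>2"] that ns' by (simp add: \<sigma>1 right_diff_distrib)
  show "eq_up_to_O (mean_square s1 \<sigma>2) ?Z (\<lambda>T. (ln T)\<^sup>2)"
    if "\<sigma>1 \<le> 1 \<and> 3/2 < \<sigma>1 + \<sigma>2 \<and> \<sigma>1 + \<sigma>2 \<le> 2 \<and> s1 \<noteq> 1" "\<sigma>1 + \<sigma>2 = 2"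
    using mean_square_strip(2)[of \<sigma>2 s1 0 "2 - \<sigma>1 - \<sigma>2"] that ns' by (simp add: \<sigma>1 right_diff_distrib)
  show "eq_up_to_O (mean_square s1 \<sigma>2) ?Z (\<lambda>T. T powr (2 - 2 * \<sigma>2) * (ln T)\<^sup>2)"
    if "s1 = 1 \<and> 1/2 < \<sigma>2 \<and> \<sigma>2 \<le> 1" "\<sigma>2 \<noteq> 1"
    using mean_square_strip(1)[of \<sigma>2 s1 1 "1 - \<sigma>2"] that ns' by (simp add: \<sigma>1 right_diff_distrib)
  show "eq_up_to_O (mean_square s1 \<sigma>2) ?Z (\<lambda>T. (ln T) ^ 4)"
    if "s1 = 1 \<and> 1/2 < \<sigma>2 \<and> \<sigma>2 \<le> 1" "\<sigma>2 = 1"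
    using mean_square_strip(2)[of \<sigma>2 s1 1 "1 - \<sigma>2"] that ns' by (simp add: \<sigma>1 right_diff_distrib)
  show "eq_up_to_O (mean_square s1 \<sigma>2) (\<lambda>T. (cmod (riemann_zeta s1))\<^sup>2 * T * ln T) (\<lambda>T. T)"
    if "\<sigma>1 > 1 \<and> \<sigma>2 = 1/2"
  proof (rule mean_square_log)
    have \<sigma>2: "\<sigma>2 = 1/2" using that ..
    show "\<exists>D. \<forall>N\<ge>1. \<bar>diag_sum s1 \<sigma>2 N - (cmod (riemann_zeta s1))\<^sup>2 * ln (real N)\<bar> \<le> D"
      unfolding \<sigma>2 by (rule diag_sum_right) (use that in \<open>simp add: \<sigma>1\<close>)
  qed (use that ns' in \<open>auto simp: \<sigma>1\<close>)
  show "eq_up_to_O (mean_square s1 \<sigma>2) (\<lambda>T. 1 / (cmod (s1 - 1))\<^sup>2 * T * ln T) (\<lambda>T. T)"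
    if "\<sigma>1 + \<sigma>2 = 3/2 \<and> \<sigma>2 > 1/2"
  proof (rule mean_square_log)
    have "Re s1 < 1" using that by (simp add: \<sigma>1)
    then show "\<exists>D. \<forall>N\<ge>1. \<bar>diag_sum s1 \<sigma>2 N - 1 / (cmod (s1 - 1))\<^sup>2 * ln (real N)\<bar> \<le> D"
      using that by (intro diag_sum_left) (auto simp: \<sigma>1)
    show "s1 \<noteq> 1" "max 0 (1 - Re s1) + 1 - \<sigma>2 = 1/2" using \<open>Re s1 < 1\<close> that by (auto simp: \<sigma>1)
  qed (use that ns' in \<open>auto simp: \<sigma>1\<close>)
  show "eq_up_to_O (mean_square s1 \<sigma>2)
          (\<lambda>T. (1 / (cmod (s1 - 1))\<^sup>2 + (cmod (riemann_zeta s1))\<^sup>2) * T * ln T) (\<lambda>T. T)"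
    if "\<sigma>2 = 1/2 \<and> \<sigma>1 = 1 \<and> s1 \<noteq> 1"
  proof (rule mean_square_log)
    have \<sigma>2: "\<sigma>2 = 1/2" using that ..
    show "\<exists>D. \<forall>N\<ge>1. \<bar>diag_sum s1 \<sigma>2 N - (1 / (cmod (s1 - 1))\<^sup>2 + (cmod (riemann_zeta s1))\<^sup>2) * ln (real N)\<bar> \<le> D"
      unfolding \<sigma>2 by (rule diag_sum_line) (use that in \<open>auto simp: \<sigma>1\<close>)
  qed (use that ns' in \<open>auto simp: \<sigma>1\<close>)
  show "eq_up_to_O (mean_square s1 \<sigma>2) (\<lambda>T. T * (ln T) ^ 3 / 3) (\<lambda>T. T * (ln T)\<^sup>2)"
    if "\<sigma>2 = 1/2 \<and> s1 = 1"
  proof -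
    have eq: "\<sigma>2 = 1/2" "s1 = 1" using that by simp_all
    show ?thesis
      using mean_square_log_cube[OF ns'[unfolded eq]] unfolding eq .
  qed
qed

end
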